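(* Let $n\ge 3$ and let $M^n\subset\mathbb{R}^{n+1}$ be a closed embedded hypersurface with induced metric $g$. Assume that the Green function $G$ of the conformal Laplacian $P_2^g=-\Delta_g+\frac{n-2}{4(n-1)}R_g$ exists, and that for some $Q\in M$ one has $$G(P,Q)=c_{n,1}\,\|P-Q\|^{2-n}\qquad\text{for all } P\in M\setminus\{Q\},$$ where $c_{n,1}=\frac{\Gamma(\frac n2-1)}{4\pi^{n/2}}$. Then $(M,g)$ is a round sphere.
   Context: $\|\cdot\|$ is the Euclidean norm of $\mathbb{R}^{n+1}$, $\Delta_g$ is the Laplace-Beltrami operator (trace of the Hessian) and $R_g$ is the scalar curvature. Hypersurfaces are smooth; closed means compact without boundary. The Green function of $P_2^g$ with pole $Q$ is the solution of $P_2^gG(\cdot,Q)=\delta_Q$ in the sense of distributions on $(M,g)$. The constant equals $c_{n,1}=\frac{1}{(n-2)|\mathbb{S}^{n-1}|}$. *)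

theory Defs
  imports "HOL-Analysis.Analysis"
begin

section \<open>Smooth functions on open sets\<close>

primrec Ck_on :: "nat \<Rightarrow> 'a::euclidean_space set \<Rightarrow> ('a \<Rightarrow> 'b::euclidean_space) \<Rightarrow> bool" where
  "Ck_on 0 U f \<longleftrightarrow> continuous_on U f"
| "Ck_on (Suc k) U f \<longleftrightarrow>
     (\<forall>x\<in>U. f differentiable (at x)) \<and>
     (\<forall>v. Ck_on k U (\<lambda>x. frechet_derivative f (at x) v))"

text \<open>Meant for open \<open>U\<close>: the derivatives are two-sided.\<close>

definition smooth_on :: "'a::euclidean_space set \<Rightarrow> ('a \<Rightarrow> 'b::euclidean_space) \<Rightarrow> bool" where
  "smooth_on U f \<longleftrightarrow> (\<forall>k. Ck_on k U f)"

definition partial :: "'n::finite \<Rightarrow> (real^'n \<Rightarrow> 'b::euclidean_space) \<Rightarrow> real^'n \<Rightarrow> 'b" where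
  "partial i f u = frechet_derivative f (at u) (axis i 1)"


section \<open>Riemannian metrics in coordinates\<close>

text \<open>
  A metric on a coordinate domain is given by its matrix \<open>g u $ i $ j\<close>; its inverse
  \<open>matrix_inv (g u) $ i $ j\<close> is what is classically written with upper indices.
  \<open>christoffel g k i j u\<close> is the symbol with upper index \<open>k\<close> and lower indices \<open>i\<close>, \<open>j\<close>.
\<close>

definition christoffel ::
    "(real^'n \<Rightarrow> real^'n^'n) \<Rightarrow> 'n::finite \<Rightarrow> 'n \<Rightarrow> 'n \<Rightarrow> real^'n \<Rightarrow> real" where
  "christoffel g k i j u = (1/2) * (\<Sum>l\<in>UNIV. matrix_inv (g u) $ k $ l *
      (partial i (\<lambda>x. g x $ j $ l) u + partial j (\<lambda>x. g x $ i $ l) u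
        - partial l (\<lambda>x. g x $ i $ j) u))"

text \<open>The sign convention makes the Ricci curvature of round spheres positive.\<close>

definition ricci_coord ::
    "(real^'n \<Rightarrow> real^'n^'n) \<Rightarrow> 'n::finite \<Rightarrow> 'n \<Rightarrow> real^'n \<Rightarrow> real" where
  "ricci_coord g i j u =
     (\<Sum>k\<in>UNIV. partial k (christoffel g k i j) u - partial j (christoffel g k i k) u)
     + (\<Sum>k\<in>UNIV. \<Sum>l\<in>UNIV. christoffel g k k l u * christoffel g l i j u
                         - christoffel g k j l u * christoffel g l i k u)"

definition scalar_coord :: "(real^'n \<Rightarrow> real^'n^'n) \<Rightarrow> real^'n::finite \<Rightarrow> real" where
  "scalar_coord g u = (\<Sum>i\<in>UNIV. \<Sum>j\<in>UNIV. matrix_inv (g u) $ i $ j * ricci_coord g i j u)"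

definition hessian_coord ::
    "(real^'n \<Rightarrow> real^'n^'n) \<Rightarrow> (real^'n \<Rightarrow> real) \<Rightarrow> 'n::finite \<Rightarrow> 'n \<Rightarrow> real^'n \<Rightarrow> real" where
  "hessian_coord g f i j u =
     partial i (partial j f) u - (\<Sum>k\<in>UNIV. christoffel g k i j u * partial k f u)"

definition laplace_coord ::
    "(real^'n \<Rightarrow> real^'n^'n) \<Rightarrow> (real^'n \<Rightarrow> real) \<Rightarrow> real^'n::finite \<Rightarrow> real" where
  "laplace_coord g f u = (\<Sum>i\<in>UNIV. \<Sum>j\<in>UNIV. matrix_inv (g u) $ i $ j * hessian_coord g f i j u)"


section \<open>Hypersurfaces\<close>

text \<open>
  With \<open>n = CARD('n)\<close>, the ambient Euclidean space of dimension \<open>n + 1\<close> is \<open>real^('n option)\<close>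
  (note that \<open>CARD('n option) = CARD('n) + 1\<close>), and coordinates range over \<open>real^'n\<close>.
\<close>

definition local_parametrization ::
    "(real^('n::finite option)) set \<Rightarrow> (real^'n) set \<Rightarrow> (real^'n \<Rightarrow> real^('n option)) \<Rightarrow> bool" where
  "local_parametrization M U \<phi> \<longleftrightarrow>
     open U \<and> smooth_on U \<phi> \<and> (\<forall>u\<in>U. inj (frechet_derivative \<phi> (at u))) \<and>
     openin (top_of_set M) (\<phi> ` U) \<and> (\<exists>\<psi>. homeomorphism U (\<phi> ` U) \<phi> \<psi>)"

text \<open>
  Closed means compact without boundary; the latter holds because the domains \<open>U\<close> of the
  parametrizations are open. Connectedness is not required.
\<close>

definition closed_embedded_hypersurface :: "(real^('n::finite option)) set \<Rightarrow> bool" where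
  "closed_embedded_hypersurface M \<longleftrightarrow>
     compact M \<and> (\<forall>p\<in>M. \<exists>U \<phi>. local_parametrization M U \<phi> \<and> p \<in> \<phi> ` U)"

text \<open>Functions on \<open>M\<close> are total functions whose values outside \<open>M\<close> are irrelevant.\<close>

definition smooth_function ::
    "(real^('n::finite option)) set \<Rightarrow> (real^('n option) \<Rightarrow> real) \<Rightarrow> bool" where
  "smooth_function M f \<longleftrightarrow> (\<forall>U \<phi>. local_parametrization M U \<phi> \<longrightarrow> smooth_on U (f \<circ> \<phi>))"

definition induced_metric :: "(real^'n \<Rightarrow> real^('n::finite option)) \<Rightarrow> real^'n \<Rightarrow> real^'n^'n" where
  "induced_metric \<phi> u = (\<chi> i j. partial i \<phi> u \<bullet> partial j \<phi> u)"

text \<open>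
  An arbitrary parametrization around \<open>p\<close> with the coordinates of \<open>p\<close>. The Laplacian and the
  scalar curvature below do not depend on this choice, being coordinate invariant.
\<close>

definition chart_at ::
    "(real^('n::finite option)) set \<Rightarrow> real^('n option) \<Rightarrow> (real^'n \<Rightarrow> real^('n option)) \<times> (real^'n)" where
  "chart_at M p = (SOME (\<phi>, u). \<exists>U. local_parametrization M U \<phi> \<and> u \<in> U \<and> \<phi> u = p)"

definition laplace_beltrami ::
    "(real^('n::finite option)) set \<Rightarrow> (real^('n option) \<Rightarrow> real) \<Rightarrow> real^('n option) \<Rightarrow> real" where
  "laplace_beltrami M f p =
     (let (\<phi>, u) = chart_at M p in laplace_coord (induced_metric \<phi>) (f \<circ> \<phi>) u)"

definition scalar_curvature ::
    "(real^('n::finite option)) set \<Rightarrow> real^('n option) \<Rightarrow> real" where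
  "scalar_curvature M p =
     (let (\<phi>, u) = chart_at M p in scalar_coord (induced_metric \<phi>) u)"

text \<open>
  \<open>\<mu>\<close> is the Riemannian volume measure of \<open>M\<close>: in every parametrization it has density
  \<open>sqrt (det g)\<close> with respect to Lebesgue measure. Such a measure exists on every closed embedded
  hypersurface and is unique.
\<close>

definition riemannian_volume ::
    "(real^('n::finite option)) set \<Rightarrow> (real^('n option)) measure \<Rightarrow> bool" where
  "riemannian_volume M \<mu> \<longleftrightarrow>
     space \<mu> = M \<and> sets \<mu> = sets (restrict_space borel M) \<and>
     (\<forall>U \<phi>. local_parametrization M U \<phi> \<longrightarrow>
       (\<forall>B\<in>sets borel. B \<subseteq> \<phi> ` U \<longrightarrow>
         emeasure \<mu> B =
           (\<integral>\<^sup>+u. ennreal (sqrt (det (induced_metric \<phi> u))) * indicator {u\<in>U. \<phi> u \<in> B} u \<partial>lborel)))"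


section \<open>The conformal Laplacian and its Green function\<close>

definition conformal_laplacian ::
    "(real^('n::finite option)) set \<Rightarrow> (real^('n option) \<Rightarrow> real) \<Rightarrow> real^('n option) \<Rightarrow> real" where
  "conformal_laplacian M f p =
     - laplace_beltrami M f p
     + (real CARD('n) - 2) / (4 * (real CARD('n) - 1)) * scalar_curvature M p * f p"

text \<open>
  The distributional equation is tested against smooth functions; no support condition is needed
  since \<open>M\<close> is compact, and the operator is moved to the test function by formal self-adjointness.
  The value of \<open>G\<close> on the diagonal is irrelevant, points being null sets.
\<close>

definition green_function ::
    "(real^('n::finite option)) set \<Rightarrow> (real^('n option)) measure \<Rightarrow>
     (real^('n option) \<Rightarrow> real^('n option) \<Rightarrow> real) \<Rightarrow> bool" where
  "green_function M \<mu> G \<longleftrightarrow>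
     (\<forall>Q\<in>M. integrable \<mu> (\<lambda>P. G P Q) \<and>
       (\<forall>f. smooth_function M f \<longrightarrow> (\<integral>P. G P Q * conformal_laplacian M f P \<partial>\<mu>) = f Q))"

end

theory Submission
  imports Defs
begin

text \<open>
  Write \<open>y = P - Q\<close>, let \<open>II\<close> be the second fundamental form of \<open>M\<close> with values in the normal space, \<open>H\<close>
  its trace, \<open>g\<close> the induced metric and \<open>y'\<close> the component of \<open>y\<close> normal to \<open>M\<close> at \<open>P\<close>. Away from the pole the
  Green function is smooth, and integration by parts turns the distributional equation into the pointwise
  equation \<open>P_2 G = 0\<close> (lemma \<open>green_function_pointwise\<close>). For a multiple of \<open>|y|^(2-n)\<close> the Gauss equation
  \<open>R = |H|^2 - |II|^2\<close> makes this a condition on the second fundamental form alone,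
  \<open>|tr B|^2 = |B|^2\<close> with \<open>B = II + 2 (y' / |y|^2) g\<close>
  (lemma \<open>green_function_curvature_equation\<close>). Up to scaling and a reflection, \<open>B\<close> is the second fundamental
  form of the image of \<open>M - {Q}\<close> under inversion at \<open>Q\<close>, so the condition says that this image, which has
  one end coming from \<open>Q\<close>, is scalar flat. The theorem states that it is a hyperplane.

  The condition has two consequences. First, in the limit \<open>P \<rightarrow> Q\<close> along a direction \<open>\<xi>\<close> it becomes a quadratic
  equation for the normal curvature of \<open>M\<close> at \<open>Q\<close> in direction \<open>\<xi>\<close>, with coefficients independent of \<open>\<xi>\<close>. By
  connectedness the normal curvature is a constant \<open>2 \<kappa>\<close> (lemma \<open>umbilic_at_pole\<close>), so with a unit normal
  \<open>\<nu>\<close> at \<open>Q\<close> the quotient \<open>(y \<bullet> \<nu>) / |y|^2\<close>, which is the height of the inverted point, tends to \<open>\<kappa>\<close> at \<open>Q\<close>.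
  Secondly, there is a maximum principle (lemma \<open>quotient_bound\<close>). If the quotient exceeded \<open>\<kappa>\<close> somewhere,
  then for small \<open>\<epsilon> > 0\<close> the function \<open>(y \<bullet> \<nu> + \<epsilon>) / |y|^2\<close> would have a local maximum above that level, and \<open>B\<close>
  would be definite there; but a definite form in dimension at least two satisfies \<open>|tr B|^2 > |B|^2\<close>.
  Applied to \<open>\<nu>\<close> and \<open>- \<nu>\<close> this shows that the quotient is identically \<open>\<kappa>\<close>, so \<open>M\<close> lies in a sphere or a
  hyperplane, and by invariance of domain a compact hypersurface without boundary in one of these is the
  whole sphere (lemma \<open>hypersurface_in_quadric\<close>).

  The Laplacian and the scalar curvature are evaluated in an arbitrary parametrization chosen separately
  at every point, so the integration by parts in one parametrization presupposes that both are
  independent of the choice. This is obtained (locale \<open>chart_change\<close>) by comparing second-order Taylor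
  expansions of two parametrizations at a common point, which determines how the second fundamental form
  transforms without any regularity theory for transition maps. Test functions are restrictions of
  ambient bump functions, which are smooth in every parametrization by the chain rule.
\<close>

section \<open>Calculus of smooth maps\<close>

abbreviation D :: "('a::euclidean_space \<Rightarrow> 'b::euclidean_space) \<Rightarrow> 'a \<Rightarrow> 'a \<Rightarrow> 'b" where
  "D f x \<equiv> frechet_derivative f (at x)"

lemma has_frechet_derivative:
  "f differentiable (at x) \<Longrightarrow> (f has_derivative D f x) (at x)"
  using frechet_derivative_works by blast

lemma Ck_on_cong:
  fixes f g :: "'a::euclidean_space \<Rightarrow> 'b::euclidean_space"
  assumes U: "open U" and "Ck_on k U f" and "\<And>x. x \<in> U \<Longrightarrow> f x = g x"
  shows "Ck_on k U g"
  using assms(2,3)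
proof (induction k arbitrary: f g)
  case 0
  then show ?case using continuous_on_cong by force
next
  case (Suc k)
  have d: "(g has_derivative D f x) (at x)" if "x \<in> U" for x
    by (rule has_derivative_transform_within_open[OF has_frechet_derivative U that])
       (use Suc that in auto)
  have "g differentiable (at x)" if "x \<in> U" for x
    using d[OF that] differentiable_def by blast
  moreover have "Ck_on k U (\<lambda>x. D g x v)" for v
    by (rule Suc.IH[of "\<lambda>x. D f x v"])
       (use Suc.prems frechet_derivative_at[OF d] in auto)
  ultimately show ?case by simp
qed

lemma Ck_on_Suc_intro:
  fixes f :: "'a::euclidean_space \<Rightarrow> 'b::euclidean_space"
  assumes U: "open U" and f': "\<And>x. x \<in> U \<Longrightarrow> (f has_derivative f' x) (at x)"
    and C: "\<And>v. Ck_on k U (\<lambda>x. f' x v)"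
  shows "Ck_on (Suc k) U f"
proof -
  have "f differentiable (at x)" if "x \<in> U" for x
    using f'[OF that] differentiable_def by blast
  moreover have "Ck_on k U (\<lambda>x. D f x v)" for v
    by (rule Ck_on_cong[OF U C]) (use frechet_derivative_at[OF f'] in auto)
  ultimately show ?thesis by simp
qed

lemma Ck_on_pred: "Ck_on (Suc k) U f \<Longrightarrow> Ck_on k U f"
proof (induction k arbitrary: f)
  case 0
  then show ?case
    by (auto intro!: continuous_at_imp_continuous_on differentiable_imp_continuous_within)
next
  case (Suc k)
  then show ?case by (metis Ck_on.simps(2))
qed

lemma Ck_on_const: "Ck_on k U (\<lambda>x. c)"
  by (induction k arbitrary: c) auto

lemma Ck_on_add:
  fixes f g :: "'a::euclidean_space \<Rightarrow> 'b::euclidean_space"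
  assumes U: "open U"
  shows "Ck_on k U f \<Longrightarrow> Ck_on k U g \<Longrightarrow> Ck_on k U (\<lambda>x. f x + g x)"
proof (induction k arbitrary: f g)
  case 0
  then show ?case by (auto intro: continuous_intros)
next
  case (Suc k)
  show ?case
    by (rule Ck_on_Suc_intro[OF U, where f' = "\<lambda>x v. D f x v + D g x v"])
       (use Suc U in \<open>auto intro!: has_derivative_add has_frechet_derivative\<close>)
qed

lemma Ck_on_bilinear:
  fixes f :: "'a::euclidean_space \<Rightarrow> 'b::euclidean_space" and g :: "'a \<Rightarrow> 'c::euclidean_space"
    and pr :: "'b \<Rightarrow> 'c \<Rightarrow> 'd::euclidean_space"
  assumes U: "open U" and pr: "bounded_bilinear pr"
  shows "Ck_on k U f \<Longrightarrow> Ck_on k U g \<Longrightarrow> Ck_on k U (\<lambda>x. pr (f x) (g x))"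
proof (induction k arbitrary: f g)
  case 0
  then show ?case by (auto intro: bounded_bilinear.continuous_on[OF pr])
next
  case (Suc k)
  have 1: "Ck_on k U f" "Ck_on k U g" using Suc.prems Ck_on_pred by blast+
  show ?case
  proof (rule Ck_on_Suc_intro[OF U, where f' = "\<lambda>x v. pr (f x) (D g x v) + pr (D f x v) (g x)"])
    show "((\<lambda>x. pr (f x) (g x)) has_derivative (\<lambda>v. pr (f x) (D g x v) + pr (D f x v) (g x))) (at x)" if "x \<in> U" for x
      by (rule bounded_bilinear.FDERIV[OF pr]) (use Suc that in \<open>auto intro!: has_frechet_derivative\<close>)
  qed (use Suc 1 U in \<open>auto intro!: Ck_on_add Suc.IH\<close>)
qed

lemma Ck_on_bounded_linear:
  fixes f :: "'a::euclidean_space \<Rightarrow> 'b::euclidean_space" and L :: "'b \<Rightarrow> 'c::euclidean_space"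
  assumes U: "open U" and L: "bounded_linear L"
  shows "Ck_on k U f \<Longrightarrow> Ck_on k U (\<lambda>x. L (f x))"
proof (induction k arbitrary: f)
  case 0
  then show ?case by (auto intro: bounded_linear.continuous_on[OF L])
next
  case (Suc k)
  show ?case
    by (rule Ck_on_Suc_intro[OF U, where f' = "\<lambda>x v. L (D f x v)"])
       (use Suc U in \<open>auto intro!: bounded_linear.has_derivative[OF L] has_frechet_derivative\<close>)
qed

lemma Ck_on_ident: "open U \<Longrightarrow> Ck_on k U (\<lambda>x. x)"
  by (cases k) (auto intro!: Ck_on_const)

lemma Ck_on_sum:
  fixes f :: "'i \<Rightarrow> 'a::euclidean_space \<Rightarrow> 'b::euclidean_space"
  assumes U: "open U" and "\<And>i. i \<in> I \<Longrightarrow> Ck_on k U (f i)"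
  shows "Ck_on k U (\<lambda>x. \<Sum>i\<in>I. f i x)"
  using assms(2) by (induction I rule: infinite_finite_induct) (auto intro: Ck_on_const Ck_on_add[OF U])

lemma linear_basis_expansion:
  fixes L :: "'a::euclidean_space \<Rightarrow> 'b::real_vector"
  assumes "linear L" shows "L v = (\<Sum>b\<in>Basis. (v \<bullet> b) *\<^sub>R L b)"
proof -
  have "L v = L (\<Sum>b\<in>Basis. (v \<bullet> b) *\<^sub>R b)" by (simp add: euclidean_representation)
  also have "\<dots> = (\<Sum>b\<in>Basis. (v \<bullet> b) *\<^sub>R L b)"
    by (simp add: linear_sum[OF assms] linear_cmul[OF assms])
  finally show ?thesis .
qed

text \<open>
  Expanding the derivative of the outer function in the fixed ambient basis makes the chain rule a
  finite sum of products of maps to which the induction hypothesis applies.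
\<close>

lemma Ck_on_compose:
  fixes f :: "'b::euclidean_space \<Rightarrow> 'c::euclidean_space" and \<phi> :: "'a::euclidean_space \<Rightarrow> 'b"
  assumes U: "open U" and V: "open V" and \<phi>V: "\<And>x. x \<in> U \<Longrightarrow> \<phi> x \<in> V"
  shows "Ck_on k V f \<Longrightarrow> Ck_on k U \<phi> \<Longrightarrow> Ck_on k U (\<lambda>x. f (\<phi> x))"
proof (induction k arbitrary: f)
  case 0
  then show ?case using \<phi>V continuous_on_compose2[of V f U \<phi>] by auto
next
  case (Suc k)
  have 1: "Ck_on k U \<phi>" using Suc.prems Ck_on_pred by blast
  have 2: "Ck_on k U (\<lambda>x. D \<phi> x v)" for v using Suc.prems by simp
  let ?D = "\<lambda>x v. \<Sum>b\<in>Basis. (D \<phi> x v \<bullet> b) *\<^sub>R D f (\<phi> x) b"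
  show ?case
  proof (rule Ck_on_Suc_intro[OF U, where f' = ?D])
    fix x assume x: "x \<in> U"
    have df: "(f has_derivative D f (\<phi> x)) (at (\<phi> x))"
      using Suc.prems \<phi>V[OF x] by (auto intro!: has_frechet_derivative)
    have "((\<lambda>x. f (\<phi> x)) has_derivative (\<lambda>v. D f (\<phi> x) (D \<phi> x v))) (at x)"
      by (rule has_derivative_compose[where f = \<phi> and g = f, OF _ df]) (use Suc.prems x in \<open>auto intro: has_frechet_derivative\<close>)
    then show "((\<lambda>x. f (\<phi> x)) has_derivative ?D x) (at x)"
      by (subst (asm) linear_basis_expansion[OF has_derivative_linear[OF df]])
  next
    fix v
    show "Ck_on k U (\<lambda>x. ?D x v)"
    proof (rule Ck_on_sum[OF U])
      fix b :: 'b assume "b \<in> Basis"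
      show "Ck_on k U (\<lambda>x. (D \<phi> x v \<bullet> b) *\<^sub>R D f (\<phi> x) b)"
        by (rule Ck_on_bilinear[OF U bounded_bilinear_scaleR Ck_on_bounded_linear[OF U bounded_linear_inner_left 2]])
           (use Suc 1 in auto)
    qed
  qed
qed

lemma smooth_on_cong:
  "open U \<Longrightarrow> smooth_on U f \<Longrightarrow> (\<And>x. x \<in> U \<Longrightarrow> f x = g x) \<Longrightarrow> smooth_on U g"
  unfolding smooth_on_def using Ck_on_cong by blast

lemma smooth_on_const: "smooth_on U (\<lambda>x. c)"
  by (simp add: smooth_on_def Ck_on_const)

lemma smooth_on_ident: "open U \<Longrightarrow> smooth_on U (\<lambda>x. x)"
  by (simp add: smooth_on_def Ck_on_ident)

lemma smooth_on_add: "open U \<Longrightarrow> smooth_on U f \<Longrightarrow> smooth_on U g \<Longrightarrow> smooth_on U (\<lambda>x. f x + g x)"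
  by (simp add: smooth_on_def Ck_on_add)

lemma smooth_on_bounded_linear:
  "open U \<Longrightarrow> bounded_linear L \<Longrightarrow> smooth_on U f \<Longrightarrow> smooth_on U (\<lambda>x. L (f x))"
  by (simp add: smooth_on_def Ck_on_bounded_linear)

lemma smooth_on_minus: "open U \<Longrightarrow> smooth_on U f \<Longrightarrow> smooth_on U (\<lambda>x. - f x)"
  by (rule smooth_on_bounded_linear[OF _ bounded_linear_minus[OF bounded_linear_ident]])

lemma smooth_on_diff: "open U \<Longrightarrow> smooth_on U f \<Longrightarrow> smooth_on U g \<Longrightarrow> smooth_on U (\<lambda>x. f x - g x)"
  using smooth_on_add[of U f "\<lambda>x. - g x"] smooth_on_minus by auto

lemma smooth_on_scaleR:
  "open U \<Longrightarrow> smooth_on U f \<Longrightarrow> smooth_on U g \<Longrightarrow> smooth_on U (\<lambda>x. f x *\<^sub>R g x)"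
  by (simp add: smooth_on_def Ck_on_bilinear[OF _ bounded_bilinear_scaleR])

lemma smooth_on_mult:
  fixes f g :: "'a::euclidean_space \<Rightarrow> real"
  shows "open U \<Longrightarrow> smooth_on U f \<Longrightarrow> smooth_on U g \<Longrightarrow> smooth_on U (\<lambda>x. f x * g x)"
  by (simp add: smooth_on_def Ck_on_bilinear[OF _ bounded_bilinear_mult])

lemma smooth_on_inner:
  "open U \<Longrightarrow> smooth_on U f \<Longrightarrow> smooth_on U g \<Longrightarrow> smooth_on U (\<lambda>x. f x \<bullet> g x)"
  by (simp add: smooth_on_def Ck_on_bilinear[OF _ bounded_bilinear_inner])

lemma smooth_on_sum:
  "open U \<Longrightarrow> (\<And>i. i \<in> I \<Longrightarrow> smooth_on U (f i)) \<Longrightarrow> smooth_on U (\<lambda>x. \<Sum>i\<in>I. f i x)"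
  by (simp add: smooth_on_def Ck_on_sum)

lemma smooth_on_prod:
  fixes f :: "'i \<Rightarrow> 'a::euclidean_space \<Rightarrow> real"
  assumes U: "open U" and "\<And>i. i \<in> I \<Longrightarrow> smooth_on U (f i)"
  shows "smooth_on U (\<lambda>x. \<Prod>i\<in>I. f i x)"
  using assms(2)
  by (induction I rule: infinite_finite_induct) (auto intro: smooth_on_const smooth_on_mult[OF U])

lemma smooth_on_compose:
  "open U \<Longrightarrow> open V \<Longrightarrow> (\<And>x. x \<in> U \<Longrightarrow> \<phi> x \<in> V) \<Longrightarrow> smooth_on V f \<Longrightarrow> smooth_on U \<phi>
    \<Longrightarrow> smooth_on U (\<lambda>x. f (\<phi> x))"
  by (simp add: smooth_on_def Ck_on_compose)

lemma smooth_on_subset: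
  assumes "smooth_on U f" "V \<subseteq> U" shows "smooth_on V f"
proof -
  have "Ck_on k U f \<Longrightarrow> Ck_on k V f" for k
    using assms(2) by (induction k arbitrary: f) (auto intro: continuous_on_subset)
  then show ?thesis using assms(1) by (simp add: smooth_on_def)
qed

lemma smooth_on_imp_differentiable: "smooth_on U f \<Longrightarrow> x \<in> U \<Longrightarrow> f differentiable (at x)"
  unfolding smooth_on_def by (metis Ck_on.simps(2))

lemma smooth_on_imp_continuous_on: "smooth_on U f \<Longrightarrow> continuous_on U f"
  unfolding smooth_on_def by (metis Ck_on.simps(1))

lemma smooth_on_frechet: "smooth_on U f \<Longrightarrow> smooth_on U (\<lambda>x. D f x v)"
  unfolding smooth_on_def by (metis Ck_on.simps(2))

lemma smooth_on_partial: "smooth_on U f \<Longrightarrow> smooth_on U (partial i f)"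
  unfolding partial_def[abs_def] by (rule smooth_on_frechet)

lemma powr_smooth_on: "smooth_on {0<..} (\<lambda>x::real. x powr a)"
proof -
  have "Ck_on k {0<..} (\<lambda>x::real. x powr a)" for k
  proof (induction k arbitrary: a)
    case 0
    then show ?case by (auto intro!: continuous_intros)
  next
    case (Suc k)
    show ?case
    proof (rule Ck_on_Suc_intro[where f' = "\<lambda>x v. a * x powr (a - 1) * v"])
      show "((\<lambda>x::real. x powr a) has_derivative (\<lambda>v. a * x powr (a - 1) * v)) (at x)" if "x \<in> {0<..}" for x
        using has_real_derivative_powr[of x a] that by (simp add: has_field_derivative_def)
      have "Ck_on k {0<..} (\<lambda>x. (a * v) * (x powr (a - 1)))" for v
        by (intro Ck_on_bounded_linear[OF _ bounded_linear_mult_right Suc.IH]) auto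
      then show "Ck_on k {0<..} (\<lambda>x. a * x powr (a - 1) * v)" for v
        by (rule back_subst[of "Ck_on k {0<..}"]) (auto simp: mult_ac)
    qed auto
  qed
  then show ?thesis by (simp add: smooth_on_def)
qed

lemma smooth_on_powr:
  fixes f :: "'a::euclidean_space \<Rightarrow> real"
  shows "open U \<Longrightarrow> smooth_on U f \<Longrightarrow> (\<And>x. x \<in> U \<Longrightarrow> 0 < f x) \<Longrightarrow> smooth_on U (\<lambda>x. f x powr a)"
  by (rule smooth_on_compose[OF _ _ _ powr_smooth_on]) auto

section \<open>Smooth bump functions\<close>

text \<open>
  The functions \<open>p (1 / t) exp (- 1 / t)\<close>, extended by zero to \<open>t \<le> 0\<close>. Allowing an arbitrary polynomial
  \<open>p\<close> makes the family closed under differentiation, so that smoothness is an induction on the order.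
\<close>

definition flat_exp :: "real poly \<Rightarrow> real \<Rightarrow> real" where
  "flat_exp p t = (if t > 0 then poly p (1 / t) * exp (- (1 / t)) else 0)"

lemma poly_times_exp_minus_tendsto_0:
  "((\<lambda>x::real. poly p x * exp (- x)) \<longlongrightarrow> 0) at_top"
proof -
  have "((\<lambda>x::real. coeff p i * (x ^ i / exp x)) \<longlongrightarrow> coeff p i * 0) at_top" for i
    by (intro tendsto_intros tendsto_power_div_exp_0)
  then have "((\<lambda>x::real. \<Sum>i\<le>degree p. coeff p i * (x ^ i / exp x)) \<longlongrightarrow> (\<Sum>i\<le>degree p. coeff p i * 0)) at_top"
    by (intro tendsto_sum) auto
  then show ?thesis
    by (simp add: poly_altdef sum_distrib_right exp_minus divide_inverse mult.assoc)
qed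

lemma flat_exp_has_derivative:
  "(flat_exp p has_real_derivative flat_exp ([:0,0,1:] * (p - pderiv p)) t) (at t)"
proof (cases "t = 0")
  case False
  show ?thesis
  proof (cases "t > 0")
    case True
    have "((\<lambda>t. poly p (1 / t) * exp (- (1 / t))) has_real_derivative
       flat_exp ([:0,0,1:] * (p - pderiv p)) t) (at t)"
      unfolding flat_exp_def using True
      by (auto intro!: derivative_eq_intros DERIV_chain2[OF poly_DERIV] simp: field_simps power2_eq_square)
    then show ?thesis
      by (rule DERIV_cong_ev[THEN iffD1, rotated -1])
         (use True eventually_nhds_in_open[of "{0<..}" t] in \<open>auto simp: flat_exp_def elim!: eventually_mono\<close>)
  next
    case F: False
    have "((\<lambda>t. 0) has_real_derivative flat_exp ([:0,0,1:] * (p - pderiv p)) t) (at t)"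
      using F by (simp add: flat_exp_def)
    then show ?thesis
      by (rule DERIV_cong_ev[THEN iffD1, rotated -1])
         (use F False eventually_nhds_in_open[of "{..<0}" t] in \<open>auto simp: flat_exp_def elim!: eventually_mono\<close>)
  qed
next
  case True
  have "((\<lambda>h. flat_exp p h / h) \<longlongrightarrow> 0) (at_right 0)"
  proof -
    have "((\<lambda>h. poly ([:0,1:] * p) (inverse h) * exp (- inverse h)) \<longlongrightarrow> 0) (at_right (0::real))"
      by (rule filterlim_compose[OF poly_times_exp_minus_tendsto_0 filterlim_inverse_at_top_right])
    then show ?thesis
      by (rule Lim_transform_eventually)
         (auto simp: flat_exp_def eventually_at_right_less divide_inverse mult_ac
            intro!: eventually_mono[OF eventually_at_right_less])
  qed
  moreover have "((\<lambda>h. flat_exp p h / h) \<longlongrightarrow> 0) (at_left 0)"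
    by (rule Lim_transform_eventually[OF tendsto_const])
       (auto simp: flat_exp_def eventually_at_filter)
  ultimately have "((\<lambda>h. flat_exp p h / h) \<longlongrightarrow> 0) (at 0)"
    using filterlim_split_at by blast
  then show ?thesis
    using True by (simp add: DERIV_def flat_exp_def)
qed

lemma flat_exp_smooth: "smooth_on UNIV (flat_exp p)"
proof -
  have "Ck_on k UNIV (flat_exp p)" for k
  proof (induction k arbitrary: p)
    case 0
    then show ?case
      using DERIV_isCont[OF flat_exp_has_derivative] by (simp add: continuous_on_eq_continuous_at)
  next
    case (Suc k)
    show ?case
    proof (rule Ck_on_Suc_intro[where f' = "\<lambda>x v. flat_exp ([:0,0,1:] * (p - pderiv p)) x * v"])
      show "(flat_exp p has_derivative (\<lambda>v. flat_exp ([:0,0,1:] * (p - pderiv p)) x * v)) (at x)" for x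
        using flat_exp_has_derivative[of p x] by (simp add: has_field_derivative_def)
      show "Ck_on k UNIV (\<lambda>x. flat_exp ([:0,0,1:] * (p - pderiv p)) x * v)" for v
        by (rule Ck_on_bounded_linear[OF _ bounded_linear_mult_left Suc.IH]) auto
    qed auto
  qed
  then show ?thesis by (simp add: smooth_on_def)
qed

lemma smooth_bump_exists:
  fixes p :: "'a::euclidean_space"
  assumes "\<delta> > 0"
  obtains F :: "'a \<Rightarrow> real" where "smooth_on UNIV F" "\<And>x. F x \<ge> 0" "F p > 0"
    "\<And>x. x \<notin> ball p \<delta> \<Longrightarrow> F x = 0"
proof
  let ?F = "\<lambda>x. flat_exp 1 (\<delta>\<^sup>2 - (x - p) \<bullet> (x - p))"
  show "smooth_on UNIV ?F"
    by (rule smooth_on_compose[OF _ _ _ flat_exp_smooth])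
       (auto intro!: smooth_on_diff smooth_on_const smooth_on_inner smooth_on_ident)
  show "?F x = 0" if "x \<notin> ball p \<delta>" for x
  proof -
    have "\<delta>\<^sup>2 \<le> (norm (x - p))\<^sup>2"
      using that assms by (intro power_mono) (auto simp: dist_norm norm_minus_commute)
    then show ?thesis by (simp add: flat_exp_def dot_square_norm)
  qed
qed (use assms in \<open>auto simp: flat_exp_def\<close>)

section \<open>Second derivatives and Taylor expansions\<close>

lemma has_derivative_line:
  fixes f :: "'a::euclidean_space \<Rightarrow> 'b::euclidean_space"
  assumes "f differentiable (at (u + t *\<^sub>R v))"
  shows "((\<lambda>t. f (u + t *\<^sub>R v)) has_vector_derivative D f (u + t *\<^sub>R v) v) (at t)"
proof -
  have 1: "((\<lambda>t. u + t *\<^sub>R v) has_derivative (\<lambda>h. h *\<^sub>R v)) (at t)"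
    by (auto intro!: derivative_eq_intros)
  have 2: "((\<lambda>t. f (u + t *\<^sub>R v)) has_derivative (\<lambda>h. D f (u + t *\<^sub>R v) (h *\<^sub>R v))) (at t)"
    by (rule has_derivative_compose[OF 1 has_frechet_derivative[OF assms]])
  show ?thesis
    using 2 linear_cmul[OF linear_frechet_derivative[OF assms]]
    by (simp add: has_vector_derivative_def)
qed

text \<open>
  The mean value theorem in the direction \<open>v\<close> turns the second difference quotient into a first
  difference quotient of the derivative along \<open>v\<close>. The quotient is symmetric in \<open>v\<close> and \<open>w\<close>, whence the
  symmetry of the second derivative.
\<close>

lemma second_difference_tendsto:
  fixes f :: "'a::euclidean_space \<Rightarrow> real"
  assumes U: "open U" "u \<in> U" and f: "\<And>x. x \<in> U \<Longrightarrow> f differentiable (at x)"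
    and f': "(\<lambda>x. D f x v) differentiable (at u)"
  shows "((\<lambda>t. (f (u + t *\<^sub>R v + t *\<^sub>R w) - f (u + t *\<^sub>R v) - f (u + t *\<^sub>R w) + f u) / t\<^sup>2)
    \<longlongrightarrow> D (\<lambda>x. D f x v) u w) (at_right 0)"
    (is "(?S \<longlongrightarrow> ?D w) _")
proof (rule tendstoI)
  fix e :: real assume e: "e > 0"
  define df where "df = (\<lambda>x. D f x v)"
  define K where "K = 2 * norm v + norm w + 1"
  have K: "K > 0" by (simp add: K_def add_nonneg_pos)
  have lin: "linear ?D" using linear_frechet_derivative[OF f'] .
  obtain r where r: "r > 0" "ball u r \<subseteq> U" using U open_contains_ball by blast
  have "(df has_derivative ?D) (at u)" using has_frechet_derivative[OF f'] by (simp add: df_def)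
  then obtain d where d: "d > 0"
    "\<And>x. norm (x - u) < d \<Longrightarrow> norm (df x - df u - ?D (x - u)) \<le> (e / (4 * K)) * norm (x - u)"
    unfolding has_derivative_at_alt using e K by (metis divide_pos_pos mult_pos_pos zero_less_numeral)
  define m where "m = min r d / K"
  have m: "m > 0" using r d K by (simp add: m_def)
  have "dist (?S t) (?D w) < e" if t: "0 < t" "t < m" for t
  proof -
    have tK: "t * K < r" "t * K < d"
      using t K by (simp_all add: m_def field_simps)
    have nb: "norm (c *\<^sub>R v + b *\<^sub>R w) \<le> t * K" if "0 \<le> c" "c \<le> t" "0 \<le> b" "b \<le> t" for c b
    proof -
      have "norm (c *\<^sub>R v + b *\<^sub>R w) \<le> c * norm v + b * norm w"
        using norm_triangle_ineq[of "c *\<^sub>R v" "b *\<^sub>R w"] that by simp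
      also have "\<dots> \<le> t * norm v + t * norm w"
        using that by (intro add_mono mult_right_mono) auto
      also have "\<dots> \<le> t * K" using t by (simp add: K_def algebra_simps)
      finally show ?thesis .
    qed
    have inU: "u + c *\<^sub>R v + b *\<^sub>R w \<in> U" if "0 \<le> c" "c \<le> t" "0 \<le> b" "b \<le> t" for c b
    proof -
      have "u + (c *\<^sub>R v + b *\<^sub>R w) \<in> ball u r"
        using nb[OF that] tK by (metis add.right_neutral dist_add_cancel dist_0_norm le_less_trans mem_ball)
      then show ?thesis using r by (auto simp: add.assoc)
    qed
    define q where "q = (\<lambda>c. f (u + c *\<^sub>R v + t *\<^sub>R w) - f (u + c *\<^sub>R v))"
    have dq: "(q has_real_derivative (df (u + c *\<^sub>R v + t *\<^sub>R w) - df (u + c *\<^sub>R v))) (at c)"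
      if "0 \<le> c" "c \<le> t" for c
    proof -
      have a: "((\<lambda>c. f ((u + t *\<^sub>R w) + c *\<^sub>R v)) has_vector_derivative df ((u + t *\<^sub>R w) + c *\<^sub>R v)) (at c)"
        unfolding df_def
        by (rule has_derivative_line) (use f inU[of c t] that t in \<open>simp add: ac_simps\<close>)
      have b: "((\<lambda>c. f (u + c *\<^sub>R v)) has_vector_derivative df (u + c *\<^sub>R v)) (at c)"
        unfolding df_def
        by (rule has_derivative_line) (use f inU[of c 0] that t in \<open>simp add: ac_simps\<close>)
      have eq: "(u + t *\<^sub>R w) + c *\<^sub>R v = u + c *\<^sub>R v + t *\<^sub>R w" for c by (simp add: ac_simps)
      show ?thesis
        using has_vector_derivative_diff[OF a b]
        unfolding q_def eq has_real_derivative_iff_has_vector_derivative .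
    qed
    obtain z where z: "0 < z" "z < t" "q t - q 0 = (t - 0) * (df (u + z *\<^sub>R v + t *\<^sub>R w) - df (u + z *\<^sub>R v))"
      using MVT2[OF t(1), of q "\<lambda>c. df (u + c *\<^sub>R v + t *\<^sub>R w) - df (u + c *\<^sub>R v)"] dq by blast
    have S: "?S t = (df (u + z *\<^sub>R v + t *\<^sub>R w) - df (u + z *\<^sub>R v)) / t"
    proof -
      have "?S t = (q t - q 0) / t\<^sup>2" by (simp add: q_def)
      then show ?thesis using z(3) t by (simp add: power2_eq_square)
    qed
    have x1: "\<bar>df (u + z *\<^sub>R v + t *\<^sub>R w) - df u - ?D (z *\<^sub>R v + t *\<^sub>R w)\<bar> \<le> e / (4 * K) * (t * K)"
    proof -
      have "norm (df (u + (z *\<^sub>R v + t *\<^sub>R w)) - df u - ?D (z *\<^sub>R v + t *\<^sub>R w)) \<le> e / (4 * K) * norm (z *\<^sub>R v + t *\<^sub>R w)"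
        using d(2)[of "u + (z *\<^sub>R v + t *\<^sub>R w)"] nb[of z t] z t tK by simp
      also have "\<dots> \<le> e / (4 * K) * (t * K)"
        using nb[of z t] z t e K by (intro mult_left_mono) auto
      finally show ?thesis by (simp add: add.assoc)
    qed
    have x2: "\<bar>df (u + z *\<^sub>R v) - df u - ?D (z *\<^sub>R v)\<bar> \<le> e / (4 * K) * (t * K)"
    proof -
      have "norm (df (u + z *\<^sub>R v) - df u - ?D (z *\<^sub>R v)) \<le> e / (4 * K) * norm (z *\<^sub>R v)"
        using d(2)[of "u + z *\<^sub>R v"] nb[of z 0] z t tK by simp
      also have "\<dots> \<le> e / (4 * K) * (t * K)"
        using nb[of z 0] z t e K by (intro mult_left_mono) auto
      finally show ?thesis by simp
    qed
    have D: "?D (z *\<^sub>R v + t *\<^sub>R w) = ?D (z *\<^sub>R v) + t * ?D w"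
      by (simp add: linear_add[OF lin] linear_cmul[OF lin])
    have eq: "e / (4 * K) * (t * K) = t * e / 4" using K by simp
    have "\<bar>(df (u + z *\<^sub>R v + t *\<^sub>R w) - df (u + z *\<^sub>R v)) - t * ?D w\<bar> \<le> t * e / 2"
      using x1 x2 unfolding D eq by linarith
    then have "\<bar>t * (?S t - ?D w)\<bar> \<le> t * e / 2"
    proof -
      have "t * ?S t = df (u + z *\<^sub>R v + t *\<^sub>R w) - df (u + z *\<^sub>R v)"
        unfolding S using t by simp
      then show ?thesis
        using \<open>\<bar>(df (u + z *\<^sub>R v + t *\<^sub>R w) - df (u + z *\<^sub>R v)) - t * ?D w\<bar> \<le> t * e / 2\<close>
        by (simp only: right_diff_distrib)
    qed
    then have "\<bar>?S t - ?D w\<bar> \<le> e / 2"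
      using t by (simp add: abs_mult)
    then show ?thesis using e by (simp add: dist_real_def)
  qed
  then show "\<forall>\<^sub>F t in at_right 0. dist (?S t) (?D w) < e"
    using m by (intro eventually_at_rightI[of 0 m]) auto
qed

lemma second_derivative_symmetric:
  fixes f :: "'a::euclidean_space \<Rightarrow> 'b::euclidean_space"
  assumes U: "open U" "u \<in> U" and f: "smooth_on U f"
  shows "D (\<lambda>x. D f x v) u w
       = D (\<lambda>x. D f x w) u v"
proof (rule euclidean_eqI)
  fix b :: 'b
  assume "b \<in> Basis"
  define h where "h = (\<lambda>x. f x \<bullet> b)"
  have hs: "smooth_on U h"
    unfolding h_def by (intro smooth_on_bounded_linear[OF U(1) bounded_linear_inner_left f])
  have h1: "D h x v = D f x v \<bullet> b" if "x \<in> U" for x v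
    using fun_cong[OF frechet_derivative_at[OF bounded_linear.has_derivative[OF bounded_linear_inner_left
      has_frechet_derivative[OF smooth_on_imp_differentiable[OF f that]]], of b]]
    by (simp add: h_def)
  have h2: "D (\<lambda>x. D h x v) u w =
    D (\<lambda>x. D f x v) u w \<bullet> b" for v w
  proof -
    have "((\<lambda>x. D f x v \<bullet> b) has_derivative
      (\<lambda>w. D (\<lambda>x. D f x v) u w \<bullet> b)) (at u)"
      by (intro bounded_linear.has_derivative[OF bounded_linear_inner_left] has_frechet_derivative
         smooth_on_imp_differentiable[OF smooth_on_frechet[OF f] U(2)])
    then have "((\<lambda>x. D h x v) has_derivative
      (\<lambda>w. D (\<lambda>x. D f x v) u w \<bullet> b)) (at u)"
      by (rule has_derivative_transform_within_open[OF _ U]) (simp add: h1)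
    then show ?thesis using frechet_derivative_at by metis
  qed
  have 1: "((\<lambda>t. (h (u + t *\<^sub>R v + t *\<^sub>R w) - h (u + t *\<^sub>R v) - h (u + t *\<^sub>R w) + h u) / t\<^sup>2)
    \<longlongrightarrow> D (\<lambda>x. D h x v) u w) (at_right 0)" for v w
    by (rule second_difference_tendsto[OF U])
       (use hs U in \<open>auto intro: smooth_on_imp_differentiable smooth_on_frechet\<close>)
  have "((\<lambda>t. (h (u + t *\<^sub>R v + t *\<^sub>R w) - h (u + t *\<^sub>R v) - h (u + t *\<^sub>R w) + h u) / t\<^sup>2)
    \<longlongrightarrow> D (\<lambda>x. D h x w) u v) (at_right 0)"
    using 1[of w v] by (simp add: add.assoc add.commute[of "_ *\<^sub>R w"] diff_diff_add add.commute[of "h (u + _ *\<^sub>R w)"])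
  from tendsto_unique[OF _ 1 this]
  show "D (\<lambda>x. D f x v) u w \<bullet> b
       = D (\<lambda>x. D f x w) u v \<bullet> b"
    by (simp add: h2)
qed

definition D2 ::
    "('a::euclidean_space \<Rightarrow> 'b::euclidean_space) \<Rightarrow> 'a \<Rightarrow> 'a \<Rightarrow> 'a \<Rightarrow> 'b" where
  "D2 f u v w = D (\<lambda>x. D f x w) u v"

lemma second_derivative_commute:
  "open U \<Longrightarrow> u \<in> U \<Longrightarrow> smooth_on U f \<Longrightarrow> D2 f u v w = D2 f u w v"
  unfolding D2_def by (rule second_derivative_symmetric)

lemma linear_second_derivative:
  assumes "open U" "u \<in> U" "smooth_on U f"
  shows "linear (\<lambda>v. D2 f u v w)" "linear (\<lambda>w. D2 f u v w)"
proof -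
  show "linear (\<lambda>v. D2 f u v w)" for w
    unfolding D2_def
    by (rule linear_frechet_derivative[OF smooth_on_imp_differentiable[OF smooth_on_frechet[OF assms(3)] assms(2)]])
  then show "linear (\<lambda>w. D2 f u v w)"
    by (simp add: second_derivative_commute[OF assms, of v])
qed

text \<open>
  Along the segment from \<open>u\<close> to \<open>u + h\<close> the derivative of the remainder is the first-order Taylor
  remainder of the derivative of \<open>f\<close>, which is small uniformly on the finitely many basis directions.
\<close>

lemma taylor_second_order:
  fixes f :: "'a::euclidean_space \<Rightarrow> 'b::euclidean_space"
  assumes U: "open U" "u \<in> U" and f: "smooth_on U f" and e: "e > 0"
  obtains d where "d > 0" "\<And>h. norm h < d \<Longrightarrow> u + h \<in> U \<and>
    norm (f (u + h) - f u - D f u h - (1/2) *\<^sub>R D2 f u h h) \<le> e * (norm h)\<^sup>2"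
proof -
  define N where "N = real DIM('a)"
  have N: "N > 0" by (simp add: N_def)
  define e' where "e' = e / N"
  have e': "e' > 0" using e N by (simp add: e'_def)
  let ?D = "\<lambda>x. D f x"
  let ?H = "D2 f u"
  note lin = linear_second_derivative[OF U f]
  have "\<exists>d>0. \<forall>x. norm (x - u) < d \<longrightarrow> norm (?D x b - ?D u b - ?H (x - u) b) \<le> e' * norm (x - u)" for b
    using has_frechet_derivative[OF smooth_on_imp_differentiable[OF smooth_on_frechet[OF f] U(2)], of b] e'
    unfolding has_derivative_at_alt D2_def by blast
  then obtain dd where dd: "\<And>b. dd b > 0" "\<And>b x. norm (x - u) < dd b \<Longrightarrow> norm (?D x b - ?D u b - ?H (x - u) b) \<le> e' * norm (x - u)"
    by metis
  obtain r where r: "r > 0" "ball u r \<subseteq> U" using U open_contains_ball by blast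
  define d where "d = Min (insert r (dd ` Basis))"
  have d: "d > 0" "d \<le> r"
    using r dd by (auto simp: d_def)
  have d3: "d \<le> dd b" if "b \<in> Basis" for b
    unfolding d_def by (rule Min_le) (use that in auto)
  show ?thesis
  proof (rule that[OF d(1)])
    fix h :: 'a assume h: "norm h < d"
    have inU: "u + t *\<^sub>R h \<in> U" if "0 \<le> t" "t \<le> 1" for t
    proof -
      have "t * norm h \<le> 1 * norm h" using that by (intro mult_right_mono) auto
      then have "u + t *\<^sub>R h \<in> ball u r" using that h d by (simp add: dist_norm)
      then show ?thesis using r by blast
    qed
    define q where "q = (\<lambda>t. f (u + t *\<^sub>R h) - t *\<^sub>R ?D u h - (t\<^sup>2 / 2) *\<^sub>R ?H h h)"
    define q' where "q' = (\<lambda>t. ?D (u + t *\<^sub>R h) h - ?D u h - t *\<^sub>R ?H h h)"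
    have dq: "(q has_vector_derivative q' t) (at t)" if "0 \<le> t" "t \<le> 1" for t
    proof -
      have "f differentiable (at (u + t *\<^sub>R h))"
        using smooth_on_imp_differentiable[OF f inU[OF that]] .
      from has_derivative_line[OF this]
      show ?thesis unfolding q_def q'_def
        by (auto intro!: derivative_eq_intros simp: has_vector_derivative_def[symmetric]
           simp del: scaleR_conv_of_real)
    qed
    have bq: "norm (q' t) \<le> e * (norm h)\<^sup>2" if t: "0 \<le> t" "t \<le> 1" for t
    proof -
      let ?x = "u + t *\<^sub>R h"
      have lx: "linear (?D ?x)"
        using linear_frechet_derivative smooth_on_imp_differentiable[OF f inU[OF t]] by blast
      have lu: "linear (?D u)"
        using linear_frechet_derivative smooth_on_imp_differentiable[OF f U(2)] by blast
      have th: "norm (t *\<^sub>R h) \<le> norm h" using t by (simp add: mult_left_le_one_le)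
      have eq: "q' t = (\<Sum>b\<in>Basis. (h \<bullet> b) *\<^sub>R (?D ?x b - ?D u b - ?H (t *\<^sub>R h) b))"
        unfolding q'_def linear_basis_expansion[OF lx, of h] linear_basis_expansion[OF lu, of h]
          linear_basis_expansion[OF lin(2), of h h]
        by (simp add: linear_cmul[OF lin(1)] sum_subtractf scaleR_right_diff_distrib scaleR_sum_right mult.commute)
      have "norm (q' t) \<le> (\<Sum>b\<in>(Basis::'a set). norm h * (e' * norm h))"
        unfolding eq
      proof (rule sum_norm_le)
        fix b :: 'a assume b: "b \<in> Basis"
        have "norm (?D ?x b - ?D u b - ?H (t *\<^sub>R h) b) \<le> e' * norm (t *\<^sub>R h)"
          using dd(2)[of ?x b] d3[OF b] h th by simp
        also have "\<dots> \<le> e' * norm h" using th e' by simp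
        finally show "norm ((h \<bullet> b) *\<^sub>R (?D ?x b - ?D u b - ?H (t *\<^sub>R h) b)) \<le> norm h * (e' * norm h)"
          using Basis_le_norm[OF b, of h] by (auto intro!: mult_mono)
      qed
      also have "\<dots> = e * (norm h)\<^sup>2"
        using N by (simp add: e'_def N_def power2_eq_square)
      finally show ?thesis .
    qed
    have "norm (q 1 - q 0) \<le> (e * (norm h)\<^sup>2) * norm (1 - 0 :: real)"
    proof (rule differentiable_bound[where S = "{0..1}" and f' = "\<lambda>t k. k *\<^sub>R q' t"])
      show "(q has_derivative (\<lambda>k. k *\<^sub>R q' t)) (at t within {0..1})" if "t \<in> {0..1}" for t
        using dq[of t] that has_derivative_at_withinI unfolding has_vector_derivative_def by force
      show "onorm (\<lambda>k. k *\<^sub>R q' t) \<le> e * (norm h)\<^sup>2" if "t \<in> {0..1}" for t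
        using bq[of t] that by (intro onorm_le) (auto simp: mult.commute intro: mult_left_mono)
    qed auto
    then show "u + h \<in> U \<and> norm (f (u + h) - f u - ?D u h - (1/2) *\<^sub>R ?H h h) \<le> e * (norm h)\<^sup>2"
      using inU[of 1] by (simp add: q_def algebra_simps)
  qed
qed

section \<open>Partial derivatives\<close>

lemma linear_axis_expansion:
  fixes L :: "real^'n::finite \<Rightarrow> 'b::real_vector"
  assumes "linear L" shows "L v = (\<Sum>i\<in>UNIV. v $ i *\<^sub>R L (axis i 1))"
proof -
  have "L v = L (\<Sum>i\<in>UNIV. v $ i *\<^sub>R axis i 1)"
    using basis_expansion[of v] by (simp add: scalar_mult_eq_scaleR)
  also have "\<dots> = (\<Sum>i\<in>UNIV. v $ i *\<^sub>R L (axis i 1))"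
    by (simp add: linear_sum[OF assms] linear_cmul[OF assms])
  finally show ?thesis .
qed

lemma partial_eqI: "(f has_derivative f') (at u) \<Longrightarrow> partial i f u = f' (axis i 1)"
  unfolding partial_def using frechet_derivative_at by metis

lemma frechet_derivative_partial:
  "f differentiable (at u) \<Longrightarrow> D f u v = (\<Sum>i\<in>UNIV. v $ i *\<^sub>R partial i f u)"
  unfolding partial_def by (rule linear_axis_expansion[OF linear_frechet_derivative])

lemma partial_cong:
  assumes "open U" "u \<in> U" "\<And>x. x \<in> U \<Longrightarrow> f x = g x" "f differentiable (at u)"
  shows "partial i f u = partial i g u"
  unfolding partial_def
  using frechet_derivative_transform_within_open[OF assms(4,1,2)] assms(3) by metis

lemma partial_const [simp]: "partial i (\<lambda>x. c) u = 0"
  unfolding partial_def by simp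

lemma partial_bilinear:
  assumes "bounded_bilinear pr" "f differentiable (at u)" "g differentiable (at u)"
  shows "partial i (\<lambda>x. pr (f x) (g x)) u = pr (partial i f u) (g u) + pr (f u) (partial i g u)"
  using partial_eqI[OF bounded_bilinear.FDERIV[OF assms(1) has_frechet_derivative[OF assms(2)] has_frechet_derivative[OF assms(3)]]]
  by (simp add: partial_def)

lemmas partial_mult = partial_bilinear[OF bounded_bilinear_mult]
lemmas partial_inner = partial_bilinear[OF bounded_bilinear_inner]

lemma partial_diff:
  assumes "f differentiable (at u)" "g differentiable (at u)"
  shows "partial i (\<lambda>x. f x - g x) u = partial i f u - partial i g u"
  using partial_eqI[OF has_derivative_diff[OF has_frechet_derivative[OF assms(1)] has_frechet_derivative[OF assms(2)]]]
  by (simp add: partial_def)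

lemma partial_sum:
  assumes "\<And>k. k \<in> K \<Longrightarrow> f k differentiable (at u)"
  shows "partial i (\<lambda>x. \<Sum>k\<in>K. f k x) u = (\<Sum>k\<in>K. partial i (f k) u)"
  using partial_eqI[OF has_derivative_sum[of K f, OF has_frechet_derivative[OF assms]]]
  by (simp add: partial_def)

lemma partial_compose:
  assumes "\<phi> differentiable (at u)" "f differentiable (at (\<phi> u))"
  shows "partial i (\<lambda>x. f (\<phi> x)) u = D f (\<phi> u) (partial i \<phi> u)"
  using partial_eqI[OF has_derivative_compose[OF has_frechet_derivative[OF assms(1)] has_frechet_derivative[OF assms(2)]]]
  by (simp add: partial_def)

lemma partial_powr:
  fixes f :: "real^'n::finite \<Rightarrow> real"
  assumes "f differentiable (at u)" "f u > 0"
  shows "partial i (\<lambda>x. f x powr a) u = a * f u powr (a - 1) * partial i f u"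
proof -
  have "((\<lambda>x. x powr a) has_derivative (\<lambda>h. a * f u powr (a - 1) * h)) (at (f u))"
    using has_real_derivative_powr[OF assms(2), of a] by (simp add: has_field_derivative_def)
  from partial_eqI[OF has_derivative_compose[OF has_frechet_derivative[OF assms(1)] this]]
  show ?thesis by (simp add: partial_def)
qed

lemma partial_commute:
  assumes "open U" "u \<in> U" "smooth_on U f"
  shows "partial i (partial j f) u = partial j (partial i f) u"
  using second_derivative_commute[OF assms, of "axis i 1" "axis j 1"]
  by (simp add: D2_def partial_def[abs_def])

lemma second_derivative_partial:
  assumes "open U" "u \<in> U" "smooth_on U f"
  shows "D2 f u v w = (\<Sum>i\<in>UNIV. \<Sum>j\<in>UNIV. (v $ i * w $ j) *\<^sub>R partial i (partial j f) u)"
proof -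
  have "D2 f u v w = (\<Sum>i\<in>UNIV. v $ i *\<^sub>R D2 f u (axis i 1) w)"
    by (rule linear_axis_expansion[OF linear_second_derivative(1)[OF assms]])
  also have "\<dots> = (\<Sum>i\<in>UNIV. v $ i *\<^sub>R (\<Sum>j\<in>UNIV. w $ j *\<^sub>R D2 f u (axis i 1) (axis j 1)))"
    by (subst linear_axis_expansion[OF linear_second_derivative(2)[OF assms]]) simp
  finally show ?thesis
    by (simp add: scaleR_sum_right D2_def partial_def[abs_def])
qed

section \<open>Inverse matrices and the derivative of the determinant\<close>

lemma matrix_inv_right:
  fixes A :: "real^'n::finite^'n"
  assumes "invertible A" shows "A ** matrix_inv A = mat 1"
  using someI_ex[OF assms[unfolded invertible_def]] by (simp add: matrix_inv_def)

lemma matrix_inv_left: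
  fixes A :: "real^'n::finite^'n"
  assumes "invertible A" shows "matrix_inv A ** A = mat 1"
  using someI_ex[OF assms[unfolded invertible_def]] by (simp add: matrix_inv_def)

lemma matrix_inv_unique:
  fixes A B :: "real^'n::finite^'n"
  assumes "A ** B = mat 1" shows "matrix_inv A = B"
proof -
  have "invertible A" using assms invertible_right_inverse by blast
  then have "matrix_inv A = matrix_inv A ** (A ** B)" using assms by simp
  also have "\<dots> = B" using matrix_inv_left[OF \<open>invertible A\<close>] by (simp add: matrix_mul_assoc)
  finally show ?thesis .
qed

text \<open>
  Cramer's rule shows that the entries of the inverse matrix are as smooth as the entries of the matrix.
\<close>

lemma matrix_inv_cramer:
  fixes A :: "real^'n::finite^'n"
  assumes "det A \<noteq> 0"
  shows "matrix_inv A $ k $ l = det (\<chi> i j. if j = k then (axis l 1 :: real^'n) $ i else A $ i $ j) / det A"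
proof -
  have inv: "invertible A" using assms by (simp add: invertible_det_nz)
  have "A *v (matrix_inv A *v axis l 1) = axis l 1"
    by (simp add: matrix_vector_mul_assoc matrix_inv_right[OF inv])
  then have "matrix_inv A *v axis l 1 = (\<chi> k. det (\<chi> i j. if j = k then (axis l 1 :: real^'n) $ i else A $ i $ j) / det A)"
    using cramer[OF assms] by blast
  then have "(matrix_inv A *v axis l 1) $ k = det (\<chi> i j. if j = k then (axis l 1 :: real^'n) $ i else A $ i $ j) / det A"
    by simp
  then show ?thesis
    by (simp add: matrix_vector_mult_basis column_def)
qed

lemma smooth_on_det:
  fixes A :: "'a::euclidean_space \<Rightarrow> real^'n::finite^'n"
  assumes "open U" "\<And>i j. smooth_on U (\<lambda>x. A x $ i $ j)"
  shows "smooth_on U (\<lambda>x. det (A x))"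
  unfolding det_def using assms
  by (intro smooth_on_sum smooth_on_mult smooth_on_const smooth_on_prod) auto

lemma smooth_on_matrix_inv:
  fixes A :: "'a::euclidean_space \<Rightarrow> real^'n::finite^'n"
  assumes U: "open U" and A: "\<And>i j. smooth_on U (\<lambda>x. A x $ i $ j)"
    and det: "\<And>x. x \<in> U \<Longrightarrow> det (A x) > 0"
  shows "smooth_on U (\<lambda>x. matrix_inv (A x) $ k $ l)"
proof -
  have "smooth_on U (\<lambda>x. det (\<chi> i j. if j = k then (axis l 1 :: real^'n) $ i else A x $ i $ j))"
  proof (rule smooth_on_det[OF U])
    show "smooth_on U (\<lambda>x. (\<chi> i j. if j = k then (axis l 1 :: real^'n) $ i else A x $ i $ j) $ i $ j)" for i j
      by (cases "j = k") (simp_all add: smooth_on_const A)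
  qed
  then have "smooth_on U (\<lambda>x. det (\<chi> i j. if j = k then (axis l 1 :: real^'n) $ i else A x $ i $ j) * det (A x) powr (- 1))"
    by (rule smooth_on_mult[OF U]) (intro smooth_on_powr[OF U] smooth_on_det[OF U] A det)
  then show ?thesis
    by (rule smooth_on_cong[OF U])
       (use det in \<open>force simp: matrix_inv_cramer powr_minus divide_inverse\<close>)
qed

text \<open>
  Jacobi's formula. Differentiating the Leibniz sum replaces one row at a time by its derivative; that
  row is a combination of the rows of \<open>A u\<close> because \<open>B\<close> is a left inverse, and Cramer's rule evaluates
  the resulting determinant.
\<close>

lemma has_derivative_det:
  fixes A :: "'a::real_normed_vector \<Rightarrow> real^'n::finite^'n" and B :: "real^'n^'n"
  assumes A: "\<And>k l. ((\<lambda>x. A x $ k $ l) has_derivative A' k l) (at u)"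
    and B: "B ** A u = mat 1"
  shows "((\<lambda>x. det (A x)) has_derivative (\<lambda>v. det (A u) * (\<Sum>k\<in>UNIV. \<Sum>l\<in>UNIV. A' k l v * B $ l $ k))) (at u)"
proof -
  let ?R = "\<lambda>v k. (\<chi> j. if j = k then (\<chi> l. A' k l v) else A u $ j) :: real^'n^'n"
  have 1: "((\<lambda>x. \<Prod>k\<in>UNIV. A x $ k $ p k) has_derivative
      (\<lambda>v. \<Sum>k\<in>UNIV. A' k (p k) v * (\<Prod>j\<in>UNIV - {k}. A u $ j $ p j))) (at u)" for p :: "'n \<Rightarrow> 'n"
    by (rule has_derivative_prod) (rule A)
  have 2: "A' k (p k) v * (\<Prod>j\<in>UNIV - {k}. A u $ j $ p j) = (\<Prod>j\<in>UNIV. ?R v k $ j $ p j)" for p v k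
  proof -
    have "(\<Prod>j\<in>UNIV. ?R v k $ j $ p j) = ?R v k $ k $ p k * (\<Prod>j\<in>UNIV - {k}. ?R v k $ j $ p j)"
      by (rule prod.remove) auto
    also have "(\<Prod>j\<in>UNIV - {k}. ?R v k $ j $ p j) = (\<Prod>j\<in>UNIV - {k}. A u $ j $ p j)"
      by (rule prod.cong) auto
    finally show ?thesis by simp
  qed
  have 3: "det (?R v k) = (\<Sum>l\<in>UNIV. A' k l v * B $ l $ k) * det (A u)" for v k
  proof -
    define x where "x = (\<chi> i. \<Sum>l\<in>UNIV. A' k l v * B $ l $ i)"
    have x: "(\<Sum>i\<in>UNIV. x $ i *s row i (A u)) = (\<chi> l. A' k l v)"
    proof (rule vec_eq_iff[THEN iffD2], rule allI)
      fix m
      have "(\<Sum>i\<in>UNIV. x $ i *s row i (A u)) $ m = (\<Sum>i\<in>UNIV. \<Sum>l\<in>UNIV. A' k l v * (B $ l $ i * A u $ i $ m))"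
        by (simp add: x_def row_def sum_distrib_right mult.assoc)
      also have "\<dots> = (\<Sum>l\<in>UNIV. A' k l v * (\<Sum>i\<in>UNIV. B $ l $ i * A u $ i $ m))"
        by (subst sum.swap) (simp add: sum_distrib_left)
      also have "\<dots> = (\<Sum>l\<in>UNIV. A' k l v * (B ** A u) $ l $ m)"
        by (simp add: matrix_matrix_mult_def)
      also have "\<dots> = A' k m v" unfolding B by (simp add: mat_def if_distrib cong: if_cong)
      finally show "(\<Sum>i\<in>UNIV. x $ i *s row i (A u)) $ m = (\<chi> l. A' k l v) $ m" by simp
    qed
    have "row i (A u) = A u $ i" for i by (simp add: row_def)
    then show ?thesis
      using cramer_lemma_transpose[of k x "A u"] unfolding x by (simp add: x_def cong: if_cong)
  qed
  have "((\<lambda>x. det (A x)) has_derivative (\<lambda>v. \<Sum>p | p permutes (UNIV :: 'n set). of_int (sign p) *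
      (\<Sum>k\<in>UNIV. \<Prod>j\<in>UNIV. ?R v k $ j $ p j))) (at u)"
    unfolding det_def
    by (intro has_derivative_sum has_derivative_mult_right) (use 1 in \<open>simp only: 2\<close>)
  moreover have "(\<Sum>p | p permutes (UNIV :: 'n set). of_int (sign p) *
      (\<Sum>k\<in>UNIV. \<Prod>j\<in>UNIV. ?R v k $ j $ p j)) = (\<Sum>k\<in>UNIV. det (?R v k))" for v
    unfolding det_def sum_distrib_left by (rule sum.swap)
  ultimately show ?thesis
    by (simp add: 3 sum_distrib_left mult.commute)
qed

text \<open>
  The image of \<open>E\<close> is isometric to the domain because it has the same dimension; pulling such an
  isometry back through \<open>E\<close> gives coordinates in which \<open>E\<close> preserves the norm.
\<close>

lemma orthonormalizing_coordinates:
  fixes E :: "real^'n::finite \<Rightarrow> 'a::euclidean_space"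
  assumes E: "linear E" "inj E"
  obtains C :: "real^'n \<Rightarrow> real^'n" where "linear C" "inj C" "\<And>v. norm (E (C v)) = norm v"
proof -
  have dim: "dim (range E) = dim (UNIV :: (real^'n) set)"
    using dim_image_eq[OF E(1), of UNIV] E(2) by simp
  obtain f where f: "linear f" "f ` UNIV = range E" "\<And>x::real^'n. norm (f x) = norm x"
    using isometry_subspaces[OF subspace_UNIV linear_subspace_image[OF E(1) subspace_UNIV] dim[symmetric]] by auto
  obtain A where A: "linear A" "A \<circ> E = id"
    using linear_injective_left_inverse[OF E] by blast
  have EA: "E (A (f v)) = f v" for v
  proof -
    obtain w where "f v = E w" using f(2) by blast
    then show ?thesis using A(2) by (metis comp_apply id_apply)
  qed
  show ?thesis
  proof (rule that[of "A \<circ> f"])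
    show "linear (A \<circ> f)" using f(1) A(1) linear_compose by blast
    show "inj (A \<circ> f)"
    proof (rule injI)
      fix x y assume "(A \<circ> f) x = (A \<circ> f) y"
      then have "f x = f y" using EA by (metis comp_apply)
      then have "norm (f (x - y)) = 0" by (simp add: linear_diff[OF f(1)])
      then show "x = y" using f(3) by simp
    qed
    show "norm (E ((A \<circ> f) v)) = norm v" for v using EA f(3) by simp
  qed
qed

section \<open>The first and second fundamental forms in coordinates\<close>

locale immersion =
  fixes U :: "(real^'n::finite) set" and \<phi> :: "real^'n \<Rightarrow> real^('n option)"
  assumes open_U: "open U" and smooth_phi: "smooth_on U \<phi>"
    and inj_frechet: "u \<in> U \<Longrightarrow> inj (D \<phi> u)"
begin

abbreviation "tang i \<equiv> partial i \<phi>"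
abbreviation "tang2 i j \<equiv> partial i (partial j \<phi>)"
abbreviation "met \<equiv> induced_metric \<phi>"
abbreviation "inv_met u \<equiv> matrix_inv (induced_metric \<phi> u)"
abbreviation "Gam \<equiv> christoffel (induced_metric \<phi>)"
abbreviation "vol_density u \<equiv> sqrt (det (induced_metric \<phi> u))"

text \<open>
  The coefficients of the second fundamental form with values in the normal space; this avoids the
  choice of a unit normal field.
\<close>

definition second_form :: "'n \<Rightarrow> 'n \<Rightarrow> real^'n \<Rightarrow> real^('n option)" where
  "second_form i j u = tang2 i j u - (\<Sum>k\<in>UNIV. Gam k i j u *\<^sub>R tang k u)"

lemma phi_differentiable: "u \<in> U \<Longrightarrow> \<phi> differentiable (at u)"
  by (rule smooth_on_imp_differentiable[OF smooth_phi])

lemma linear_frechet_phi: "u \<in> U \<Longrightarrow> linear (D \<phi> u)"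
  by (rule linear_frechet_derivative[OF phi_differentiable])

lemma smooth_tang: "smooth_on U (tang i)"
  by (rule smooth_on_partial[OF smooth_phi])

lemma smooth_tang2: "smooth_on U (tang2 i j)"
  by (rule smooth_on_partial[OF smooth_tang])

lemma tang2_commute: "u \<in> U \<Longrightarrow> tang2 i j u = tang2 j i u"
  by (rule partial_commute[OF open_U _ smooth_phi])

lemma met_entry: "met u $ i $ j = tang i u \<bullet> tang j u"
  by (simp add: induced_metric_def)

lemma met_commute: "met u $ i $ j = met u $ j $ i"
  by (simp add: met_entry inner_commute)

lemma smooth_met: "smooth_on U (\<lambda>x. met x $ i $ j)"
  unfolding met_entry by (intro smooth_on_inner open_U smooth_tang)

lemma orthonormal_frame:
  assumes u: "u \<in> U"
  obtains C :: "real^'n \<Rightarrow> real^'n" where "linear C" "inj C"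
    "\<And>v w. D \<phi> u (C v) \<bullet> D \<phi> u (C w) = v \<bullet> w"
proof -
  obtain C :: "real^'n \<Rightarrow> real^'n" where C: "linear C" "inj C"
    "\<And>v. norm (D \<phi> u (C v)) = norm v"
    using orthonormalizing_coordinates[OF linear_frechet_phi inj_frechet, OF u u] by blast
  have lin: "linear (\<lambda>v. D \<phi> u (C v))"
    using linear_compose[OF C(1) linear_frechet_phi[OF u]] by (simp add: o_def)
  have "D \<phi> u (C v) \<bullet> D \<phi> u (C w) = v \<bullet> w" for v w
    unfolding dot_norm linear_add[OF lin, symmetric] C(3) ..
  then show ?thesis using C that by blast
qed

text \<open>
  In an orthonormal frame the metric is the identity matrix, and a change of frame multiplies the
  determinant by a square.
\<close>

lemma det_met_pos:
  assumes u: "u \<in> U" shows "det (met u) > 0"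
proof -
  let ?E = "D \<phi> u"
  obtain C :: "real^'n \<Rightarrow> real^'n" where C: "linear C" "\<And>v w. ?E (C v) \<bullet> ?E (C w) = v \<bullet> w"
    using orthonormal_frame[OF u] by metis
  let ?c = "matrix C"
  have "(transpose ?c ** met u ** ?c) $ i $ j = (mat 1 :: real^'n^'n) $ i $ j" for i j
  proof -
    have E: "?E (C (axis i 1)) = (\<Sum>k\<in>UNIV. ?c $ k $ i *\<^sub>R tang k u)" for i
      using frechet_derivative_partial[OF phi_differentiable[OF u]] by (simp add: matrix_def)
    have "(transpose ?c ** met u ** ?c) $ i $ j = ?E (C (axis i 1)) \<bullet> ?E (C (axis j 1))"
      unfolding E
      by (simp add: matrix_matrix_mult_def transpose_def met_entry inner_sum_left inner_sum_right
          sum_distrib_left sum_distrib_right mult_ac)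
    also have "\<dots> = (mat 1 :: real^'n^'n) $ i $ j"
      by (simp add: C(2) inner_axis_axis mat_def)
    finally show ?thesis .
  qed
  then have "transpose ?c ** met u ** ?c = mat 1" by (simp add: vec_eq_iff)
  then have "det (transpose ?c ** met u ** ?c) = 1" by simp
  then have "(det ?c)\<^sup>2 * det (met u) = 1"
    by (simp add: det_mul power2_eq_square mult_ac)
  then show ?thesis
    using zero_less_mult_iff[of "(det ?c)\<^sup>2" "det (met u)"] by (simp add: not_less[symmetric])
qed

lemma inv_met_met: "u \<in> U \<Longrightarrow> (\<Sum>j\<in>UNIV. inv_met u $ i $ j * met u $ j $ k) = (if i = k then 1 else 0)"
  using matrix_inv_left[of "met u"] det_met_pos[of u]
  by (auto simp: invertible_det_nz matrix_matrix_mult_def vec_eq_iff mat_def)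

lemma met_inv_met: "u \<in> U \<Longrightarrow> (\<Sum>j\<in>UNIV. met u $ i $ j * inv_met u $ j $ k) = (if i = k then 1 else 0)"
  using matrix_inv_right[of "met u"] det_met_pos[of u]
  by (auto simp: invertible_det_nz matrix_matrix_mult_def vec_eq_iff mat_def)

text \<open>
  Linear systems whose matrix is the metric are solved by the inverse metric. The identities for
  the derivatives of the Christoffel symbols and of the inverse metric are first proved with lowered index.
\<close>

lemma raise_index:
  assumes "u \<in> U" "\<And>l. (\<Sum>r\<in>UNIV. X r * met u $ r $ l) = Y l"
  shows "X k = (\<Sum>l\<in>UNIV. inv_met u $ k $ l * Y l)"
proof -
  have "(\<Sum>l\<in>UNIV. inv_met u $ k $ l * Y l) = (\<Sum>l\<in>UNIV. \<Sum>r\<in>UNIV. X r * (inv_met u $ k $ l * met u $ l $ r))"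
    by (simp add: assms(2)[symmetric] sum_distrib_left mult_ac met_commute[of u _ _])
  also have "\<dots> = (\<Sum>r\<in>UNIV. X r * (\<Sum>l\<in>UNIV. inv_met u $ k $ l * met u $ l $ r))"
    by (subst sum.swap) (simp add: sum_distrib_left)
  also have "\<dots> = X k"
    by (simp add: inv_met_met[OF assms(1)] if_distrib cong: if_cong)
  finally show ?thesis ..
qed

lemma inv_met_commute:
  assumes "u \<in> U" shows "inv_met u $ i $ j = inv_met u $ j $ i"
proof -
  have "inv_met u $ i $ j = (\<Sum>l\<in>UNIV. inv_met u $ j $ l * (if i = l then 1 else 0))"
    by (rule raise_index[OF assms]) (rule inv_met_met[OF assms])
  then show ?thesis by (simp add: if_distrib cong: if_cong)
qed

lemma lower_index:
  assumes "u \<in> U" "\<And>k. X k = (\<Sum>l\<in>UNIV. inv_met u $ k $ l * Y l)"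
  shows "(\<Sum>k\<in>UNIV. X k * met u $ k $ l) = Y l"
proof -
  have "(\<Sum>k\<in>UNIV. X k * met u $ k $ l) = (\<Sum>k\<in>UNIV. \<Sum>m\<in>UNIV. Y m * (met u $ l $ k * inv_met u $ k $ m))"
    by (simp add: assms(2) sum_distrib_left sum_distrib_right mult_ac met_commute[of u _ l])
  also have "\<dots> = (\<Sum>m\<in>UNIV. Y m * (\<Sum>k\<in>UNIV. met u $ l $ k * inv_met u $ k $ m))"
    by (subst sum.swap) (simp add: sum_distrib_left)
  also have "\<dots> = Y l"
    by (simp add: met_inv_met[OF assms(1)] if_distrib cong: if_cong)
  finally show ?thesis .
qed

lemma smooth_inv_met: "smooth_on U (\<lambda>x. inv_met x $ i $ j)"
  by (rule smooth_on_matrix_inv[OF open_U smooth_met det_met_pos])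

lemma smooth_vol_density: "smooth_on U (\<lambda>x. vol_density x)"
proof -
  have "smooth_on U (\<lambda>x. det (met x) powr (1/2))"
    by (intro smooth_on_powr smooth_on_det open_U smooth_met det_met_pos)
  then show ?thesis
    by (rule smooth_on_cong[OF open_U]) (use det_met_pos in \<open>auto simp: powr_half_sqrt less_imp_le\<close>)
qed

lemma partial_met:
  assumes u: "u \<in> U"
  shows "partial i (\<lambda>x. met x $ j $ k) u = tang2 i j u \<bullet> tang k u + tang j u \<bullet> tang2 i k u"
  unfolding met_entry
  by (rule partial_inner) (use u smooth_tang smooth_on_imp_differentiable in blast)+

text \<open>
  For an induced metric the three derivatives of the metric combine into a single second derivative
  of the parametrization, so the Christoffel symbols are its tangential coefficients.
\<close>

lemma christoffel_formula:
  assumes u: "u \<in> U"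
  shows "Gam k i j u = (\<Sum>l\<in>UNIV. inv_met u $ k $ l * (tang2 i j u \<bullet> tang l u))"
  unfolding christoffel_def partial_met[OF u] sum_distrib_left
proof (rule sum.cong[OF refl])
  fix l
  show "1 / 2 * (inv_met u $ k $ l * (tang2 i j u \<bullet> tang l u + tang j u \<bullet> tang2 i l u +
      (tang2 j i u \<bullet> tang l u + tang i u \<bullet> tang2 j l u) - (tang2 l i u \<bullet> tang j u + tang i u \<bullet> tang2 l j u)))
    = inv_met u $ k $ l * (tang2 i j u \<bullet> tang l u)"
    unfolding tang2_commute[OF u, of j i] tang2_commute[OF u, of l i] tang2_commute[OF u, of l j]
    by (simp add: inner_commute)
qed

lemma christoffel_commute: "u \<in> U \<Longrightarrow> Gam k i j u = Gam k j i u"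
  by (simp add: christoffel_formula tang2_commute[of u i])

lemma christoffel_lower: "u \<in> U \<Longrightarrow> (\<Sum>k\<in>UNIV. Gam k i j u * met u $ k $ l) = tang2 i j u \<bullet> tang l u"
  by (rule lower_index) (auto simp: christoffel_formula)

lemma smooth_christoffel: "smooth_on U (Gam k i j)"
proof -
  have "smooth_on U (\<lambda>u. \<Sum>l\<in>UNIV. inv_met u $ k $ l * (tang2 i j u \<bullet> tang l u))"
    by (intro smooth_on_sum smooth_on_mult smooth_on_inner open_U smooth_inv_met smooth_tang smooth_tang2)
  then show ?thesis
    by (rule smooth_on_cong[OF open_U]) (simp add: christoffel_formula)
qed

lemma smooth_second_form: "smooth_on U (second_form i j)"
  unfolding second_form_def[abs_def]
  by (intro smooth_on_diff smooth_on_sum smooth_on_scaleR open_U smooth_christoffel smooth_tang smooth_tang2)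

lemma second_form_commute: "u \<in> U \<Longrightarrow> second_form i j u = second_form j i u"
  by (simp add: second_form_def christoffel_commute[of u _ i] tang2_commute[of u i])

lemma second_form_normal: "u \<in> U \<Longrightarrow> second_form i j u \<bullet> tang l u = 0"
  using christoffel_lower[of u i j l]
  by (simp add: second_form_def inner_diff_left inner_sum_left met_entry)

lemma second_form_inner: "u \<in> U \<Longrightarrow> second_form i j u \<bullet> second_form k l u = second_form i j u \<bullet> tang2 k l u"
  by (simp add: second_form_def[of k l] inner_diff_right inner_sum_right second_form_normal)

lemmas smooth_differentiable = smooth_on_imp_differentiable[OF smooth_tang] smooth_on_imp_differentiable[OF smooth_tang2]
  smooth_on_imp_differentiable[OF smooth_met] smooth_on_imp_differentiable[OF smooth_inv_met]
  smooth_on_imp_differentiable[OF smooth_christoffel] smooth_on_imp_differentiable[OF smooth_vol_density]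

text \<open>
  Differentiating the lowered identity \<open>christoffel_lower\<close> gives the derivative of the Christoffel
  symbols without differentiating the inverse metric. The left-hand side is half of the classical
  expression for the Riemann tensor; the term with third derivatives cancels on antisymmetrization.
\<close>

lemma christoffel_derivative:
  assumes u: "u \<in> U"
  shows "partial k (Gam r i j) u + (\<Sum>m\<in>UNIV. Gam m i j u * Gam r m k u)
       = (\<Sum>l\<in>UNIV. inv_met u $ r $ l * (partial k (tang2 i j) u \<bullet> tang l u + second_form i j u \<bullet> second_form k l u))"
proof (rule raise_index[OF u])
  fix l
  have "partial k (\<lambda>x. \<Sum>r\<in>UNIV. Gam r i j x * met x $ r $ l) u = partial k (\<lambda>x. tang2 i j x \<bullet> tang l x) u"
  proof (rule partial_cong[OF open_U u christoffel_lower])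
    have "smooth_on U (\<lambda>x. \<Sum>r\<in>UNIV. Gam r i j x * met x $ r $ l)"
      by (intro smooth_on_sum smooth_on_mult open_U smooth_christoffel smooth_met)
    then show "(\<lambda>x. \<Sum>r\<in>UNIV. Gam r i j x * met x $ r $ l) differentiable at u"
      using u smooth_on_imp_differentiable by blast
  qed
  moreover have "partial k (\<lambda>x. tang2 i j x \<bullet> tang l x) u
     = partial k (tang2 i j) u \<bullet> tang l u + tang2 i j u \<bullet> tang2 k l u"
    by (rule partial_inner) (use smooth_differentiable u in blast)+
  moreover have "partial k (\<lambda>x. \<Sum>r\<in>UNIV. Gam r i j x * met x $ r $ l) u =
     (\<Sum>r\<in>UNIV. partial k (\<lambda>x. Gam r i j x * met x $ r $ l) u)"
    by (rule partial_sum) (use smooth_differentiable u in \<open>auto intro!: differentiable_mult\<close>)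
  moreover have "partial k (\<lambda>x. Gam r i j x * met x $ r $ l) u =
     partial k (Gam r i j) u * met u $ r $ l + Gam r i j u * (tang2 k r u \<bullet> tang l u) + Gam r i j u * (tang r u \<bullet> tang2 k l u)" for r
    by (subst partial_mult) (use smooth_differentiable u in \<open>auto simp: partial_met algebra_simps\<close>)
  ultimately have 1: "(\<Sum>r\<in>UNIV. partial k (Gam r i j) u * met u $ r $ l) + (\<Sum>r\<in>UNIV. Gam r i j u * (tang2 k r u \<bullet> tang l u))
     + (\<Sum>r\<in>UNIV. Gam r i j u * (tang r u \<bullet> tang2 k l u)) = partial k (tang2 i j) u \<bullet> tang l u + tang2 i j u \<bullet> tang2 k l u"
    by (simp add: sum.distrib)
  have 2: "second_form i j u \<bullet> second_form k l u = tang2 i j u \<bullet> tang2 k l u - (\<Sum>r\<in>UNIV. Gam r i j u * (tang r u \<bullet> tang2 k l u))"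
    unfolding second_form_inner[OF u] unfolding second_form_def[of i j] by (simp add: inner_diff_left inner_sum_left)
  have 3: "(\<Sum>r\<in>UNIV. Gam r i j u * (tang2 k r u \<bullet> tang l u)) = (\<Sum>r\<in>UNIV. (\<Sum>m\<in>UNIV. Gam m i j u * Gam r m k u) * met u $ r $ l)"
  proof -
    have "(\<Sum>r\<in>UNIV. Gam r i j u * (tang2 k r u \<bullet> tang l u)) = (\<Sum>r\<in>UNIV. \<Sum>m\<in>UNIV. Gam r i j u * (Gam m r k u * met u $ m $ l))"
      by (simp add: tang2_commute[OF u, of k] christoffel_lower[OF u, symmetric] sum_distrib_left)
    also have "\<dots> = (\<Sum>m\<in>UNIV. \<Sum>r\<in>UNIV. Gam r i j u * (Gam m r k u * met u $ m $ l))"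
      by (rule sum.swap)
    finally show ?thesis by (simp add: sum_distrib_right mult.assoc)
  qed
  show "(\<Sum>r\<in>UNIV. (partial k (Gam r i j) u + (\<Sum>m\<in>UNIV. Gam m i j u * Gam r m k u)) * met u $ r $ l) =
    partial k (tang2 i j) u \<bullet> tang l u + second_form i j u \<bullet> second_form k l u"
    using 1 2 3 by (simp add: distrib_right sum.distrib)
qed

lemma tang3_commute:
  assumes u: "u \<in> U" shows "partial k (tang2 i j) u = partial j (tang2 i k) u"
proof -
  have 1: "partial k (tang2 i j) u = partial k (tang2 j i) u" for i j k
    by (rule partial_cong[OF open_U u tang2_commute]) (use smooth_differentiable u in auto)
  have "partial k (tang2 i j) u = partial k (tang2 j i) u" by (rule 1)
  also have "\<dots> = partial j (tang2 k i) u" by (rule partial_commute[OF open_U u smooth_tang])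
  also have "\<dots> = partial j (tang2 i k) u" by (rule 1)
  finally show ?thesis .
qed

text \<open>
  The Gauss equation: the Ricci tensor of the induced metric is quadratic in the second fundamental
  form. It is the antisymmetrization of \<open>christoffel_derivative\<close>.
\<close>

theorem gauss_ricci:
  assumes u: "u \<in> U"
  shows "ricci_coord met i j u = (\<Sum>k\<in>UNIV. \<Sum>l\<in>UNIV. inv_met u $ k $ l *
    (second_form i j u \<bullet> second_form k l u - second_form i k u \<bullet> second_form j l u))"
proof -
  have "ricci_coord met i j u = (\<Sum>k\<in>UNIV. partial k (Gam k i j) u + (\<Sum>m\<in>UNIV. Gam m i j u * Gam k m k u))
     - (\<Sum>k\<in>UNIV. partial j (Gam k i k) u + (\<Sum>m\<in>UNIV. Gam m i k u * Gam k m j u))"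
  proof -
    have "(\<Sum>k\<in>UNIV. \<Sum>l\<in>UNIV. Gam k k l u * Gam l i j u) = (\<Sum>k\<in>UNIV. \<Sum>m\<in>UNIV. Gam m i j u * Gam k m k u)"
      by (intro sum.cong refl) (metis christoffel_commute[OF u] mult.commute)
    moreover have "(\<Sum>k\<in>UNIV. \<Sum>l\<in>UNIV. Gam k j l u * Gam l i k u) = (\<Sum>k\<in>UNIV. \<Sum>m\<in>UNIV. Gam m i k u * Gam k m j u)"
      by (intro sum.cong refl) (metis christoffel_commute[OF u] mult.commute)
    ultimately show ?thesis unfolding ricci_coord_def by (simp add: sum.distrib sum_subtractf)
  qed
  also have "\<dots> = (\<Sum>k\<in>UNIV. \<Sum>l\<in>UNIV. inv_met u $ k $ l *
    (second_form i j u \<bullet> second_form k l u - second_form i k u \<bullet> second_form j l u))"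
    unfolding christoffel_derivative[OF u] sum_subtractf[symmetric]
    by (simp add: tang3_commute[OF u, of _ i j] algebra_simps)
  finally show ?thesis .
qed

lemma partial_vol_density:
  assumes u: "u \<in> U"
  shows "partial i (\<lambda>x. vol_density x) u = vol_density u * (\<Sum>k\<in>UNIV. Gam k i k u)"
proof -
  have inv: "inv_met u ** met u = mat 1"
    using det_met_pos[OF u] by (intro matrix_inv_left) (simp add: invertible_det_nz)
  have "partial i (\<lambda>x. det (met x)) u = det (met u) *
      (\<Sum>k\<in>UNIV. \<Sum>l\<in>UNIV. partial i (\<lambda>x. met x $ k $ l) u * inv_met u $ l $ k)"
    using partial_eqI[OF has_derivative_det[where A = met and u = u, OF _ inv], OF has_frechet_derivative[OF smooth_differentiable(3)[OF u]]]
    by (simp add: partial_def)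
  also have "(\<Sum>k\<in>UNIV. \<Sum>l\<in>UNIV. partial i (\<lambda>x. met x $ k $ l) u * inv_met u $ l $ k)
     = (\<Sum>k\<in>UNIV. \<Sum>l\<in>UNIV. inv_met u $ k $ l * (tang2 i k u \<bullet> tang l u))
     + (\<Sum>k\<in>UNIV. \<Sum>l\<in>UNIV. inv_met u $ l $ k * (tang2 i l u \<bullet> tang k u))"
    by (simp add: partial_met[OF u] algebra_simps sum.distrib inv_met_commute[OF u] inner_commute)
  also have "\<dots> = 2 * (\<Sum>k\<in>UNIV. Gam k i k u)"
    by (subst (2) sum.swap) (simp add: christoffel_formula[OF u])
  finally have d: "partial i (\<lambda>x. det (met x)) u = det (met u) * (2 * (\<Sum>k\<in>UNIV. Gam k i k u))" .
  have sm: "smooth_on U (\<lambda>x. det (met x))" by (intro smooth_on_det open_U smooth_met)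
  have "partial i (\<lambda>x. vol_density x) u = partial i (\<lambda>x. det (met x) powr (1/2)) u"
    by (rule partial_cong[OF open_U u])
       (use det_met_pos smooth_differentiable(6)[OF u] in \<open>auto simp: powr_half_sqrt less_imp_le\<close>)
  also have "\<dots> = (1/2) * det (met u) powr (1/2 - 1) * partial i (\<lambda>x. det (met x)) u"
    by (rule partial_powr[OF smooth_on_imp_differentiable[OF sm u] det_met_pos[OF u]])
  also have "\<dots> = (det (met u) powr 1 * det (met u) powr (1/2 - 1)) * (\<Sum>k\<in>UNIV. Gam k i k u)"
    using det_met_pos[OF u] by (simp add: d)
  also have "det (met u) powr 1 * det (met u) powr (1/2 - 1) = vol_density u"
    unfolding powr_add[symmetric] using det_met_pos[OF u] by (simp add: powr_half_sqrt less_imp_le)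
  finally show ?thesis .
qed

lemma partial_inv_met:
  assumes u: "u \<in> U"
  shows "partial k (\<lambda>x. inv_met x $ i $ j) u =
    - (\<Sum>m\<in>UNIV. inv_met u $ i $ m * Gam j k m u) - (\<Sum>l\<in>UNIV. Gam i k l u * inv_met u $ l $ j)"
proof -
  let ?Y = "\<lambda>l. - (\<Sum>m\<in>UNIV. inv_met u $ i $ m * (tang2 k m u \<bullet> tang l u + tang m u \<bullet> tang2 k l u))"
  have "partial k (\<lambda>x. inv_met x $ i $ j) u = (\<Sum>l\<in>UNIV. inv_met u $ j $ l * ?Y l)"
  proof (rule raise_index[OF u])
    fix l
    have "0 = partial k (\<lambda>x. (if i = l then 1 else 0) :: real) u" by simp
    also have "\<dots> = partial k (\<lambda>x. \<Sum>m\<in>UNIV. inv_met x $ i $ m * met x $ m $ l) u"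
      by (rule partial_cong[OF open_U u]) (auto simp: inv_met_met)
    also have "\<dots> = (\<Sum>m\<in>UNIV. partial k (\<lambda>x. inv_met x $ i $ m * met x $ m $ l) u)"
      by (rule partial_sum) (use smooth_differentiable u in \<open>auto intro!: differentiable_mult\<close>)
    also have "\<dots> = (\<Sum>m\<in>UNIV. partial k (\<lambda>x. inv_met x $ i $ m) u * met u $ m $ l) - ?Y l"
      by (subst partial_mult) (use smooth_differentiable u in \<open>auto simp: partial_met sum.distrib\<close>)
    finally show "(\<Sum>m\<in>UNIV. partial k (\<lambda>x. inv_met x $ i $ m) u * met u $ m $ l) = ?Y l" by simp
  qed
  also have "\<dots> = - (\<Sum>l\<in>UNIV. \<Sum>m\<in>UNIV. inv_met u $ i $ m * (inv_met u $ j $ l * (tang2 k m u \<bullet> tang l u)))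
      - (\<Sum>l\<in>UNIV. \<Sum>m\<in>UNIV. (inv_met u $ i $ m * (tang2 k l u \<bullet> tang m u)) * inv_met u $ l $ j)"
    by (simp add: sum_distrib_left sum_negf sum.distrib sum_subtractf algebra_simps inner_commute inv_met_commute[OF u, of j])
  also have "\<dots> = - (\<Sum>m\<in>UNIV. inv_met u $ i $ m * Gam j k m u) - (\<Sum>l\<in>UNIV. Gam i k l u * inv_met u $ l $ j)"
    by (subst sum.swap) (simp add: christoffel_formula[OF u] sum_distrib_left sum_distrib_right)
  finally show ?thesis .
qed

text \<open>
  The identity behind the divergence form of the Laplacian: the terms from the volume density and from
  one of the two indices of the inverse metric cancel.
\<close>

lemma divergence_inv_met:
  assumes u: "u \<in> U"
  shows "(\<Sum>i\<in>UNIV. partial i (\<lambda>x. vol_density x * inv_met x $ i $ j) u) =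
    - vol_density u * (\<Sum>i\<in>UNIV. \<Sum>m\<in>UNIV. inv_met u $ i $ m * Gam j i m u)"
proof -
  have "partial i (\<lambda>x. vol_density x * inv_met x $ i $ j) u =
     vol_density u * ((\<Sum>k\<in>UNIV. Gam k i k u * inv_met u $ i $ j) - (\<Sum>m\<in>UNIV. inv_met u $ i $ m * Gam j i m u)
       - (\<Sum>l\<in>UNIV. Gam i i l u * inv_met u $ l $ j))" for i
    by (subst partial_mult)
       (use smooth_differentiable u in \<open>auto simp: partial_inv_met partial_vol_density sum_distrib_right[symmetric] algebra_simps\<close>)
  then have "(\<Sum>i\<in>UNIV. partial i (\<lambda>x. vol_density x * inv_met x $ i $ j) u) =
     vol_density u * ((\<Sum>i\<in>UNIV. \<Sum>k\<in>UNIV. Gam k i k u * inv_met u $ i $ j) - (\<Sum>i\<in>UNIV. \<Sum>m\<in>UNIV. inv_met u $ i $ m * Gam j i m u)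
       - (\<Sum>i\<in>UNIV. \<Sum>l\<in>UNIV. Gam i i l u * inv_met u $ l $ j))"
    by (simp add: sum_distrib_left[symmetric] sum_subtractf)
  also have "(\<Sum>i\<in>UNIV. \<Sum>k\<in>UNIV. Gam k i k u * inv_met u $ i $ j) = (\<Sum>i\<in>UNIV. \<Sum>l\<in>UNIV. Gam i i l u * inv_met u $ l $ j)"
    by (subst sum.swap) (simp add: christoffel_commute[OF u])
  finally show ?thesis by simp
qed

theorem laplace_divergence_form:
  fixes f :: "real^'n \<Rightarrow> real"
  assumes u: "u \<in> U" and f: "smooth_on U f"
  shows "(\<Sum>i\<in>UNIV. partial i (\<lambda>x. \<Sum>j\<in>UNIV. vol_density x * inv_met x $ i $ j * partial j f x) u)
    = vol_density u * laplace_coord met f u"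
proof -
  note df = smooth_on_imp_differentiable[OF smooth_on_partial[OF f] u]
  have "partial i (\<lambda>x. \<Sum>j\<in>UNIV. vol_density x * inv_met x $ i $ j * partial j f x) u
    = (\<Sum>j\<in>UNIV. partial i (\<lambda>x. vol_density x * inv_met x $ i $ j) u * partial j f u
         + vol_density u * (inv_met u $ i $ j * partial i (partial j f) u))" for i
    by (subst partial_sum) (use smooth_differentiable u df in \<open>auto simp: partial_mult algebra_simps intro!: sum.cong\<close>)
  then have "(\<Sum>i\<in>UNIV. partial i (\<lambda>x. \<Sum>j\<in>UNIV. vol_density x * inv_met x $ i $ j * partial j f x) u)
     = (\<Sum>j\<in>UNIV. (\<Sum>i\<in>UNIV. partial i (\<lambda>x. vol_density x * inv_met x $ i $ j) u) * partial j f u)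
       + vol_density u * (\<Sum>i\<in>UNIV. \<Sum>j\<in>UNIV. inv_met u $ i $ j * partial i (partial j f) u)"
    by (simp add: sum.distrib sum_distrib_left sum_distrib_right) (rule sum.swap)
  also have "(\<Sum>j\<in>UNIV. (\<Sum>i\<in>UNIV. partial i (\<lambda>x. vol_density x * inv_met x $ i $ j) u) * partial j f u)
     = - vol_density u * (\<Sum>j\<in>UNIV. \<Sum>i\<in>UNIV. \<Sum>m\<in>UNIV. inv_met u $ i $ m * (Gam j i m u * partial j f u))"
    unfolding divergence_inv_met[OF u] by (simp add: sum_distrib_left sum_distrib_right sum_negf mult.assoc)
  also have "(\<Sum>j\<in>UNIV. \<Sum>i\<in>UNIV. \<Sum>m\<in>UNIV. inv_met u $ i $ m * (Gam j i m u * partial j f u))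
     = (\<Sum>i\<in>UNIV. \<Sum>m\<in>UNIV. \<Sum>j\<in>UNIV. inv_met u $ i $ m * (Gam j i m u * partial j f u))"
    by (subst sum.swap, rule sum.cong[OF refl], rule sum.swap)
  finally show ?thesis
    unfolding laplace_coord_def hessian_coord_def
    by (simp add: right_diff_distrib sum_subtractf sum_negf sum_distrib_left)
qed

text \<open>
  For the restriction of an ambient function, the covariant Hessian is expressed by objects that do
  not involve the coordinates: the ambient derivatives, the tangent vectors and the second fundamental form.
\<close>

lemma hessian_ambient:
  fixes F :: "real^('n option) \<Rightarrow> real"
  assumes u: "u \<in> U" and V: "open V" "smooth_on V F" "\<And>x. x \<in> U \<Longrightarrow> \<phi> x \<in> V"
  shows "hessian_coord met (F \<circ> \<phi>) i j u =
    D2 F (\<phi> u) (tang i u) (tang j u) + D F (\<phi> u) (second_form i j u)"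
proof -
  let ?DF = "\<lambda>x. D F x"
  have lin: "linear (?DF x)" if "x \<in> V" for x
    by (rule linear_frechet_derivative[OF smooth_on_imp_differentiable[OF V(2) that]])
  note Vu = V(3)[OF u]
  have 1: "partial j (F \<circ> \<phi>) x = ?DF (\<phi> x) (tang j x)" if "x \<in> U" for x j
    using partial_compose[OF phi_differentiable[OF that] smooth_on_imp_differentiable[OF V(2) V(3)[OF that]]]
    by (simp add: o_def)
  have sm: "smooth_on U (F \<circ> \<phi>)"
    using smooth_on_compose[OF open_U V(1,3,2) smooth_phi] by (simp add: o_def)
  have e: "?DF x v = (\<Sum>b\<in>Basis. (v \<bullet> b) * ?DF x b)" if "x \<in> V" for x v
    using linear_basis_expansion[OF lin[OF that], of v] by simp
  have 2: "partial i (partial j (F \<circ> \<phi>)) u = D2 F (\<phi> u) (tang i u) (tang j u) + ?DF (\<phi> u) (tang2 i j u)"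
  proof -
    have dDF: "(\<lambda>x. ?DF x b) differentiable (at (\<phi> u))" for b
      by (rule smooth_on_imp_differentiable[OF smooth_on_frechet[OF V(2)] Vu])
    have dDFp: "(\<lambda>x. ?DF (\<phi> x) b) differentiable (at u)" for b
      using differentiable_chain_at[OF phi_differentiable[OF u] dDF[of b]] by (simp add: o_def)
    have dti: "(\<lambda>x. tang j x \<bullet> b) differentiable (at u)" for b
      using smooth_on_imp_differentiable[OF smooth_on_inner[OF open_U smooth_tang smooth_on_const] u] .
    have "partial i (partial j (F \<circ> \<phi>)) u = partial i (\<lambda>x. \<Sum>b\<in>Basis. (tang j x \<bullet> b) * ?DF (\<phi> x) b) u"
      by (rule partial_cong[OF open_U u])
         (use 1 e V(3) smooth_on_imp_differentiable[OF smooth_on_partial[OF sm] u] in auto)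
    also have "\<dots> = (\<Sum>b\<in>Basis. partial i (\<lambda>x. (tang j x \<bullet> b) * ?DF (\<phi> x) b) u)"
      by (rule partial_sum) (intro differentiable_mult dti dDFp)
    also have "\<dots> = (\<Sum>b\<in>Basis. (tang2 i j u \<bullet> b) * ?DF (\<phi> u) b + (tang j u \<bullet> b) * D2 F (\<phi> u) (tang i u) b)"
    proof (rule sum.cong[OF refl])
      fix b :: "real^('n option)"
      have "partial i (\<lambda>x. ?DF (\<phi> x) b) u = D2 F (\<phi> u) (tang i u) b"
        unfolding D2_def by (rule partial_compose[OF phi_differentiable[OF u] dDF])
      moreover have "partial i (\<lambda>x. tang j x \<bullet> b) u = tang2 i j u \<bullet> b"
        by (subst partial_inner) (use smooth_differentiable u in auto)
      ultimately show "partial i (\<lambda>x. (tang j x \<bullet> b) * ?DF (\<phi> x) b) u =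
        (tang2 i j u \<bullet> b) * ?DF (\<phi> u) b + (tang j u \<bullet> b) * D2 F (\<phi> u) (tang i u) b"
        by (simp add: partial_mult[OF dti dDFp])
    qed
    also have "\<dots> = D2 F (\<phi> u) (tang i u) (tang j u) + ?DF (\<phi> u) (tang2 i j u)"
      using linear_basis_expansion[OF linear_second_derivative(2)[OF V(1) Vu V(2)], of "tang i u" "tang j u"]
      by (simp add: sum.distrib e[OF Vu, of "tang2 i j u"])
    finally show ?thesis .
  qed
  have "?DF (\<phi> u) (second_form i j u) = ?DF (\<phi> u) (tang2 i j u) - (\<Sum>k\<in>UNIV. Gam k i j u * ?DF (\<phi> u) (tang k u))"
    by (simp add: second_form_def linear_diff[OF lin[OF Vu]] linear_sum[OF lin[OF Vu]] linear_cmul[OF lin[OF Vu]])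
  then show ?thesis
    by (simp add: hessian_coord_def 2 1[OF u])
qed

end

section \<open>Taylor expansions along curves\<close>

lemma taylor_first_order_limit:
  fixes f :: "'a::euclidean_space \<Rightarrow> 'b::euclidean_space"
  assumes f: "f differentiable (at u)"
    and \<eta>: "(\<eta> \<longlongrightarrow> 0) (at_right 0)" "eventually (\<lambda>t. norm (\<eta> t) \<le> K * t) (at_right 0)"
  shows "((\<lambda>t. (1 / t) *\<^sub>R (f (u + \<eta> t) - f u - D f u (\<eta> t))) \<longlongrightarrow> 0) (at_right 0)"
proof (rule tendstoI)
  fix e :: real assume e: "e > 0"
  define e' where "e' = e / (2 * (\<bar>K\<bar> + 1))"
  have e': "e' > 0" "e' * \<bar>K\<bar> < e" using e by (auto simp: e'_def field_simps add_pos_nonneg add_nonneg_pos)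
  obtain d where d: "d > 0" "\<And>x. norm (x - u) < d \<Longrightarrow> norm (f x - f u - D f u (x - u)) \<le> e' * norm (x - u)"
    using has_frechet_derivative[OF f] e' unfolding has_derivative_at_alt by blast
  have "eventually (\<lambda>t. norm (\<eta> t) < d) (at_right 0)"
    using \<eta>(1) d(1) by (auto dest!: tendstoD simp: dist_norm)
  then show "eventually (\<lambda>t. dist ((1 / t) *\<^sub>R (f (u + \<eta> t) - f u - D f u (\<eta> t))) 0 < e) (at_right 0)"
    using \<eta>(2) eventually_at_right_less[of "0::real"]
  proof eventually_elim
    case (elim t)
    have "norm (f (u + \<eta> t) - f u - D f u (\<eta> t)) \<le> e' * norm (\<eta> t)"
      using d(2)[of "u + \<eta> t"] elim by simp
    also have "\<dots> \<le> e' * (\<bar>K\<bar> * t)"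
      using elim e' by (intro mult_left_mono) (auto intro: order_trans mult_right_mono)
    also have "\<dots> < e * t" using e' elim by (simp add: mult.assoc[symmetric])
    finally show ?case
      unfolding dist_norm diff_zero norm_scaleR using elim by (simp add: pos_divide_less_eq)
  qed
qed

lemma taylor_second_order_limit:
  fixes f :: "'a::euclidean_space \<Rightarrow> 'b::euclidean_space"
  assumes U: "open U" "u \<in> U" and f: "smooth_on U f"
    and \<eta>: "(\<eta> \<longlongrightarrow> 0) (at_right 0)" "eventually (\<lambda>t. norm (\<eta> t) \<le> K * t) (at_right 0)"
  shows "((\<lambda>t. (1 / t\<^sup>2) *\<^sub>R (f (u + \<eta> t) - f u - D f u (\<eta> t)
    - (1/2) *\<^sub>R D2 f u (\<eta> t) (\<eta> t))) \<longlongrightarrow> 0) (at_right 0)"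
proof (rule tendstoI)
  fix e :: real assume e: "e > 0"
  define e' where "e' = e / (2 * (K\<^sup>2 + 1))"
  have e': "e' > 0" "e' * K\<^sup>2 < e" using e by (auto simp: e'_def field_simps add_nonneg_pos add_pos_nonneg)
  obtain d where d: "d > 0" "\<And>h. norm h < d \<Longrightarrow> u + h \<in> U \<and>
    norm (f (u + h) - f u - D f u h - (1/2) *\<^sub>R D2 f u h h) \<le> e' * (norm h)\<^sup>2"
    using taylor_second_order[OF U f e'(1)] by metis
  have "eventually (\<lambda>t. norm (\<eta> t) < d) (at_right 0)"
    using \<eta>(1) d(1) by (auto dest!: tendstoD simp: dist_norm)
  then show "eventually (\<lambda>t. dist ((1 / t\<^sup>2) *\<^sub>R (f (u + \<eta> t) - f u - D f u (\<eta> t)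
    - (1/2) *\<^sub>R D2 f u (\<eta> t) (\<eta> t))) 0 < e) (at_right 0)"
    using \<eta>(2) eventually_at_right_less[of "0::real"]
  proof eventually_elim
    case (elim t)
    have "norm (f (u + \<eta> t) - f u - D f u (\<eta> t)
      - (1/2) *\<^sub>R D2 f u (\<eta> t) (\<eta> t)) \<le> e' * (norm (\<eta> t))\<^sup>2"
      using d(2) elim by blast
    also have "\<dots> \<le> e' * (K * t)\<^sup>2"
      using elim e' by (intro mult_left_mono power_mono) auto
    also have "\<dots> < e * t\<^sup>2" using e' elim by (simp add: mult.assoc[symmetric] power_mult_distrib)
    finally show ?case
      unfolding dist_norm diff_zero norm_scaleR using elim by (simp add: pos_divide_less_eq)
  qed
qed

lemma tendsto_second_derivative:
  fixes f :: "real^'n::finite \<Rightarrow> 'b::euclidean_space"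
  assumes "open U" "u \<in> U" "smooth_on U f" "(h \<longlongrightarrow> k) F"
  shows "((\<lambda>t. D2 f u (h t) (h t)) \<longlongrightarrow> D2 f u k k) F"
  unfolding second_derivative_partial[OF assms(1-3)]
  by (intro tendsto_intros assms(4))

section \<open>Independence of the parametrization\<close>

lemma immersion_of_parametrization:
  "local_parametrization M U \<phi> \<Longrightarrow> immersion U \<phi>"
  unfolding local_parametrization_def by unfold_locales auto

lemma parametrization_in: "local_parametrization M U \<phi> \<Longrightarrow> u \<in> U \<Longrightarrow> \<phi> u \<in> M"
  unfolding local_parametrization_def by (meson image_eqI openin_imp_subset subsetD)

text \<open>
  A point near \<open>\<phi>2 u2\<close> on the line in direction \<open>\<xi>\<close> is also \<open>\<phi>1 (u1 + \<eta> t)\<close>. Both parametrizations expand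
  this point to second order, where \<open>\<eta> t\<close> tends to zero by continuity of the inverse parametrization. The
  first-order terms determine the limit \<open>S\<close> of \<open>\<eta> t / t\<close>; a normal vector annihilates them, so the
  second-order terms have equal normal components.
\<close>

lemma chart_change_direction:
  fixes M :: "(real^('n::finite option)) set" and \<xi> :: "real^'n"
  assumes P1: "local_parametrization M U1 \<phi>1" and P2: "local_parametrization M U2 \<phi>2"
    and u1: "u1 \<in> U1" and u2: "u2 \<in> U2" and p: "\<phi>1 u1 = \<phi>2 u2"
    and A: "linear A" "A \<circ> D \<phi>1 u1 = id"
  defines "S \<equiv> A (D \<phi>2 u2 \<xi>)"
  shows "D \<phi>1 u1 S = D \<phi>2 u2 \<xi>"
    and "(\<And>v. \<nu> \<bullet> D \<phi>1 u1 v = 0) \<Longrightarrow>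
      \<nu> \<bullet> D2 \<phi>1 u1 S S = \<nu> \<bullet> D2 \<phi>2 u2 \<xi> \<xi>"
proof -
  interpret I1: immersion U1 \<phi>1 by (rule immersion_of_parametrization[OF P1])
  interpret I2: immersion U2 \<phi>2 by (rule immersion_of_parametrization[OF P2])
  let ?E1 = "D \<phi>1 u1" and ?E2 = "D \<phi>2 u2"
  let ?H1 = "D2 \<phi>1 u1" and ?H2 = "D2 \<phi>2 u2"
  have lin1: "linear ?E1" and lin2: "linear ?E2"
    using I1.linear_frechet_phi[OF u1] I2.linear_frechet_phi[OF u2] .
  obtain \<psi> where \<psi>: "homeomorphism U1 (\<phi>1 ` U1) \<phi>1 \<psi>"
    using P1 unfolding local_parametrization_def by blast
  obtain O1 where O1: "open O1" "\<phi>1 ` U1 = M \<inter> O1"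
    using P1 unfolding local_parametrization_def openin_open by blast
  define q where "q = (\<lambda>t. \<phi>2 (u2 + t *\<^sub>R \<xi>))"
  define \<eta> where "\<eta> = (\<lambda>t. \<psi> (q t) - u1)"
  have line: "((\<lambda>t. u2 + t *\<^sub>R \<xi>) \<longlongrightarrow> u2) (at_right 0)"
    by (auto intro!: tendsto_eq_intros)
  have inU2: "eventually (\<lambda>t. u2 + t *\<^sub>R \<xi> \<in> U2) (at_right 0)"
    by (rule topological_tendstoD[OF line I2.open_U u2])
  have "isCont \<phi>2 u2" using differentiable_imp_continuous_within[OF I2.phi_differentiable[OF u2]] .
  then have q: "(q \<longlongrightarrow> \<phi>2 u2) (at_right 0)"
    unfolding q_def by (rule isCont_tendsto_compose[OF _ line])
  have pO1: "\<phi>2 u2 \<in> \<phi>1 ` U1" using u1 p by (metis imageI)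
  then have inO: "eventually (\<lambda>t. q t \<in> O1) (at_right 0)"
    using topological_tendstoD[OF q O1(1)] O1(2) by blast
  have qin: "eventually (\<lambda>t. q t \<in> \<phi>1 ` U1) (at_right 0)"
    using inU2 inO by eventually_elim (use parametrization_in[OF P2] O1(2) q_def in auto)
  have "((\<lambda>t. \<psi> (q t)) \<longlongrightarrow> \<psi> (\<phi>2 u2)) (at_right 0)"
    by (rule continuous_on_tendsto_compose[OF homeomorphism_cont2[OF \<psi>] q pO1 qin])
  moreover have "\<psi> (\<phi>2 u2) = u1" using homeomorphism_apply1[OF \<psi> u1] p by simp
  ultimately have \<eta>0: "(\<eta> \<longlongrightarrow> 0) (at_right 0)"
    unfolding \<eta>_def by (metis LIM_zero)
  have \<phi>\<eta>: "eventually (\<lambda>t. \<phi>1 (u1 + \<eta> t) = q t) (at_right 0)"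
    using qin by eventually_elim (simp add: \<eta>_def homeomorphism_apply2[OF \<psi>])
  \<comment> \<open>The injective derivative bounds \<open>\<eta> t\<close> by the displacement in the ambient space, hence by a multiple of \<open>t\<close>.\<close>
  have \<xi>b: "eventually (\<lambda>t. norm (t *\<^sub>R \<xi>) \<le> norm \<xi> * t) (at_right 0)"
    using eventually_at_right_less[of "0::real"] by eventually_elim simp
  have \<xi>0: "((\<lambda>t. t *\<^sub>R \<xi>) \<longlongrightarrow> 0) (at_right 0)" by (auto intro!: tendsto_eq_intros)
  have q1: "((\<lambda>t. (1 / t) *\<^sub>R (q t - \<phi>1 u1)) \<longlongrightarrow> ?E2 \<xi>) (at_right 0)"
  proof -
    have "((\<lambda>t. (1 / t) *\<^sub>R (q t - \<phi>1 u1 - ?E2 (t *\<^sub>R \<xi>)) + ?E2 \<xi>) \<longlongrightarrow> 0 + ?E2 \<xi>) (at_right 0)"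
      using taylor_first_order_limit[OF I2.phi_differentiable[OF u2] \<xi>0 \<xi>b]
      by (intro tendsto_add tendsto_const) (simp add: q_def p)
    then show ?thesis
      unfolding add_0
      by (rule Lim_transform_eventually[OF _ eventually_mono[OF eventually_at_right_less[of "0::real"]]])
         (auto simp: linear_cmul[OF lin2] scaleR_right_diff_distrib)
  qed
  obtain c where c: "c > 0" "\<And>h. c * norm h \<le> norm (?E1 h)"
    using linear_inj_bounded_below_pos[OF lin1 I1.inj_frechet[OF u1]] by (metis mult.commute)
  obtain d where d: "d > 0" "\<And>x. norm (x - u1) < d \<Longrightarrow> norm (\<phi>1 x - \<phi>1 u1 - ?E1 (x - u1)) \<le> (c / 2) * norm (x - u1)"
    using has_frechet_derivative[OF I1.phi_differentiable[OF u1]] c(1) half_gt_zero unfolding has_derivative_at_alt by blast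
  define K where "K = (2 / c) * (norm (?E2 \<xi>) + 1)"
  have "eventually (\<lambda>t. norm (\<eta> t) < d) (at_right 0)"
    using \<eta>0 d(1) by (auto dest!: tendstoD simp: dist_norm)
  moreover have "eventually (\<lambda>t. norm ((1 / t) *\<^sub>R (q t - \<phi>1 u1)) < norm (?E2 \<xi>) + 1) (at_right 0)"
    by (rule order_tendstoD(2)[OF tendsto_norm[OF q1]]) simp
  ultimately have \<eta>b: "eventually (\<lambda>t. norm (\<eta> t) \<le> K * t) (at_right 0)"
    using \<phi>\<eta> eventually_at_right_less[of "0::real"]
  proof eventually_elim
    case (elim t)
    have "c * norm (\<eta> t) \<le> norm (?E1 (\<eta> t))" by (rule c)
    also have "\<dots> \<le> norm (\<phi>1 (u1 + \<eta> t) - \<phi>1 u1) + norm (\<phi>1 (u1 + \<eta> t) - \<phi>1 u1 - ?E1 (\<eta> t))"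
      by (metis norm_minus_commute norm_triangle_sub)
    also have "\<dots> \<le> norm (q t - \<phi>1 u1) + (c / 2) * norm (\<eta> t)"
      using d(2)[of "u1 + \<eta> t"] elim by simp
    also have "norm (q t - \<phi>1 u1) \<le> (norm (?E2 \<xi>) + 1) * t"
      using elim unfolding norm_scaleR by (simp add: pos_divide_less_eq)
    finally show ?case using c(1) by (simp add: K_def field_simps)
  qed
  have E1: "((\<lambda>t. ?E1 ((1 / t) *\<^sub>R \<eta> t)) \<longlongrightarrow> ?E2 \<xi>) (at_right 0)"
  proof -
    have "((\<lambda>t. (1 / t) *\<^sub>R (q t - \<phi>1 u1) - (1 / t) *\<^sub>R (\<phi>1 (u1 + \<eta> t) - \<phi>1 u1 - ?E1 (\<eta> t))) \<longlongrightarrow> ?E2 \<xi> - 0) (at_right 0)"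
      by (intro tendsto_diff q1 taylor_first_order_limit[OF I1.phi_differentiable[OF u1] \<eta>0 \<eta>b])
    then show ?thesis
      unfolding diff_zero
      by (rule Lim_transform_eventually)
         (use \<phi>\<eta> in \<open>eventually_elim, simp add: linear_cmul[OF lin1] scaleR_right_diff_distrib[symmetric]\<close>)
  qed
  have S: "((\<lambda>t. (1 / t) *\<^sub>R \<eta> t) \<longlongrightarrow> S) (at_right 0)"
  proof -
    have "A (?E1 v) = v" for v using A(2) by (metis comp_apply id_apply)
    then show ?thesis
      using bounded_linear.tendsto[OF linear_conv_bounded_linear[THEN iffD1, OF A(1)] E1] by (simp add: S_def)
  qed
  have "((\<lambda>t. ?E1 ((1 / t) *\<^sub>R \<eta> t)) \<longlongrightarrow> ?E1 S) (at_right 0)"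
    by (rule bounded_linear.tendsto[OF linear_conv_bounded_linear[THEN iffD1, OF lin1] S])
  from tendsto_unique[OF _ this E1] show ES: "?E1 S = ?E2 \<xi>" by simp
  assume \<nu>: "\<And>v. \<nu> \<bullet> ?E1 v = 0"
  have \<nu>2: "\<nu> \<bullet> ?E2 (t *\<^sub>R \<xi>) = 0" for t
    using \<nu>[of S] by (simp add: ES linear_cmul[OF lin2])
  have h1: "(1 / t) *\<^sub>R (1 / t) *\<^sub>R ?H1 (\<eta> t) (\<eta> t) = ?H1 ((1 / t) *\<^sub>R \<eta> t) ((1 / t) *\<^sub>R \<eta> t)" for t
    using linear_cmul[OF linear_second_derivative(1)[OF I1.open_U u1 I1.smooth_phi]]
       linear_cmul[OF linear_second_derivative(2)[OF I1.open_U u1 I1.smooth_phi]] by simp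
  have h2: "?H2 (t *\<^sub>R \<xi>) (t *\<^sub>R \<xi>) = t\<^sup>2 *\<^sub>R ?H2 \<xi> \<xi>" for t
    using linear_cmul[OF linear_second_derivative(1)[OF I2.open_U u2 I2.smooth_phi]]
       linear_cmul[OF linear_second_derivative(2)[OF I2.open_U u2 I2.smooth_phi]] by (simp add: power2_eq_square)
  \<comment> \<open>The same limit computed in the two parametrizations.\<close>
  have L1: "((\<lambda>t. (1 / t\<^sup>2) * (\<nu> \<bullet> (q t - \<phi>1 u1))) \<longlongrightarrow> \<nu> \<bullet> (0 + (1/2) *\<^sub>R ?H1 S S)) (at_right 0)"
  proof -
    have "((\<lambda>t. \<nu> \<bullet> ((1 / t\<^sup>2) *\<^sub>R (\<phi>1 (u1 + \<eta> t) - \<phi>1 u1 - ?E1 (\<eta> t) - (1/2) *\<^sub>R ?H1 (\<eta> t) (\<eta> t))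
       + (1/2) *\<^sub>R ?H1 ((1 / t) *\<^sub>R \<eta> t) ((1 / t) *\<^sub>R \<eta> t))) \<longlongrightarrow> \<nu> \<bullet> (0 + (1/2) *\<^sub>R ?H1 S S)) (at_right 0)"
      by (intro tendsto_inner tendsto_add tendsto_scaleR tendsto_const
         taylor_second_order_limit[OF I1.open_U u1 I1.smooth_phi \<eta>0 \<eta>b]
         tendsto_second_derivative[OF I1.open_U u1 I1.smooth_phi S])
    then show ?thesis
      by (rule Lim_transform_eventually)
         (use \<phi>\<eta> in \<open>eventually_elim, simp add: h1[symmetric] inner_simps \<nu> power2_eq_square algebra_simps\<close>)
  qed
  have L2: "((\<lambda>t. (1 / t\<^sup>2) * (\<nu> \<bullet> (q t - \<phi>1 u1))) \<longlongrightarrow> \<nu> \<bullet> (0 + (1/2) *\<^sub>R ?H2 \<xi> \<xi>)) (at_right 0)"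
  proof -
    have "((\<lambda>t. \<nu> \<bullet> ((1 / t\<^sup>2) *\<^sub>R (\<phi>2 (u2 + t *\<^sub>R \<xi>) - \<phi>2 u2 - ?E2 (t *\<^sub>R \<xi>) - (1/2) *\<^sub>R ?H2 (t *\<^sub>R \<xi>) (t *\<^sub>R \<xi>))
       + (1/2) *\<^sub>R ?H2 \<xi> \<xi>)) \<longlongrightarrow> \<nu> \<bullet> (0 + (1/2) *\<^sub>R ?H2 \<xi> \<xi>)) (at_right 0)"
      by (intro tendsto_inner tendsto_add tendsto_const
         taylor_second_order_limit[OF I2.open_U u2 I2.smooth_phi \<xi>0 \<xi>b])
    then show ?thesis
      by (rule Lim_transform_eventually[OF _ eventually_mono[OF eventually_at_right_less[of "0::real"]]])
         (simp add: h2 inner_simps \<nu>2 q_def p algebra_simps)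
  qed
  from tendsto_unique[OF _ L1 L2] show "\<nu> \<bullet> ?H1 S S = \<nu> \<bullet> ?H2 \<xi> \<xi>" by simp
qed

context immersion begin

text \<open>
  The second fundamental form as a bilinear map on coordinate vectors.
\<close>

definition sform :: "real^'n \<Rightarrow> real^'n \<Rightarrow> real^'n \<Rightarrow> real^('n option)" where
  "sform u v w = (\<Sum>i\<in>UNIV. \<Sum>j\<in>UNIV. (v $ i * w $ j) *\<^sub>R second_form i j u)"

lemma sform_bilinear: "linear (\<lambda>v. sform u v w)" "linear (\<lambda>w. sform u v w)"
  unfolding sform_def
  by (auto intro!: linearI simp: algebra_simps sum.distrib scaleR_sum_right)

lemma sform_commute: "u \<in> U \<Longrightarrow> sform u v w = sform u w v"
  unfolding sform_def by (subst sum.swap) (simp add: second_form_commute[of u] mult.commute)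

lemma sform_axis: "sform u (axis i 1) (axis j 1) = second_form i j u"
proof -
  have "sform u (axis i 1) (axis j 1) = (\<Sum>k\<in>UNIV. \<Sum>l\<in>UNIV. if k = i then (if l = j then second_form k l u else 0) else 0)"
    unfolding sform_def by (intro sum.cong refl) (auto simp: axis_def)
  also have "\<dots> = (\<Sum>k\<in>UNIV. if k = i then (\<Sum>l\<in>UNIV. if l = j then second_form k l u else 0) else 0)"
    by (intro sum.cong refl) auto
  also have "\<dots> = second_form i j u"
    by simp
  finally show ?thesis .
qed

lemma frechet_tang: "u \<in> U \<Longrightarrow> D \<phi> u v = (\<Sum>i\<in>UNIV. v $ i *\<^sub>R tang i u)"
  by (rule frechet_derivative_partial[OF phi_differentiable])

lemma sform_normal: "u \<in> U \<Longrightarrow> sform u v w \<bullet> D \<phi> u x = 0"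
  by (simp add: sform_def frechet_tang inner_sum_left inner_sum_right second_form_normal)

lemma normal_second_derivative:
  assumes u: "u \<in> U" and \<nu>: "\<And>v. \<nu> \<bullet> D \<phi> u v = 0"
  shows "\<nu> \<bullet> D2 \<phi> u v w = \<nu> \<bullet> sform u v w"
proof -
  have "\<nu> \<bullet> tang k u = 0" for k using \<nu>[of "axis k 1"] by (simp add: partial_def)
  then show ?thesis
    by (simp add: second_derivative_partial[OF open_U u smooth_phi] sform_def inner_sum_right second_form_def inner_diff_right)
qed

end

lemma quadratic_eq_imp_bilinear_eq:
  fixes B B' :: "'a::real_vector \<Rightarrow> 'a \<Rightarrow> 'b::real_vector"
  assumes B: "\<And>w. linear (\<lambda>v. B v w)" "\<And>v. linear (\<lambda>w. B v w)" "\<And>v w. B v w = B w v"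
    and B': "\<And>w. linear (\<lambda>v. B' v w)" "\<And>v. linear (\<lambda>w. B' v w)" "\<And>v w. B' v w = B' w v"
    and eq: "\<And>v. B v v = B' v v"
  shows "B v w = B' v w"
proof -
  have "B (v + w) (v + w) = B v v + B w w + 2 *\<^sub>R B v w"
    using linear_add[OF B(1)] linear_add[OF B(2)] B(3)[of w v] by (simp add: scaleR_2 algebra_simps)
  moreover have "B' (v + w) (v + w) = B' v v + B' w w + 2 *\<^sub>R B' v w"
    using linear_add[OF B'(1)] linear_add[OF B'(2)] B'(3)[of w v] by (simp add: scaleR_2 algebra_simps)
  ultimately show ?thesis using eq[of "v + w"] eq[of v] eq[of w] by simp
qed

locale chart_change =
  fixes M :: "(real^('n::finite option)) set" and U1 U2 :: "(real^'n) set" and \<phi>1 \<phi>2 u1 u2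
  assumes P1: "local_parametrization M U1 \<phi>1" and P2: "local_parametrization M U2 \<phi>2"
    and u1: "u1 \<in> U1" and u2: "u2 \<in> U2" and same_point: "\<phi>1 u1 = \<phi>2 u2"
begin

sublocale I1: immersion U1 \<phi>1 by (rule immersion_of_parametrization[OF P1])
sublocale I2: immersion U2 \<phi>2 by (rule immersion_of_parametrization[OF P2])

text \<open>
  Equality of the quadratic forms follows by testing the difference, which is a normal vector, against
  itself in \<open>chart_change_direction\<close>; polarization then gives the bilinear forms.
\<close>

lemma transition_matrix:
  obtains S :: "real^'n^'n" where "invertible S"
    "\<And>i. I2.tang i u2 = (\<Sum>a\<in>UNIV. S $ a $ i *\<^sub>R I1.tang a u1)"
    "\<And>i j. I2.second_form i j u2 = (\<Sum>a\<in>UNIV. \<Sum>b\<in>UNIV. (S $ a $ i * S $ b $ j) *\<^sub>R I1.second_form a b u1)"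
proof -
  let ?E1 = "D \<phi>1 u1" and ?E2 = "D \<phi>2 u2"
  have lin1: "linear ?E1" and lin2: "linear ?E2"
    using I1.linear_frechet_phi[OF u1] I2.linear_frechet_phi[OF u2] .
  obtain A where A: "linear A" "A \<circ> ?E1 = id"
    using linear_injective_left_inverse[OF lin1 I1.inj_frechet[OF u1]] by blast
  define T where "T = (\<lambda>\<xi>. A (?E2 \<xi>))"
  have linT: "linear T" using linear_compose[OF lin2 A(1)] by (simp add: T_def o_def)
  have ET: "?E1 (T \<xi>) = ?E2 \<xi>" for \<xi>
    unfolding T_def by (rule chart_change_direction(1)[OF P1 P2 u1 u2 same_point A])
  have quad: "I2.sform u2 \<xi> \<xi> = I1.sform u1 (T \<xi>) (T \<xi>)" for \<xi>
  proof -
    define d where "d = I2.sform u2 \<xi> \<xi> - I1.sform u1 (T \<xi>) (T \<xi>)"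
    have n2: "I2.sform u2 \<xi> \<xi> \<bullet> ?E1 v = 0" for v
    proof -
      have "\<exists>w. ?E1 v = ?E2 w"
      proof -
        have "inj T"
        proof (rule injI)
          fix x y assume "T x = T y"
          then have "?E2 x = ?E2 y" by (metis ET)
          then show "x = y" using I2.inj_frechet[OF u2] by (simp add: injD)
        qed
        then have "surj T" using linear_injective_imp_surjective[OF linT] by simp
        then obtain w where "v = T w" by blast
        then show ?thesis using ET by auto
      qed
      then show ?thesis using I2.sform_normal[OF u2] by metis
    qed
    have nd: "d \<bullet> ?E1 v = 0" for v
      by (simp add: d_def inner_diff_left n2 I1.sform_normal[OF u1])
    have nd2: "d \<bullet> ?E2 v = 0" for v using nd[of "T v"] by (simp add: ET)
    have "d \<bullet> D2 \<phi>1 u1 (T \<xi>) (T \<xi>) = d \<bullet> D2 \<phi>2 u2 \<xi> \<xi>"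
      unfolding T_def by (rule chart_change_direction(2)[OF P1 P2 u1 u2 same_point A nd])
    then have "d \<bullet> d = 0"
      unfolding I1.normal_second_derivative[OF u1 nd] I2.normal_second_derivative[OF u2 nd2]
      by (subst (2) d_def) (simp add: inner_diff_right)
    then show ?thesis by (simp add: d_def)
  qed
  have bil: "I2.sform u2 v w = I1.sform u1 (T v) (T w)" for v w
    by (rule quadratic_eq_imp_bilinear_eq[of "I2.sform u2" "\<lambda>v w. I1.sform u1 (T v) (T w)"])
       (use I2.sform_bilinear I2.sform_commute[OF u2] I1.sform_commute[OF u1] quad
         linear_compose[OF linT I1.sform_bilinear(1)] linear_compose[OF linT I1.sform_bilinear(2)] in \<open>auto simp: o_def\<close>)
  have ent: "matrix T $ a $ i = T (axis i 1) $ a" for a i by (simp add: matrix_def)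
  show ?thesis
  proof (rule that[of "matrix T"])
    have "inj T"
    proof (rule injI)
      fix x y assume "T x = T y"
      then have "?E2 x = ?E2 y" by (metis ET)
      then show "x = y" using I2.inj_frechet[OF u2] by (simp add: injD)
    qed
    then show "invertible (matrix T)"
      using matrix_invertible[OF linT] linear_injective_isomorphism[OF linT] by (auto simp: fun_eq_iff)
    show "I2.tang i u2 = (\<Sum>a\<in>UNIV. matrix T $ a $ i *\<^sub>R I1.tang a u1)" for i
      unfolding ent I1.frechet_tang[OF u1, symmetric] ET by (simp add: partial_def)
    show "I2.second_form i j u2 = (\<Sum>a\<in>UNIV. \<Sum>b\<in>UNIV. (matrix T $ a $ i * matrix T $ b $ j) *\<^sub>R I1.second_form a b u1)" for i j
      unfolding I2.sform_axis[symmetric] bil unfolding I1.sform_def ent ..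
  qed
qed

text \<open>
  Traces with respect to the metric of covariant 2-tensors are independent of the chart. The Ricci
  tensor and the Hessian are such tensors, and the Ricci tensor is itself such a trace.
\<close>

lemma trace_invariant:
  fixes S :: "real^'n^'n"
  assumes S: "invertible S" "\<And>i. I2.tang i u2 = (\<Sum>a\<in>UNIV. S $ a $ i *\<^sub>R I1.tang a u1)"
    and X: "\<And>i j. X2 i j = (\<Sum>a\<in>UNIV. \<Sum>b\<in>UNIV. S $ a $ i * S $ b $ j * X1 a b)"
  shows "(\<Sum>i\<in>UNIV. \<Sum>j\<in>UNIV. I2.inv_met u2 $ i $ j * X2 i j) = (\<Sum>i\<in>UNIV. \<Sum>j\<in>UNIV. I1.inv_met u1 $ i $ j * X1 i j)"
proof -
  let ?g1 = "I1.met u1" and ?g2 = "I2.met u2"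
  have inv2: "invertible ?g2" using I2.det_met_pos[OF u2] by (simp add: invertible_det_nz)
  have g2: "?g2 = transpose S ** ?g1 ** S"
    by (simp add: vec_eq_iff I1.met_entry I2.met_entry S(2) matrix_matrix_mult_def transpose_def
       inner_sum_left inner_sum_right sum_distrib_left sum_distrib_right mult_ac)
  have "transpose S ** (?g1 ** (S ** matrix_inv ?g2 ** transpose S)) = transpose S"
    using matrix_inv_right[OF inv2] by (simp add: matrix_mul_assoc g2[symmetric])
  moreover obtain R where R: "R ** transpose S = mat 1"
  proof -
    obtain R where "S ** R = mat 1" using S(1) invertible_def by blast
    then have "transpose R ** transpose S = mat 1" by (metis matrix_transpose_mul transpose_mat)
    then show ?thesis using that by blast
  qed
  ultimately have "?g1 ** (S ** matrix_inv ?g2 ** transpose S) = mat 1"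
    by (metis matrix_mul_assoc matrix_mul_lid)
  then have e: "I1.inv_met u1 = S ** matrix_inv ?g2 ** transpose S" by (rule matrix_inv_unique)
  have ent: "I1.inv_met u1 $ a $ b = (\<Sum>i\<in>UNIV. \<Sum>j\<in>UNIV. S $ a $ i * I2.inv_met u2 $ i $ j * S $ b $ j)" for a b
    unfolding e by (simp add: matrix_matrix_mult_def transpose_def sum_distrib_right) (rule sum.swap)
  have "(\<Sum>i\<in>UNIV. \<Sum>j\<in>UNIV. I2.inv_met u2 $ i $ j * X2 i j)
    = (\<Sum>i\<in>UNIV. \<Sum>j\<in>UNIV. \<Sum>a\<in>UNIV. \<Sum>b\<in>UNIV. S $ a $ i * I2.inv_met u2 $ i $ j * S $ b $ j * X1 a b)"
    by (simp add: X sum_distrib_left mult_ac)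
  also have "\<dots> = (\<Sum>i\<in>UNIV. \<Sum>a\<in>UNIV. \<Sum>j\<in>UNIV. \<Sum>b\<in>UNIV. S $ a $ i * I2.inv_met u2 $ i $ j * S $ b $ j * X1 a b)"
    by (rule sum.cong[OF refl], rule sum.swap)
  also have "\<dots> = (\<Sum>a\<in>UNIV. \<Sum>i\<in>UNIV. \<Sum>b\<in>UNIV. \<Sum>j\<in>UNIV. S $ a $ i * I2.inv_met u2 $ i $ j * S $ b $ j * X1 a b)"
    by (subst sum.swap, rule sum.cong[OF refl], rule sum.cong[OF refl], rule sum.swap)
  also have "\<dots> = (\<Sum>a\<in>UNIV. \<Sum>b\<in>UNIV. \<Sum>i\<in>UNIV. \<Sum>j\<in>UNIV. S $ a $ i * I2.inv_met u2 $ i $ j * S $ b $ j * X1 a b)"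
    by (rule sum.cong[OF refl], rule sum.swap)
  finally show ?thesis by (simp add: ent sum_distrib_right)
qed

lemma scalar_coord_invariant: "scalar_coord I2.met u2 = scalar_coord I1.met u1"
proof -
  obtain S :: "real^'n^'n" where S: "invertible S"
    "\<And>i. I2.tang i u2 = (\<Sum>a\<in>UNIV. S $ a $ i *\<^sub>R I1.tang a u1)"
    "\<And>i j. I2.second_form i j u2 = (\<Sum>a\<in>UNIV. \<Sum>b\<in>UNIV. (S $ a $ i * S $ b $ j) *\<^sub>R I1.second_form a b u1)"
    by (rule transition_matrix) (rule that)
  let ?II = "\<lambda>i j. I1.second_form i j u1"
  show ?thesis
    unfolding scalar_coord_def
  proof (rule trace_invariant[OF S(1,2)])
    fix i j
    let ?X = "\<lambda>c d. \<Sum>a\<in>UNIV. \<Sum>b\<in>UNIV. S $ a $ i * S $ b $ j * (?II a b \<bullet> ?II c d - ?II a c \<bullet> ?II b d)"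
    have "ricci_coord I2.met i j u2 = (\<Sum>c\<in>UNIV. \<Sum>d\<in>UNIV. I1.inv_met u1 $ c $ d * ?X c d)"
      unfolding I2.gauss_ricci[OF u2]
    proof (rule trace_invariant[OF S(1,2)])
      fix k l
      have 1: "I2.second_form i j u2 \<bullet> I2.second_form k l u2
        = (\<Sum>c\<in>UNIV. \<Sum>d\<in>UNIV. S $ c $ k * S $ d $ l * (\<Sum>a\<in>UNIV. \<Sum>b\<in>UNIV. S $ a $ i * S $ b $ j * (?II a b \<bullet> ?II c d)))"
        unfolding S(3)[of k l] inner_sum_right inner_scaleR_right
        unfolding S(3)[of i j] inner_sum_left inner_scaleR_left ..
      have "I2.second_form i k u2 \<bullet> I2.second_form j l u2
        = (\<Sum>a\<in>UNIV. \<Sum>c\<in>UNIV. \<Sum>b\<in>UNIV. \<Sum>d\<in>UNIV. S $ c $ k * S $ d $ l * (S $ a $ i * S $ b $ j * (?II a c \<bullet> ?II b d)))"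
        unfolding S(3)[of i k] inner_sum_left inner_scaleR_left
        unfolding S(3)[of j l] inner_sum_right inner_scaleR_right
        by (simp add: sum_distrib_left mult_ac)
      also have "\<dots> = (\<Sum>c\<in>UNIV. \<Sum>a\<in>UNIV. \<Sum>d\<in>UNIV. \<Sum>b\<in>UNIV. S $ c $ k * S $ d $ l * (S $ a $ i * S $ b $ j * (?II a c \<bullet> ?II b d)))"
        by (subst sum.swap, rule sum.cong[OF refl], rule sum.cong[OF refl], rule sum.swap)
      also have "\<dots> = (\<Sum>c\<in>UNIV. \<Sum>d\<in>UNIV. \<Sum>a\<in>UNIV. \<Sum>b\<in>UNIV. S $ c $ k * S $ d $ l * (S $ a $ i * S $ b $ j * (?II a c \<bullet> ?II b d)))"
        by (rule sum.cong[OF refl], rule sum.swap)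
      finally show "I2.second_form i j u2 \<bullet> I2.second_form k l u2 - I2.second_form i k u2 \<bullet> I2.second_form j l u2
        = (\<Sum>c\<in>UNIV. \<Sum>d\<in>UNIV. S $ c $ k * S $ d $ l * ?X c d)"
        unfolding 1 by (simp add: sum_distrib_left sum_subtractf right_diff_distrib)
    qed
    also have "\<dots> = (\<Sum>c\<in>UNIV. \<Sum>a\<in>UNIV. \<Sum>b\<in>UNIV. \<Sum>d\<in>UNIV. S $ a $ i * S $ b $ j * (I1.inv_met u1 $ c $ d * (?II a b \<bullet> ?II c d - ?II a c \<bullet> ?II b d)))"
    proof (rule sum.cong[OF refl])
      fix c
      have "(\<Sum>d\<in>UNIV. I1.inv_met u1 $ c $ d * ?X c d) =
        (\<Sum>d\<in>UNIV. \<Sum>a\<in>UNIV. \<Sum>b\<in>UNIV. S $ a $ i * S $ b $ j * (I1.inv_met u1 $ c $ d * (?II a b \<bullet> ?II c d - ?II a c \<bullet> ?II b d)))"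
        by (simp add: sum_distrib_left mult_ac)
      also have "\<dots> = (\<Sum>a\<in>UNIV. \<Sum>b\<in>UNIV. \<Sum>d\<in>UNIV. S $ a $ i * S $ b $ j * (I1.inv_met u1 $ c $ d * (?II a b \<bullet> ?II c d - ?II a c \<bullet> ?II b d)))"
        by (subst sum.swap, rule sum.cong[OF refl], rule sum.swap)
      finally show "(\<Sum>d\<in>UNIV. I1.inv_met u1 $ c $ d * ?X c d) = \<dots>" .
    qed
    also have "\<dots> = (\<Sum>a\<in>UNIV. \<Sum>b\<in>UNIV. S $ a $ i * S $ b $ j * ricci_coord I1.met a b u1)"
      unfolding I1.gauss_ricci[OF u1]
      by (subst sum.swap, rule sum.cong[OF refl], subst sum.swap) (simp add: sum_distrib_left)
    finally show "ricci_coord I2.met i j u2 = (\<Sum>a\<in>UNIV. \<Sum>b\<in>UNIV. S $ a $ i * S $ b $ j * ricci_coord I1.met a b u1)" .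
  qed
qed

lemma laplace_coord_invariant:
  fixes F :: "real^('n option) \<Rightarrow> real"
  assumes F: "smooth_on UNIV F"
  shows "laplace_coord I2.met (F \<circ> \<phi>2) u2 = laplace_coord I1.met (F \<circ> \<phi>1) u1"
proof -
  obtain S :: "real^'n^'n" where S: "invertible S"
    "\<And>i. I2.tang i u2 = (\<Sum>a\<in>UNIV. S $ a $ i *\<^sub>R I1.tang a u1)"
    "\<And>i j. I2.second_form i j u2 = (\<Sum>a\<in>UNIV. \<Sum>b\<in>UNIV. (S $ a $ i * S $ b $ j) *\<^sub>R I1.second_form a b u1)"
    by (rule transition_matrix) (rule that)
  note lin = linear_second_derivative[OF open_UNIV UNIV_I F]
  have linF: "linear (D F p)" for p
    by (rule linear_frechet_derivative[OF smooth_on_imp_differentiable[OF F UNIV_I]])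
  have h1: "hessian_coord I1.met (F \<circ> \<phi>1) a b u1 = D2 F (\<phi>1 u1) (I1.tang a u1) (I1.tang b u1)
     + D F (\<phi>1 u1) (I1.second_form a b u1)" for a b
    by (rule I1.hessian_ambient[OF u1 open_UNIV F UNIV_I])
  have h2: "hessian_coord I2.met (F \<circ> \<phi>2) a b u2 = D2 F (\<phi>1 u1) (I2.tang a u2) (I2.tang b u2)
     + D F (\<phi>1 u1) (I2.second_form a b u2)" for a b
    using I2.hessian_ambient[OF u2 open_UNIV F UNIV_I] same_point by simp
  show ?thesis
    unfolding laplace_coord_def
  proof (rule trace_invariant[OF S(1,2)])
    fix i j
    have "D2 F (\<phi>1 u1) (I2.tang i u2) (I2.tang j u2) =
      (\<Sum>a\<in>UNIV. \<Sum>b\<in>UNIV. S $ a $ i * S $ b $ j * D2 F (\<phi>1 u1) (I1.tang a u1) (I1.tang b u1))"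
      unfolding S(2)[of i] linear_sum[OF lin(1)] linear_cmul[OF lin(1)]
      unfolding S(2)[of j] linear_sum[OF lin(2)] linear_cmul[OF lin(2)]
      by (simp add: sum_distrib_left mult.assoc)
    moreover have "D F (\<phi>1 u1) (I2.second_form i j u2) =
      (\<Sum>a\<in>UNIV. \<Sum>b\<in>UNIV. S $ a $ i * S $ b $ j * D F (\<phi>1 u1) (I1.second_form a b u1))"
      unfolding S(3) by (simp add: linear_sum[OF linF] linear_cmul[OF linF])
    ultimately show "hessian_coord I2.met (F \<circ> \<phi>2) i j u2 =
      (\<Sum>a\<in>UNIV. \<Sum>b\<in>UNIV. S $ a $ i * S $ b $ j * hessian_coord I1.met (F \<circ> \<phi>1) a b u1)"
      unfolding h1 h2 by (simp add: sum.distrib distrib_left)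
  qed
qed

end

lemma chart_at_exists:
  assumes "local_parametrization M U \<phi>" "u \<in> U"
  obtains U' \<phi>' u' where "chart_at M (\<phi> u) = (\<phi>', u')" "local_parametrization M U' \<phi>'" "u' \<in> U'" "\<phi>' u' = \<phi> u"
proof -
  obtain \<phi>' u' where c: "chart_at M (\<phi> u) = (\<phi>', u')" by fastforce
  let ?P = "\<lambda>(\<psi>, v). \<exists>U. local_parametrization M U \<psi> \<and> v \<in> U \<and> \<psi> v = \<phi> u"
  have "?P (\<phi>, u)" using assms by auto
  then have "?P (chart_at M (\<phi> u))" unfolding chart_at_def by (rule someI)
  then show ?thesis using that c by auto
qed

lemma conformal_laplacian_chart:
  fixes M :: "(real^('n::finite option)) set"
  assumes P: "local_parametrization M U \<phi>" and u: "u \<in> U" and F: "smooth_on UNIV F"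
  shows "conformal_laplacian M F (\<phi> u) = - laplace_coord (induced_metric \<phi>) (F \<circ> \<phi>) u
    + (real CARD('n) - 2) / (4 * (real CARD('n) - 1)) * scalar_coord (induced_metric \<phi>) u * F (\<phi> u)"
proof -
  obtain U' \<phi>' u' where c: "chart_at M (\<phi> u) = (\<phi>', u')" "local_parametrization M U' \<phi>'" "u' \<in> U'" "\<phi>' u' = \<phi> u"
    using chart_at_exists[OF P u] by metis
  interpret chart_change M U' U \<phi>' \<phi> u' u by unfold_locales (use c P u in auto)
  show ?thesis
    unfolding conformal_laplacian_def laplace_beltrami_def scalar_curvature_def c
    using scalar_coord_invariant laplace_coord_invariant[OF F] by simp
qed

text \<open>
  Restrictions of ambient functions are smooth in every parametrization by the chain rule alone. They
  are the test functions used throughout.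
\<close>

lemma smooth_function_ambient:
  assumes F: "smooth_on UNIV F" shows "smooth_function M F"
  unfolding smooth_function_def o_def
proof (intro allI impI)
  fix U \<phi> assume "local_parametrization M U \<phi>"
  then have "open U" "smooth_on U \<phi>" by (auto simp: local_parametrization_def)
  then show "smooth_on U (\<lambda>x. F (\<phi> x))"
    using smooth_on_compose[OF _ open_UNIV UNIV_I F] by blast
qed

lemma conformal_laplacian_local:
  assumes P: "local_parametrization M U \<phi>" and u: "u \<in> U" and F: "smooth_on UNIV F"
    and W: "open W" "\<phi> u \<in> W" "\<And>x. x \<in> W \<Longrightarrow> F x = 0"
  shows "conformal_laplacian M F (\<phi> u) = 0"
proof -
  interpret immersion U \<phi> by (rule immersion_of_parametrization[OF P])
  have flat: "D f x v = 0" if "x \<in> W" "\<And>x. x \<in> W \<Longrightarrow> f x = 0" for f :: "_ \<Rightarrow> real" and x v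
  proof -
    have "D (\<lambda>x. 0 :: real) x = D f x"
      by (rule frechet_derivative_transform_within_open[OF differentiable_const W(1) that(1)]) (simp add: that(2))
    from fun_cong[OF this, of v] show ?thesis by simp
  qed
  have D: "D F x v = 0" if "x \<in> W" for x v
    by (rule flat[OF that W(3)])
  have DD: "D2 F (\<phi> u) v w = 0" for v w
    unfolding D2_def by (rule flat[OF W(2) D])
  show ?thesis
    using D W by (simp add: conformal_laplacian_chart[OF P u F] laplace_coord_def
      hessian_ambient[OF u open_UNIV F UNIV_I] DD)
qed

context immersion begin

lemma smooth_laplace_coord:
  assumes f: "smooth_on U f" shows "smooth_on U (laplace_coord met f)"
  unfolding laplace_coord_def[abs_def] hessian_coord_def
  by (intro smooth_on_sum smooth_on_mult smooth_on_diff open_U smooth_inv_met smooth_christoffel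
     smooth_on_partial f)

lemma smooth_scalar_coord: "smooth_on U (scalar_coord met)"
  unfolding scalar_coord_def[abs_def] ricci_coord_def
  by (intro smooth_on_sum smooth_on_mult smooth_on_diff smooth_on_add open_U smooth_inv_met smooth_christoffel
     smooth_on_partial)

end

text \<open>
  Shrinking the domain allows a local property of a parametrization to be assumed on its whole domain.
\<close>

lemma local_parametrization_subset:
  assumes P: "local_parametrization M U \<phi>" and V: "open V" "V \<subseteq> U"
  shows "local_parametrization M V \<phi>"
proof -
  obtain \<psi> where \<psi>: "homeomorphism U (\<phi> ` U) \<phi> \<psi>"
    using P unfolding local_parametrization_def by blast
  have "openin (top_of_set (\<phi> ` U)) (\<phi> ` V)"
    using homeomorphism_imp_open_map[OF \<psi>] V by (simp add: open_subset)
  moreover have "openin (top_of_set M) (\<phi> ` U)"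
    using P unfolding local_parametrization_def by blast
  ultimately have "openin (top_of_set M) (\<phi> ` V)"
    by (rule openin_trans)
  moreover have "homeomorphism V (\<phi> ` V) \<phi> \<psi>"
    using \<psi> V(2) by (rule homeomorphism_of_subsets) auto
  ultimately show ?thesis
    using P V smooth_on_subset[OF _ V(2)] unfolding local_parametrization_def by blast
qed

section \<open>Integration in a parametrization\<close>

text \<open>
  The defining formula for the volume of Borel sets says that the measure, restricted to the image of
  the parametrization, is the push-forward of the measure with density \<open>sqrt (det g)\<close>.
\<close>

lemma integral_chart:
  fixes M :: "(real^('n::finite option)) set" and w :: "real^('n option) \<Rightarrow> real"
  assumes M: "compact M" and vol: "riemannian_volume M \<mu>" and P: "local_parametrization M U \<phi>"
    and u0: "u0 \<in> U"
    and w: "continuous_on U (\<lambda>u. w (\<phi> u))" "\<And>x. x \<in> M \<Longrightarrow> x \<notin> \<phi> ` U \<Longrightarrow> w x = 0"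
  shows "(\<integral>x. w x \<partial>\<mu>) = (\<integral>u. (if u \<in> U then sqrt (det (induced_metric \<phi> u)) * w (\<phi> u) else 0) \<partial>lborel)"
proof -
  interpret immersion U \<phi> by (rule immersion_of_parametrization[OF P])
  have sp: "space \<mu> = M" and sets: "sets \<mu> = sets (restrict_space borel M)"
    and meas: "\<And>B. B \<in> sets borel \<Longrightarrow> B \<subseteq> \<phi> ` U \<Longrightarrow> emeasure \<mu> B =
      (\<integral>\<^sup>+u. ennreal (vol_density u) * indicator {u\<in>U. \<phi> u \<in> B} u \<partial>lborel)"
    using vol P unfolding riemannian_volume_def by blast+
  have Mb: "M \<in> sets borel" using M by (simp add: compact_imp_closed borel_closed)
  obtain O1 where O1: "open O1" "\<phi> ` U = M \<inter> O1"
    using P unfolding local_parametrization_def openin_open by blast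
  have Ub: "\<phi> ` U \<in> sets borel" unfolding O1(2) using O1(1) Mb by auto
  have mu_sets: "B \<in> sets \<mu> \<longleftrightarrow> B \<in> sets borel \<and> B \<subseteq> M" for B
    unfolding sets using Mb by (auto simp: sets_restrict_space_iff)
  have Um: "\<phi> ` U \<in> sets \<mu>" using Ub O1(2) by (auto simp: mu_sets)
  obtain \<psi> where \<psi>: "homeomorphism U (\<phi> ` U) \<phi> \<psi>"
    using P unfolding local_parametrization_def by blast
  define d where "d = (\<lambda>u. if u \<in> U then vol_density u else 0)"
  define \<phi>' where "\<phi>' = (\<lambda>u. if u \<in> U then \<phi> u else \<phi> u0)"
  have Uo: "U \<in> sets borel" using open_U by auto
  have d: "d \<in> borel_measurable borel" "\<And>u. d u \<ge> 0"
    unfolding d_def using det_met_pos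
    by (auto intro!: borel_measurable_continuous_on_if[OF Uo smooth_on_imp_continuous_on[OF smooth_vol_density]] less_imp_le)
  have \<phi>'b: "\<phi>' \<in> borel_measurable borel"
    unfolding \<phi>'_def by (rule borel_measurable_continuous_on_if[OF Uo smooth_on_imp_continuous_on[OF smooth_phi]]) auto
  have "\<phi>' \<in> measurable borel (restrict_space borel M)"
    by (rule measurable_restrict_space2[OF _ \<phi>'b]) (use parametrization_in[OF P] u0 in \<open>auto simp: \<phi>'_def\<close>)
  then have \<phi>'m: "\<phi>' \<in> measurable lborel \<mu>"
    by (subst measurable_cong_sets[OF sets_lborel sets])
  let ?N = "density lborel (\<lambda>u. ennreal (d u))"
  have \<phi>'N: "\<phi>' \<in> measurable ?N \<mu>" using \<phi>'m by simp
  have wm: "w \<in> borel_measurable \<mu>"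
  proof -
    have "continuous_on (\<phi> ` U) w"
    proof -
      have "continuous_on (\<phi> ` U) (\<lambda>x. w (\<phi> (\<psi> x)))"
        by (rule continuous_on_compose2[OF w(1) homeomorphism_cont2[OF \<psi>]])
           (use homeomorphism_image2[OF \<psi>] in auto)
      then show ?thesis
        by (rule continuous_on_eq) (simp add: homeomorphism_apply2[OF \<psi>])
    qed
    then have "(\<lambda>x. if x \<in> \<phi> ` U then w x else 0) \<in> borel_measurable borel"
      by (rule borel_measurable_continuous_on_if[OF Ub]) auto
    then have "(\<lambda>x. if x \<in> \<phi> ` U then w x else 0) \<in> borel_measurable (restrict_space borel M)"
      by (rule measurable_restrict_space1)
    then have "(\<lambda>x. if x \<in> \<phi> ` U then w x else 0) \<in> borel_measurable \<mu>"
      using measurable_cong_sets[OF sets refl] by blast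
    then show ?thesis
      by (rule measurable_cong[THEN iffD1, rotated]) (use w(2) sp in auto)
  qed
  have eq: "density \<mu> (indicator (\<phi> ` U)) = distr ?N \<mu> \<phi>'"
  proof (rule measure_eqI)
    fix B assume "B \<in> sets (density \<mu> (indicator (\<phi> ` U)))"
    then have B: "B \<in> sets \<mu>" by simp
    have "emeasure (density \<mu> (indicator (\<phi> ` U))) B = emeasure \<mu> (\<phi> ` U \<inter> B)"
      by (rule emeasure_restricted[OF Um B])
    also have "\<dots> = (\<integral>\<^sup>+u. ennreal (vol_density u) * indicator {u\<in>U. \<phi> u \<in> \<phi> ` U \<inter> B} u \<partial>lborel)"
      by (rule meas) (use B Ub in \<open>auto simp: mu_sets\<close>)
    also have "\<dots> = (\<integral>\<^sup>+u. ennreal (d u) * indicator (\<phi>' -` B \<inter> space ?N) u \<partial>lborel)"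
      by (rule nn_integral_cong) (auto simp: d_def \<phi>'_def indicator_def)
    also have "\<dots> = emeasure ?N (\<phi>' -` B \<inter> space ?N)"
      by (rule emeasure_density[symmetric]) (use d measurable_sets[OF \<phi>'N B] in auto)
    also have "\<dots> = emeasure (distr ?N \<mu> \<phi>') B"
      by (rule emeasure_distr[OF \<phi>'N B, symmetric])
    finally show "emeasure (density \<mu> (indicator (\<phi> ` U))) B = emeasure (distr ?N \<mu> \<phi>') B" .
  qed simp
  have "(\<integral>x. w x \<partial>\<mu>) = (\<integral>x. indicator (\<phi> ` U) x *\<^sub>R w x \<partial>\<mu>)"
    by (rule Bochner_Integration.integral_cong) (use w(2) sp in \<open>auto simp: indicator_def\<close>)
  also have "\<dots> = (\<integral>x. w x \<partial>density \<mu> (\<lambda>x. ennreal (indicator (\<phi> ` U) x)))"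
    by (rule integral_density[symmetric]) (use wm Um in auto)
  also have "(\<lambda>x. ennreal (indicator (\<phi> ` U) x)) = indicator (\<phi> ` U)"
    by (auto simp: indicator_def fun_eq_iff)
  also have "(\<integral>x. w x \<partial>density \<mu> (indicator (\<phi> ` U))) = (\<integral>u. w (\<phi>' u) \<partial>?N)"
    unfolding eq by (rule integral_distr[OF \<phi>'N wm])
  also have "\<dots> = (\<integral>u. d u *\<^sub>R w (\<phi>' u) \<partial>lborel)"
    by (rule integral_density) (use d measurable_compose[OF \<phi>'m wm] in auto)
  also have "\<dots> = (\<integral>u. (if u \<in> U then vol_density u * w (\<phi> u) else 0) \<partial>lborel)"
    by (rule Bochner_Integration.integral_cong) (auto simp: d_def \<phi>'_def)
  finally show ?thesis .
qed

text \<open>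
  Translation invariance makes the integral of every difference quotient vanish; the difference
  quotients converge to the derivative and are dominated because the support is compact.
\<close>

lemma integral_directional_derivative_eq_0:
  fixes h :: "'a::euclidean_space \<Rightarrow> real"
  assumes h: "\<And>x. h differentiable (at x)" and D: "continuous_on UNIV (\<lambda>x. D h x v)"
    and K: "compact K" "\<And>x. x \<notin> K \<Longrightarrow> h x = 0"
  shows "(\<integral>x. D h x v \<partial>lborel) = 0"
proof -
  let ?D = "\<lambda>x. D h x v"
  have hc: "continuous_on UNIV h"
    using differentiable_imp_continuous_within[OF h] by (simp add: continuous_on_eq_continuous_at)
  have hi: "integrable lborel h"
  proof -
    have "integrable lborel (\<lambda>x. indicator K x *\<^sub>R h x)"
      by (rule borel_integrable_compact[OF K(1) continuous_on_subset[OF hc]]) auto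
    moreover have "(\<lambda>x. indicator K x *\<^sub>R h x) = h" using K(2) by (auto simp: indicator_def fun_eq_iff)
    ultimately show ?thesis by simp
  qed
  have hm: "h \<in> borel_measurable borel" using hc by (rule borel_measurable_continuous_onI)
  have shift: "integrable lborel (\<lambda>x. h (x + c))" "(\<integral>x. h (x + c) \<partial>lborel) = (\<integral>x. h x \<partial>lborel)" for c
  proof -
    have e: "lborel = distr lborel borel ((+) c)" by (rule lborel_distr_plus[symmetric])
    have "integrable (distr lborel borel ((+) c)) h" using hi e by metis
    then show "integrable lborel (\<lambda>x. h (x + c))"
      using integrable_distr_eq[of "(+) c" lborel borel h] hm by (simp add: add.commute)
    have "(\<integral>x. h x \<partial>lborel) = (\<integral>x. h x \<partial>distr lborel borel ((+) c))" using e by metis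
    also have "\<dots> = (\<integral>x. h (c + x) \<partial>lborel)" by (rule integral_distr) (use hm in auto)
    finally show "(\<integral>x. h (x + c) \<partial>lborel) = (\<integral>x. h x \<partial>lborel)" by (simp add: add.commute)
  qed
  define t where "t = (\<lambda>m. 1 / real (Suc m))"
  have t: "0 < t m" "t m \<le> 1" for m by (auto simp: t_def)
  define q where "q = (\<lambda>m x. (h (x + t m *\<^sub>R v) - h x) / t m)"
  have qi: "(\<integral>x. q m x \<partial>lborel) = 0" for m
    unfolding q_def using hi shift by simp
  obtain R where R: "R > 0" "K \<subseteq> cball 0 R"
    using compact_imp_bounded[OF K(1)] unfolding bounded_pos by (auto simp: subset_iff)
  have "bounded (?D ` cball 0 (R + 2 * norm v))"
    by (intro compact_imp_bounded compact_continuous_image continuous_on_subset[OF D]) auto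
  then obtain B where B: "\<And>x. x \<in> cball 0 (R + 2 * norm v) \<Longrightarrow> \<bar>?D x\<bar> \<le> B"
    unfolding bounded_iff by (metis image_eqI real_norm_def)
  have B0: "B \<ge> 0" using B[of 0] R(1) by (metis abs_ge_zero add_nonneg_nonneg cball_trivial dist_self less_imp_le mem_cball mult_nonneg_nonneg norm_ge_zero order_trans zero_le_numeral)
  have bound: "\<bar>q m x\<bar> \<le> indicator (cball 0 (R + norm v)) x * B" for m x
  proof (cases "x \<in> cball 0 (R + norm v)")
    case True
    define p where "p = (\<lambda>s. h (x + s *\<^sub>R v))"
    have dp: "(p has_real_derivative ?D (x + s *\<^sub>R v)) (at s)" for s
      using has_derivative_line[where u = x and t = s and v = v, OF h] unfolding p_def has_real_derivative_iff_has_vector_derivative .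
    obtain z where z: "0 < z" "z < t m" "p (t m) - p 0 = (t m - 0) * ?D (x + z *\<^sub>R v)"
      using MVT2[OF t(1)[of m], of p "\<lambda>s. ?D (x + s *\<^sub>R v)"] dp by blast
    have "norm (x + z *\<^sub>R v) \<le> norm x + z * norm v"
      using norm_triangle_ineq[of x "z *\<^sub>R v"] z by simp
    also have "\<dots> \<le> (R + norm v) + 1 * norm v"
      using True z t(2)[of m] by (intro add_mono mult_right_mono) auto
    finally have "\<bar>?D (x + z *\<^sub>R v)\<bar> \<le> B" by (intro B) simp
    moreover have "q m x = ?D (x + z *\<^sub>R v)" using z(3) t(1)[of m] by (simp add: q_def p_def)
    ultimately show ?thesis using True by simp
  next
    case False
    then have nx: "norm x > R + norm v" by simp
    have "x \<notin> K" using nx R by (metis add_increasing2 mem_cball_0 norm_ge_zero not_less subsetD)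
    moreover have "x + t m *\<^sub>R v \<notin> K"
    proof
      assume "x + t m *\<^sub>R v \<in> K"
      then have "norm (x + t m *\<^sub>R v) \<le> R" using R(2) by auto
      moreover have "norm (t m *\<^sub>R v) \<le> norm v" using t[of m] by (simp add: mult_left_le_one_le less_imp_le)
      ultimately show False using nx norm_triangle_ineq4[of "x + t m *\<^sub>R v" "t m *\<^sub>R v"] by simp
    qed
    ultimately show ?thesis using K(2) False by (simp add: q_def)
  qed
  have lim: "(\<lambda>m. q m x) \<longlonglongrightarrow> ?D x" for x
  proof -
    have "((\<lambda>s. h (x + s *\<^sub>R v)) has_real_derivative ?D x) (at 0)"
      using has_derivative_line[where u = x and t = 0 and v = v, OF h] unfolding has_real_derivative_iff_has_vector_derivative by simp
    then have l: "((\<lambda>s. (h (x + s *\<^sub>R v) - h x) / s) \<longlongrightarrow> ?D x) (at 0)"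
      by (simp add: DERIV_def)
    have "filterlim t (at 0) sequentially"
      unfolding filterlim_at using LIMSEQ_inverse_real_of_nat t(1)
      by (auto simp: t_def inverse_eq_divide)
    from filterlim_compose[OF l this] show ?thesis by (simp add: q_def)
  qed
  have "(\<lambda>m. \<integral>x. q m x \<partial>lborel) \<longlonglongrightarrow> (\<integral>x. ?D x \<partial>lborel)"
  proof (rule integral_dominated_convergence[where w = "\<lambda>x. indicator (cball 0 (R + norm v)) x * B"])
    show "?D \<in> borel_measurable lborel" using borel_measurable_continuous_onI[OF D] by simp
    show "q m \<in> borel_measurable lborel" for m
      unfolding q_def using hm by measurable
    have "integrable lborel (\<lambda>x::'a. indicator (cball 0 (R + norm v)) x *\<^sub>R B)"
      by (rule borel_integrable_compact) auto
    then show "integrable lborel (\<lambda>x::'a. indicator (cball 0 (R + norm v)) x * B)" by simp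
  qed (use lim bound in auto)
  then show ?thesis unfolding qi by (simp add: LIMSEQ_const_iff)
qed

text \<open>
  Functions on a chart domain that vanish off a compact subset are treated as functions on the whole
  coordinate space.
\<close>

lemma extension_by_zero:
  fixes h :: "'a::euclidean_space \<Rightarrow> real"
  assumes V: "open V" and K: "compact K" "K \<subseteq> V" and h: "continuous_on V h" "\<And>x. x \<in> V \<Longrightarrow> x \<notin> K \<Longrightarrow> h x = 0"
  shows "continuous_on UNIV (\<lambda>x. if x \<in> V then h x else 0)"
    and "integrable lborel (\<lambda>x. if x \<in> V then h x else 0)"
proof -
  let ?h = "\<lambda>x. if x \<in> V then h x else 0"
  have "continuous_on V ?h" using h(1) by (rule continuous_on_eq) simp
  moreover have "continuous_on (- K) ?h"
    by (rule continuous_on_eq[of _ "\<lambda>x. 0"]) (use h(2) in auto)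
  ultimately have "continuous_on (V \<union> - K) ?h"
    using V K by (intro continuous_on_open_Un) (auto intro: compact_imp_closed)
  moreover have "V \<union> - K = UNIV" using K by auto
  ultimately show c: "continuous_on UNIV ?h" by simp
  have "integrable lborel (\<lambda>x. indicator K x *\<^sub>R ?h x)"
    by (rule borel_integrable_compact[OF K(1) continuous_on_subset[OF c]]) auto
  moreover have "(\<lambda>x. indicator K x *\<^sub>R ?h x) = ?h" using h(2) K(2) by (auto simp: indicator_def fun_eq_iff)
  ultimately show "integrable lborel ?h" by simp
qed

lemma integral_partial_eq_0:
  fixes h :: "real^'n::finite \<Rightarrow> real"
  assumes V: "open V" and K: "compact K" "K \<subseteq> V" and h: "smooth_on V h" "\<And>x. x \<in> V \<Longrightarrow> x \<notin> K \<Longrightarrow> h x = 0"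
  shows "integrable lborel (\<lambda>x. if x \<in> V then partial i h x else 0)"
    and "(\<integral>x. (if x \<in> V then partial i h x else 0) \<partial>lborel) = 0"
proof -
  let ?h = "\<lambda>x. if x \<in> V then h x else 0"
  have oK: "open (- K)" using K(1) compact_imp_closed by blast
  have d0: "(f has_derivative (\<lambda>v. 0)) (at x)" if "x \<notin> K" "\<And>x. x \<notin> K \<Longrightarrow> f x = 0" for x and f :: "real^'n \<Rightarrow> real"
    by (rule has_derivative_transform_within_open[OF has_derivative_const oK]) (use that in auto)
  have h0: "?h x = 0" if "x \<notin> K" for x using that h(2) by auto
  have dV: "(?h has_derivative D h x) (at x)" if "x \<in> V" for x
    by (rule has_derivative_transform_within_open[OF has_frechet_derivative[OF smooth_on_imp_differentiable[OF h(1) that]] V that]) auto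
  have p: "partial i ?h = (\<lambda>x. if x \<in> V then partial i h x else 0)"
  proof
    fix x show "partial i ?h x = (if x \<in> V then partial i h x else 0)"
      using partial_eqI[where i = i, OF dV[of x]] partial_eqI[where i = i, OF d0[of x ?h, OF _ h0]] K(2)
      by (auto simp: partial_def)
  qed
  have p0: "partial i h x = 0" if "x \<in> V" "x \<notin> K" for x
    using partial_eqI[where i = i, OF d0[of x ?h, OF that(2) h0]] fun_cong[OF p, of x] that by simp
  note ext = extension_by_zero[OF V K smooth_on_imp_continuous_on[OF smooth_on_partial[OF h(1)]]]
  show "integrable lborel (\<lambda>x. if x \<in> V then partial i h x else 0)" by (rule ext(2)) (rule p0)
  have cp: "continuous_on UNIV (partial i ?h)" unfolding p by (rule ext(1)) (rule p0)
  have "(\<integral>x. D ?h x (axis i 1) \<partial>lborel) = 0"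
  proof (rule integral_directional_derivative_eq_0[OF _ _ K(1) h0])
    show "?h differentiable at x" for x
      using dV[of x] d0[of x ?h, OF _ h0] K(2) unfolding differentiable_def by blast
    show "continuous_on UNIV (\<lambda>x. D ?h x (axis i 1))"
      using cp unfolding partial_def[abs_def] .
  qed auto
  then have "(\<integral>x. partial i ?h x \<partial>lborel) = 0"
    unfolding partial_def[abs_def] .
  then show "(\<integral>x. (if x \<in> V then partial i h x else 0) \<partial>lborel) = 0"
    unfolding p .
qed

section \<open>The conformal Laplacian of the Green function away from the pole\<close>

text \<open>
  Green's second identity for a compactly supported \<open>f\<close>: the integrand is the divergence of the vector
  field \<open>V\<close>, by the divergence form of the Laplacian and the symmetry of the metric.
\<close>

lemma (in immersion) green_identity:
  fixes f \<gamma> :: "real^'n \<Rightarrow> real"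
  assumes K: "compact K" "K \<subseteq> U" and f: "smooth_on U f" "\<And>x. x \<in> U \<Longrightarrow> x \<notin> K \<Longrightarrow> f x = 0"
    and \<gamma>: "smooth_on U \<gamma>"
  shows "integrable lborel (\<lambda>u. if u \<in> U then vol_density u * (\<gamma> u * laplace_coord met f u - f u * laplace_coord met \<gamma> u) else 0)"
    and "(\<integral>u. (if u \<in> U then vol_density u * (\<gamma> u * laplace_coord met f u - f u * laplace_coord met \<gamma> u) else 0) \<partial>lborel) = 0"
proof -
  define flux where "flux = (\<lambda>f i x. \<Sum>j\<in>UNIV. vol_density x * inv_met x $ i $ j * partial j f x)"
  have sflux: "smooth_on U (flux f i)" if "smooth_on U f" for f i
    unfolding flux_def
    by (intro smooth_on_sum smooth_on_mult open_U smooth_vol_density smooth_inv_met smooth_on_partial that)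
  define V where "V = (\<lambda>i x. \<gamma> x * flux f i x - f x * flux \<gamma> i x)"
  have sV: "smooth_on U (V i)" for i
    unfolding V_def by (intro smooth_on_diff smooth_on_mult open_U sflux f \<gamma>)
  have f0: "partial j f x = 0" if "x \<in> U" "x \<notin> K" for j x
  proof -
    have "partial j (\<lambda>x. 0::real) x = partial j f x"
      by (rule partial_cong[of "U - K"]) (use that f(2) open_U K(1) in \<open>auto intro: open_Diff compact_imp_closed\<close>)
    then show ?thesis by simp
  qed
  have V0: "V i x = 0" if "x \<in> U" "x \<notin> K" for i x
    using f(2) f0 that by (simp add: V_def flux_def)
  note I = integral_partial_eq_0[OF open_U K sV V0]
  have div: "(\<Sum>i\<in>UNIV. partial i (V i) u) = vol_density u * (\<gamma> u * laplace_coord met f u - f u * laplace_coord met \<gamma> u)"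
    if u: "u \<in> U" for u
  proof -
    note df = smooth_on_imp_differentiable[OF f(1) u] and d\<gamma> = smooth_on_imp_differentiable[OF \<gamma> u]
      and dflux = smooth_on_imp_differentiable[OF sflux[OF f(1)] u] smooth_on_imp_differentiable[OF sflux[OF \<gamma>] u]
    have V: "partial i (V i) u = partial i \<gamma> u * flux f i u + \<gamma> u * partial i (flux f i) u
       - (partial i f u * flux \<gamma> i u + f u * partial i (flux \<gamma> i) u)" for i
      unfolding V_def
      by (subst partial_diff) (use df d\<gamma> dflux in \<open>auto simp: partial_mult\<close>)
    have sym: "(\<Sum>i\<in>UNIV. partial i \<gamma> u * flux f i u) = (\<Sum>i\<in>UNIV. partial i f u * flux \<gamma> i u)"
    proof -
      have "(\<Sum>i\<in>UNIV. partial i \<gamma> u * flux f i u) = (\<Sum>i\<in>UNIV. \<Sum>j\<in>UNIV. vol_density u * (inv_met u $ i $ j * (partial i \<gamma> u * partial j f u)))"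
        by (simp add: flux_def sum_distrib_left mult_ac)
      also have "\<dots> = (\<Sum>j\<in>UNIV. \<Sum>i\<in>UNIV. vol_density u * (inv_met u $ j $ i * (partial i \<gamma> u * partial j f u)))"
        by (subst sum.swap) (simp add: inv_met_commute[OF u])
      also have "\<dots> = (\<Sum>i\<in>UNIV. partial i f u * flux \<gamma> i u)"
        by (simp add: flux_def sum_distrib_left mult_ac)
      finally show ?thesis .
    qed
    have lap: "(\<Sum>i\<in>UNIV. partial i (flux f i) u) = vol_density u * laplace_coord met f u" if "smooth_on U f" for f
      unfolding flux_def by (rule laplace_divergence_form[OF u that])
    have "(\<Sum>i\<in>UNIV. partial i (V i) u) = (\<Sum>i\<in>UNIV. partial i \<gamma> u * flux f i u) + \<gamma> u * (\<Sum>i\<in>UNIV. partial i (flux f i) u)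
       - ((\<Sum>i\<in>UNIV. partial i f u * flux \<gamma> i u) + f u * (\<Sum>i\<in>UNIV. partial i (flux \<gamma> i) u))"
      by (simp add: V sum.distrib sum_subtractf sum_distrib_left)
    then show ?thesis
      unfolding sym lap[OF f(1)] lap[OF \<gamma>] by (simp add: algebra_simps)
  qed
  have e: "(\<lambda>u. \<Sum>i\<in>UNIV. (if u \<in> U then partial i (V i) u else 0)) =
    (\<lambda>u. if u \<in> U then vol_density u * (\<gamma> u * laplace_coord met f u - f u * laplace_coord met \<gamma> u) else 0)"
    using div by (auto simp: fun_eq_iff)
  show "integrable lborel (\<lambda>u. if u \<in> U then vol_density u * (\<gamma> u * laplace_coord met f u - f u * laplace_coord met \<gamma> u) else 0)"
    unfolding e[symmetric] by (intro Bochner_Integration.integrable_sum I(1))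
  show "(\<integral>u. (if u \<in> U then vol_density u * (\<gamma> u * laplace_coord met f u - f u * laplace_coord met \<gamma> u) else 0) \<partial>lborel) = 0"
    unfolding e[symmetric] by (subst Bochner_Integration.integral_sum) (simp_all add: I)
qed

lemma continuous_nonneg_integral_0_imp_0:
  fixes h :: "'a::euclidean_space \<Rightarrow> real"
  assumes c: "continuous_on UNIV h" and "\<And>x. h x \<ge> 0" "integrable lborel h" "(\<integral>x. h x \<partial>lborel) = 0"
  shows "h x = 0"
proof (rule ccontr)
  assume "h x \<noteq> 0"
  have "AE x in lborel. h x = 0"
    using integral_nonneg_eq_0_iff_AE[of lborel h] assms by simp
  moreover have "{x. h x \<noteq> 0} \<in> sets lborel"
    using c by (auto intro!: borel_open open_Collect_neq)
  ultimately have "{x. h x \<noteq> 0} \<in> null_sets lborel"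
    using AE_iff_null_sets[of "{x. h x \<noteq> 0}" lborel] by simp
  then have "negligible {x. h x \<noteq> 0}"
    using null_sets_completionI negligible_iff_null_sets by blast
  moreover have "open {x. h x \<noteq> 0}" using c by (intro open_Collect_neq) auto
  ultimately show False using open_not_negligible \<open>h x \<noteq> 0\<close> by blast
qed

text \<open>
  If the conformal Laplacian \<open>W\<close> of the Green function were nonzero at a point, it would have constant
  sign nearby. Testing the distributional equation with a nonnegative bump function \<open>F\<close> supported there,
  where the pole does not contribute, and integrating by parts gives a vanishing integral of a function
  of constant sign that does not vanish.
\<close>

lemma green_function_pointwise:
  fixes M :: "(real^('n::finite option)) set"
  assumes M: "closed_embedded_hypersurface M" and vol: "riemannian_volume M \<mu>" and G: "green_function M \<mu> G"
    and Q: "Q \<in> M" and k: "k \<noteq> 0" and GQ: "\<And>P. P \<in> M \<Longrightarrow> P \<noteq> Q \<Longrightarrow> G P Q = k * \<gamma> P"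
    and P: "local_parametrization M U \<phi>" and u0: "u0 \<in> U" and QU: "Q \<notin> \<phi> ` U"
    and \<gamma>: "smooth_on U (\<gamma> \<circ> \<phi>)"
  shows "- laplace_coord (induced_metric \<phi>) (\<gamma> \<circ> \<phi>) u0 + (real CARD('n) - 2) / (4 * (real CARD('n) - 1))
     * scalar_coord (induced_metric \<phi>) u0 * \<gamma> (\<phi> u0) = 0"
proof (rule ccontr)
  define c where "c = (real CARD('n) - 2) / (4 * (real CARD('n) - 1))"
  define W where "W = (\<lambda>u. - laplace_coord (induced_metric \<phi>) (\<gamma> \<circ> \<phi>) u + c * scalar_coord (induced_metric \<phi>) u * \<gamma> (\<phi> u))"
  assume "\<not> ?thesis"
  then have W0: "W u0 \<noteq> 0" by (simp add: W_def c_def)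
  have cM: "compact M" using M by (simp add: closed_embedded_hypersurface_def)
  \<comment> \<open>The chart is shrunk to a domain on which \<open>W\<close> has the sign of \<open>W u0\<close>.\<close>
  define V where "V = {u \<in> U. W u * W u0 > 0}"
  interpret IU: immersion U \<phi> by (rule immersion_of_parametrization[OF P])
  have "continuous_on U W"
    unfolding W_def using smooth_on_imp_continuous_on[OF \<gamma>]
      smooth_on_imp_continuous_on[OF IU.smooth_laplace_coord[OF \<gamma>]] smooth_on_imp_continuous_on[OF IU.smooth_scalar_coord]
    by (auto intro!: continuous_intros simp: o_def)
  then have "open (U \<inter> (\<lambda>u. W u * W u0) -` {0<..})"
    by (intro continuous_open_preimage IU.open_U) (auto intro!: continuous_intros)
  moreover have "U \<inter> (\<lambda>u. W u * W u0) -` {0<..} = V" by (auto simp: V_def)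
  ultimately have oV: "open V" by simp
  have VU: "V \<subseteq> U" and u0V: "u0 \<in> V"
    using W0 u0 by (auto simp: V_def zero_less_mult_iff)
  have PV: "local_parametrization M V \<phi>" by (rule local_parametrization_subset[OF P oV VU])
  interpret immersion V \<phi> by (rule immersion_of_parametrization[OF PV])
  have \<gamma>V: "smooth_on V (\<gamma> \<circ> \<phi>)" by (rule smooth_on_subset[OF \<gamma> VU])
  obtain \<psi> where \<psi>: "homeomorphism V (\<phi> ` V) \<phi> \<psi>"
    using PV unfolding local_parametrization_def by blast
  obtain O1 where O1: "open O1" "\<phi> ` V = M \<inter> O1"
    using PV unfolding local_parametrization_def openin_open by blast
  have "\<phi> u0 \<in> O1" using O1(2) u0V by blast
  then obtain \<delta> where \<delta>: "\<delta> > 0" "cball (\<phi> u0) \<delta> \<subseteq> O1"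
    using O1(1) open_contains_cball by blast
  obtain F :: "real^('n option) \<Rightarrow> real" where F: "smooth_on UNIV F" "\<And>x. F x \<ge> 0" "F (\<phi> u0) > 0"
    "\<And>x. x \<notin> ball (\<phi> u0) \<delta> \<Longrightarrow> F x = 0"
    by (rule smooth_bump_exists[OF \<delta>(1), of "\<phi> u0"]) (rule that)
  \<comment> \<open>In particular the pole lies outside the support of \<open>F\<close>.\<close>
  have out: "x \<notin> cball (\<phi> u0) \<delta>" if "x \<in> M" "x \<notin> \<phi> ` V" for x using O1(2) \<delta>(2) that by blast
  define K where "K = \<psi> ` (M \<inter> cball (\<phi> u0) \<delta>)"
  have sub: "M \<inter> cball (\<phi> u0) \<delta> \<subseteq> \<phi> ` V" using out by blast
  have "\<psi> x \<in> V" if "x \<in> \<phi> ` V" for x using homeomorphism_image2[OF \<psi>] that by blast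
  then have K: "compact K" "K \<subseteq> V"
    unfolding K_def using homeomorphism_image2[OF \<psi>] sub cM
    by (auto intro!: compact_continuous_image continuous_on_subset[OF homeomorphism_cont2[OF \<psi>]] compact_Int_closed)
  define f where "f = F \<circ> \<phi>"
  have f: "smooth_on V f"
    unfolding f_def o_def by (rule smooth_on_compose[OF oV open_UNIV UNIV_I F(1) smooth_phi])
  have f0: "f u = 0" if "u \<in> V" "u \<notin> K" for u
  proof -
    have "\<phi> u \<notin> cball (\<phi> u0) \<delta>"
    proof
      assume "\<phi> u \<in> cball (\<phi> u0) \<delta>"
      then have "\<psi> (\<phi> u) \<in> K" using parametrization_in[OF PV that(1)] by (auto simp: K_def)
      then show False using that homeomorphism_apply1[OF \<psi>] by simp
    qed
    then show ?thesis using F(4) by (auto simp: f_def)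
  qed
  define w where "w = (\<lambda>x. G x Q * conformal_laplacian M F x)"
  have wV: "w (\<phi> u) = k * (\<gamma> (\<phi> u) * (- laplace_coord met f u + c * scalar_coord met u * f u))" if "u \<in> V" for u
    using conformal_laplacian_chart[OF PV that F(1)] GQ[OF parametrization_in[OF PV that]] QU VU that
    by (auto simp: w_def c_def f_def)
  have cont: "continuous_on V (laplace_coord met f)" "continuous_on V (scalar_coord met)" "continuous_on V f"
    "continuous_on V (\<lambda>u. \<gamma> (\<phi> u))" "continuous_on V (laplace_coord met (\<gamma> \<circ> \<phi>))" "continuous_on V (\<lambda>u. vol_density u)"
    using smooth_on_imp_continuous_on[OF smooth_laplace_coord[OF f]] smooth_on_imp_continuous_on[OF smooth_scalar_coord]
      smooth_on_imp_continuous_on[OF f] smooth_on_imp_continuous_on[OF \<gamma>V] smooth_on_imp_continuous_on[OF smooth_laplace_coord[OF \<gamma>V]]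
      smooth_on_imp_continuous_on[OF smooth_vol_density] by (auto simp: o_def)
  have "(\<integral>x. w x \<partial>\<mu>) = F Q"
    using G Q smooth_function_ambient[OF F(1), of M] unfolding green_function_def w_def by blast
  also have "F Q = 0"
  proof -
    have "Q \<notin> cball (\<phi> u0) \<delta>" using out Q QU VU by blast
    then show ?thesis using F(4) by auto
  qed
  finally have w_int: "(\<integral>x. w x \<partial>\<mu>) = 0" .
  have "continuous_on V (\<lambda>u. k * (\<gamma> (\<phi> u) * (- laplace_coord met f u + c * scalar_coord met u * f u)))"
    by (intro continuous_intros cont)
  then have "continuous_on V (\<lambda>u. w (\<phi> u))"
    by (rule continuous_on_eq) (simp add: wV)
  moreover have "w x = 0" if x: "x \<in> M" "x \<notin> \<phi> ` V" for x
  proof -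
    obtain U' \<phi>' where U': "local_parametrization M U' \<phi>'" "x \<in> \<phi>' ` U'"
      using M x(1) unfolding closed_embedded_hypersurface_def by blast
    then obtain u' where u': "u' \<in> U'" "x = \<phi>' u'" by blast
    have "F y = 0" if "y \<in> - cball (\<phi> u0) \<delta>" for y using that by (intro F(4)) auto
    then have "conformal_laplacian M F (\<phi>' u') = 0"
      by (intro conformal_laplacian_local[OF U'(1) u'(1) F(1), of "- cball (\<phi> u0) \<delta>"])
         (use out[OF x] u'(2) in \<open>auto simp del: mem_cball\<close>)
    then show ?thesis by (simp add: w_def u'(2))
  qed
  ultimately have "(\<integral>u. (if u \<in> V then vol_density u * w (\<phi> u) else 0) \<partial>lborel) = 0"
    using integral_chart[OF cM vol PV u0V, of w] w_int by simp
  also have "(\<lambda>u. if u \<in> V then vol_density u * w (\<phi> u) else 0) = (\<lambda>u. k * (if u \<in> V then vol_density u *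
       (\<gamma> (\<phi> u) * (- laplace_coord met f u + c * scalar_coord met u * f u)) else 0))"
    by (auto simp: wV fun_eq_iff)
  finally have I1: "(\<integral>u. (if u \<in> V then vol_density u * (\<gamma> (\<phi> u) * (- laplace_coord met f u + c * scalar_coord met u * f u)) else 0) \<partial>lborel) = 0"
    using k by simp
  note I2 = green_identity[OF K f f0 \<gamma>V]
  have cW: "continuous_on V (\<lambda>u. vol_density u * f u * W u * W u0)"
    unfolding W_def by (intro continuous_intros cont)
  note ext = extension_by_zero[OF oV K cW]
  \<comment> \<open>Adding Green's identity moves the Laplacian from \<open>f\<close> to the Green function.\<close>
  have e: "(\<lambda>u. if u \<in> V then vol_density u * f u * W u * W u0 else 0) = (\<lambda>u. W u0 *
    ((if u \<in> V then vol_density u * (\<gamma> (\<phi> u) * (- laplace_coord met f u + c * scalar_coord met u * f u)) else 0)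
     + (if u \<in> V then vol_density u * ((\<gamma> \<circ> \<phi>) u * laplace_coord met f u - f u * laplace_coord met (\<gamma> \<circ> \<phi>) u) else 0)))"
    by (auto simp: fun_eq_iff W_def algebra_simps)
  have lapK: "\<gamma> (\<phi> u) * laplace_coord met f u = 0" if "u \<in> V" "u \<notin> K" for u
  proof -
    have z: "partial j h x = 0" if "x \<in> V - K" "\<And>x. x \<in> V - K \<Longrightarrow> h x = 0" for j x and h :: "_ \<Rightarrow> real"
    proof -
      have "partial j (\<lambda>x. 0::real) x = partial j h x"
        by (rule partial_cong[of "V - K"]) (use that oV K(1) in \<open>auto intro: open_Diff compact_imp_closed\<close>)
      then show ?thesis by simp
    qed
    have "partial j f x = 0" if "x \<in> V - K" for j x using z[OF that] f0 by blast
    then have "partial i (partial j f) x = 0" "partial j f x = 0" if "x \<in> V - K" for i j x using z that by blast+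
    then show ?thesis using that by (simp add: laplace_coord_def hessian_coord_def)
  qed
  have i1: "integrable lborel (\<lambda>u. if u \<in> V then vol_density u * (\<gamma> (\<phi> u) * (- laplace_coord met f u + c * scalar_coord met u * f u)) else 0)"
  proof (rule extension_by_zero(2)[OF oV K])
    show "continuous_on V (\<lambda>u. vol_density u * (\<gamma> (\<phi> u) * (- laplace_coord met f u + c * scalar_coord met u * f u)))"
      by (intro continuous_intros cont)
    show "vol_density u * (\<gamma> (\<phi> u) * (- laplace_coord met f u + c * scalar_coord met u * f u)) = 0" if "u \<in> V" "u \<notin> K" for u
      using lapK[OF that] f0[OF that] by auto
  qed
  have "(if u0 \<in> V then vol_density u0 * f u0 * W u0 * W u0 else 0) = 0"
  proof (rule continuous_nonneg_integral_0_imp_0[OF ext(1)])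
    show "(if u \<in> V then vol_density u * f u * W u * W u0 else 0) \<ge> 0" for u
      using F(2)[of "\<phi> u"] det_met_pos[of u] by (auto simp: V_def f_def mult.assoc less_imp_le)
    show "integrable lborel (\<lambda>u. if u \<in> V then vol_density u * f u * W u * W u0 else 0)"
      by (rule ext(2)) (use f0 in auto)
    show "(\<integral>u. (if u \<in> V then vol_density u * f u * W u * W u0 else 0) \<partial>lborel) = 0"
      unfolding e using I1 I2 i1 by simp
  qed (use f0 in auto)
  then show False
    using u0V W0 F(3) det_met_pos[OF u0V] by (auto simp: f_def)
qed

section \<open>The curvature equation satisfied away from the pole\<close>

lemma partial_cmult:
  fixes f :: "real^'n::finite \<Rightarrow> real"
  assumes "f differentiable (at u)"
  shows "partial i (\<lambda>x. c * f x) u = c * partial i f u"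
  by (simp add: partial_mult[OF differentiable_const assms])

context immersion begin

definition normal_part :: "real^'n \<Rightarrow> real^('n option) \<Rightarrow> real^('n option)" where
  "normal_part u y = y - (\<Sum>i\<in>UNIV. \<Sum>j\<in>UNIV. (inv_met u $ i $ j * (y \<bullet> tang i u)) *\<^sub>R tang j u)"

definition mean_curvature :: "real^'n \<Rightarrow> real^('n option)" where
  "mean_curvature u = (\<Sum>i\<in>UNIV. \<Sum>j\<in>UNIV. inv_met u $ i $ j *\<^sub>R second_form i j u)"

text \<open>
  For \<open>a = b = y\<close> this is the squared norm of the trace minus the squared norm of
  \<open>B = II + 2 (normal_part y / (y \<bullet> y)) g\<close>, where \<open>II\<close> is the second fundamental form and \<open>g\<close> the metric:
  expand the squares and use the Gauss equation for the scalar curvature. Up to scaling and a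
  reflection, \<open>B\<close> is the second fundamental form after inversion in the unit sphere around the origin of
  \<open>y\<close>. The vectors \<open>a\<close> and \<open>b\<close> are kept apart because near the pole they are rescaled by different powers.
\<close>

definition curvature_defect :: "real^'n \<Rightarrow> real^('n option) \<Rightarrow> real^('n option) \<Rightarrow> real" where
  "curvature_defect u a b = 4 * (real CARD('n) - 1) * (real CARD('n) * (a \<bullet> normal_part u a) / (b \<bullet> b)\<^sup>2
      + (a \<bullet> mean_curvature u) / (b \<bullet> b)) + scalar_coord met u"

text \<open>
  Powers of the squared distance to \<open>Q\<close>; the exponent \<open>(2 - n) / 2\<close> gives the Green function.
\<close>

lemma hessian_norm_power:
  fixes a :: real
  assumes u: "u \<in> U" and Q: "Q \<notin> \<phi> ` U"
  defines "y \<equiv> \<lambda>x. \<phi> x - Q"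
  shows "hessian_coord met (\<lambda>x. (y x \<bullet> y x) powr a) i j u =
      4 * a * (a - 1) * (y u \<bullet> y u) powr (a - 2) * ((y u \<bullet> tang i u) * (y u \<bullet> tang j u))
      + 2 * a * (y u \<bullet> y u) powr (a - 1) * (met u $ i $ j + y u \<bullet> second_form i j u)"
    and "smooth_on U (\<lambda>x. (y x \<bullet> y x) powr a)"
proof -
  define s where "s = (\<lambda>x. y x \<bullet> y x)"
  have ys: "smooth_on U y"
    unfolding y_def by (intro smooth_on_diff smooth_on_const open_U smooth_phi)
  have ss: "smooth_on U s"
    unfolding s_def by (intro smooth_on_inner open_U ys)
  have s0: "s x > 0" if "x \<in> U" for x using that Q by (auto simp: s_def y_def)
  show sp: "smooth_on U (\<lambda>x. (y x \<bullet> y x) powr a)"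
    using smooth_on_powr[OF open_U ss s0] by (simp add: s_def)
  note dy = smooth_on_imp_differentiable[OF ys] and ds = smooth_on_imp_differentiable[OF ss]
  have py: "partial j y x = tang j x" if "x \<in> U" for x j
    unfolding y_def by (subst partial_diff) (use phi_differentiable that in auto)
  have ps: "partial j s x = 2 * (y x \<bullet> tang j x)" if "x \<in> U" for x j
    unfolding s_def by (subst partial_inner) (use dy that in \<open>auto simp: py inner_commute\<close>)
  have pp: "partial j (\<lambda>x. s x powr b) x = 2 * b * (s x powr (b - 1) * (y x \<bullet> tang j x))" if "x \<in> U" for x j b
    by (subst partial_powr) (use ds s0 that in \<open>auto simp: ps\<close>)
  have syt: "smooth_on U (\<lambda>x. y x \<bullet> tang j x)" for j by (intro smooth_on_inner open_U ys smooth_tang)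
  have spb: "smooth_on U (\<lambda>x. s x powr b)" for b by (rule smooth_on_powr[OF open_U ss s0])
  have "partial i (partial j (\<lambda>x. s x powr a)) u = partial i (\<lambda>x. 2 * a * (s x powr (a - 1) * (y x \<bullet> tang j x))) u"
    by (rule partial_cong[OF open_U u pp])
       (use smooth_on_imp_differentiable[OF smooth_on_partial[OF spb] u] in auto)
  also have "\<dots> = 2 * a * (2 * (a - 1) * (s u powr (a - 1 - 1) * (y u \<bullet> tang i u)) * (y u \<bullet> tang j u)
      + s u powr (a - 1) * (tang i u \<bullet> tang j u + y u \<bullet> tang2 i j u))"
  proof -
    have "partial i (\<lambda>x. y x \<bullet> tang j x) u = tang i u \<bullet> tang j u + y u \<bullet> tang2 i j u"
      by (subst partial_inner) (use dy[OF u] smooth_differentiable(1)[OF u] in \<open>auto simp: py[OF u]\<close>)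
    then show ?thesis
      by (subst partial_cmult)
         (use smooth_on_imp_differentiable[OF syt u] smooth_on_imp_differentiable[OF spb u] in
           \<open>auto intro!: differentiable_mult simp: partial_mult pp[OF u]\<close>)
  qed
  finally have 1: "partial i (partial j (\<lambda>x. s x powr a)) u = 4 * a * (a - 1) * s u powr (a - 2) * ((y u \<bullet> tang i u) * (y u \<bullet> tang j u))
      + 2 * a * s u powr (a - 1) * (met u $ i $ j + y u \<bullet> tang2 i j u)"
    by (simp add: met_entry algebra_simps)
  have 2: "(\<Sum>k\<in>UNIV. Gam k i j u * partial k (\<lambda>x. s x powr a) u) = 2 * a * s u powr (a - 1) * (\<Sum>k\<in>UNIV. Gam k i j u * (y u \<bullet> tang k u))"
    by (simp add: pp[OF u] sum_distrib_left mult_ac)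
  have 3: "y u \<bullet> second_form i j u = y u \<bullet> tang2 i j u - (\<Sum>k\<in>UNIV. Gam k i j u * (y u \<bullet> tang k u))"
    by (simp add: second_form_def inner_diff_right inner_sum_right)
  show "hessian_coord met (\<lambda>x. (y x \<bullet> y x) powr a) i j u =
      4 * a * (a - 1) * (y u \<bullet> y u) powr (a - 2) * ((y u \<bullet> tang i u) * (y u \<bullet> tang j u))
      + 2 * a * (y u \<bullet> y u) powr (a - 1) * (met u $ i $ j + y u \<bullet> second_form i j u)"
    unfolding hessian_coord_def using 1 2 unfolding 3 s_def by (simp add: algebra_simps)
qed

lemma trace_met:
  assumes u: "u \<in> U"
  shows "(\<Sum>i\<in>UNIV. \<Sum>j\<in>UNIV. inv_met u $ i $ j * met u $ i $ j) = real CARD('n)"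
proof -
  have "(\<Sum>j\<in>UNIV. inv_met u $ i $ j * met u $ i $ j) = 1" for i
    using inv_met_met[OF u, of i i] by (simp add: met_commute[of u i])
  then show ?thesis by simp
qed

lemma laplace_norm_power:
  fixes a :: real
  assumes u: "u \<in> U" and Q: "Q \<notin> \<phi> ` U"
  defines "y \<equiv> \<lambda>x. \<phi> x - Q"
  shows "laplace_coord met (\<lambda>x. (y x \<bullet> y x) powr a) u =
      4 * a * (a - 1) * (y u \<bullet> y u) powr (a - 2) * (y u \<bullet> y u - y u \<bullet> normal_part u (y u))
      + 2 * a * (y u \<bullet> y u) powr (a - 1) * (real CARD('n) + y u \<bullet> mean_curvature u)"
proof -
  have "laplace_coord met (\<lambda>x. (y x \<bullet> y x) powr a) u =
      4 * a * (a - 1) * (y u \<bullet> y u) powr (a - 2) * (\<Sum>i\<in>UNIV. \<Sum>j\<in>UNIV. inv_met u $ i $ j * ((y u \<bullet> tang i u) * (y u \<bullet> tang j u)))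
      + 2 * a * (y u \<bullet> y u) powr (a - 1) * ((\<Sum>i\<in>UNIV. \<Sum>j\<in>UNIV. inv_met u $ i $ j * met u $ i $ j)
         + (\<Sum>i\<in>UNIV. \<Sum>j\<in>UNIV. inv_met u $ i $ j * (y u \<bullet> second_form i j u)))"
    unfolding laplace_coord_def y_def hessian_norm_power(1)[OF u Q]
    by (simp add: sum_distrib_left sum.distrib[symmetric] algebra_simps)
  then show ?thesis
    unfolding trace_met[OF u]
    by (simp add: normal_part_def mean_curvature_def inner_diff_right inner_sum_right mult.assoc)
qed

end

text \<open>
  Dividing the pointwise equation by \<open>(n - 2)\<close> times the Green function leaves an equation between
  extrinsic quantities.
\<close>

lemma green_function_curvature_equation:
  fixes M :: "(real^('n::finite option)) set" and Q
  assumes n: "CARD('n) \<ge> 3" and M: "closed_embedded_hypersurface M" and vol: "riemannian_volume M \<mu>"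
    and G: "green_function M \<mu> G" and Q: "Q \<in> M" and k: "k \<noteq> 0"
    and GQ: "\<And>P. P \<in> M \<Longrightarrow> P \<noteq> Q \<Longrightarrow> G P Q = k * norm (P - Q) powr (2 - real CARD('n))"
    and P: "local_parametrization M U \<phi>" and u: "u \<in> U" and uQ: "\<phi> u \<noteq> Q"
  defines "y \<equiv> \<phi> u - Q"
  shows "immersion.curvature_defect \<phi> u y y = 0"
proof -
  define V where "V = {x \<in> U. \<phi> x \<noteq> Q}"
  interpret IU: immersion U \<phi> by (rule immersion_of_parametrization[OF P])
  have "open (U \<inter> \<phi> -` (- {Q}))"
    by (intro continuous_open_preimage IU.open_U smooth_on_imp_continuous_on[OF IU.smooth_phi]) auto
  moreover have "U \<inter> \<phi> -` (- {Q}) = V" by (auto simp: V_def)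
  ultimately have oV: "open V" by simp
  have PV: "local_parametrization M V \<phi>"
    by (rule local_parametrization_subset[OF P oV]) (auto simp: V_def)
  have uV: "u \<in> V" and QV: "Q \<notin> \<phi> ` V" using u uQ by (auto simp: V_def)
  interpret immersion V \<phi> by (rule immersion_of_parametrization[OF PV])
  define m where "m = real CARD('n)"
  have m: "m \<ge> 3" using n by (simp add: m_def)
  define a where "a = (2 - m) / 2"
  define \<gamma> where "\<gamma> = (\<lambda>P. ((P - Q) \<bullet> (P - Q)) powr a)"
  have G': "G P Q = k * \<gamma> P" if "P \<in> M" "P \<noteq> Q" for P
  proof -
    have "norm (P - Q) powr (2 - m) = norm (P - Q) powr (2 * a)" by (simp add: a_def diff_divide_distrib)
    also have "\<dots> = (norm (P - Q) powr 2) powr a" by (simp only: powr_powr)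
    also have "norm (P - Q) powr 2 = (P - Q) \<bullet> (P - Q)"
      using that by (simp add: dot_square_norm)
    finally show ?thesis using GQ[OF that] by (simp add: \<gamma>_def m_def)
  qed
  have \<gamma>\<phi>: "\<gamma> \<circ> \<phi> = (\<lambda>x. ((\<phi> x - Q) \<bullet> (\<phi> x - Q)) powr a)" by (auto simp: \<gamma>_def)
  have \<gamma>s: "smooth_on V (\<gamma> \<circ> \<phi>)" unfolding \<gamma>\<phi> by (rule hessian_norm_power(2)[OF uV QV])
  have eq: "- laplace_coord met (\<gamma> \<circ> \<phi>) u + (m - 2) / (4 * (m - 1)) * scalar_coord met u * \<gamma> (\<phi> u) = 0"
    unfolding m_def by (rule green_function_pointwise[OF M vol G Q k G' PV uV QV \<gamma>s])
  define s where "s = y \<bullet> y"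
  have s: "s > 0" using uQ by (simp add: s_def y_def)
  define X where "X = y \<bullet> normal_part u y"
  define Y where "Y = y \<bullet> mean_curvature u"
  define R where "R = scalar_coord met u"
  have "laplace_coord met (\<gamma> \<circ> \<phi>) u = 4 * a * (a - 1) * s powr (a - 2) * (s - X) + 2 * a * s powr (a - 1) * (m + Y)"
    unfolding \<gamma>\<phi> laplace_norm_power[OF uV QV] by (simp add: s_def y_def X_def Y_def m_def)
  also have "s powr (a - 2) = s powr a / s\<^sup>2" using s by (simp add: powr_diff)
  also have "s powr (a - 1) = s powr a / s" using s by (simp add: powr_diff)
  also have "4 * a * (a - 1) * (s powr a / s\<^sup>2) * (s - X) + 2 * a * (s powr a / s) * (m + Y)
    = s powr a * ((m - 2) * m * (s - X) / s\<^sup>2 - (m - 2) * (m + Y) / s)"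
  proof -
    have c: "4 * a * (a - 1) = (m - 2) * m" "2 * a = - (m - 2)" by (simp_all add: a_def field_simps)
    have "x * (p / q) * y + - x' * (p / q') * y' = p * (x * y / q - x' * y' / q')" for p q q' x x' y y' :: real
      by (simp add: right_diff_distrib mult_ac)
    then show ?thesis unfolding c .
  qed
  finally have L: "laplace_coord met (\<gamma> \<circ> \<phi>) u = s powr a * ((m - 2) * m * (s - X) / s\<^sup>2 - (m - 2) * (m + Y) / s)" .
  have \<gamma>u: "\<gamma> (\<phi> u) = s powr a" by (simp add: \<gamma>_def s_def y_def)
  have "p * (- Z + r) = - (p * Z) + r * p" for p Z r :: real by (simp add: algebra_simps)
  then have "s powr a * (- ((m - 2) * m * (s - X) / s\<^sup>2 - (m - 2) * (m + Y) / s) + (m - 2) / (4 * (m - 1)) * R) = 0"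
    using eq unfolding L \<gamma>u R_def[symmetric] by metis
  then have "- ((m - 2) * m * (s - X) / s\<^sup>2 - (m - 2) * (m + Y) / s) + (m - 2) / (4 * (m - 1)) * R = 0"
    using s by simp
  moreover have "(m - 2) * m * (s - X) / s\<^sup>2 = (m - 2) * (m / s - m * X / s\<^sup>2)"
    using s by (simp add: field_simps power2_eq_square)
  moreover have "(m - 2) * (m + Y) / s = (m - 2) * (m / s + Y / s)"
    by (simp add: add_divide_distrib[symmetric])
  moreover have "- (k * (a - b) - k * (a + c)) + k / d * R = k * (b + c + R / d)" for k a b c d :: real
    by (simp add: algebra_simps)
  ultimately have "(m - 2) * (m * X / s\<^sup>2 + Y / s + R / (4 * (m - 1))) = 0"
    by metis
  then have b0: "m * X / s\<^sup>2 + Y / s + R / (4 * (m - 1)) = 0"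
    using m by simp
  have "d * b + R = d * (b + R / d)" if "d \<noteq> 0" for d b :: real
    using that by (simp add: distrib_left)
  from this[of "4 * (m - 1)" "m * X / s\<^sup>2 + Y / s"]
  have "4 * (m - 1) * (m * X / s\<^sup>2 + Y / s) + R = 0"
    using m b0 by simp
  then show ?thesis unfolding curvature_defect_def m_def X_def Y_def R_def s_def .
qed

section \<open>Orthonormal coordinates at a point\<close>

text \<open>
  Precomposing a parametrization with a linear map makes its coordinate vectors at one point orthonormal.
\<close>

lemma normalized_chart:
  fixes M :: "(real^('n::finite option)) set"
  assumes M: "closed_embedded_hypersurface M" and p: "p \<in> M"
  obtains U \<phi> u where "local_parametrization M U \<phi>" "u \<in> U" "\<phi> u = p" "induced_metric \<phi> u = mat 1"
proof -
  obtain U0 \<phi>0 where P0: "local_parametrization M U0 \<phi>0" "p \<in> \<phi>0 ` U0"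
    using M p unfolding closed_embedded_hypersurface_def by blast
  obtain u0 where u0: "u0 \<in> U0" "\<phi>0 u0 = p" using P0(2) by blast
  interpret I0: immersion U0 \<phi>0 by (rule immersion_of_parametrization[OF P0(1)])
  obtain C :: "real^'n \<Rightarrow> real^'n" where C: "linear C" "inj C"
    "\<And>v w. D \<phi>0 u0 (C v) \<bullet> D \<phi>0 u0 (C w) = v \<bullet> w"
    using I0.orthonormal_frame[OF u0(1)] by metis
  obtain C' where C': "linear C'" "\<And>x. C' (C x) = x" "\<And>x. C (C' x) = x"
    using linear_injective_isomorphism[OF C(1,2)] by blast
  have bC: "bounded_linear C" "bounded_linear C'"
    using C(1) C'(1) linear_conv_bounded_linear by auto
  define U where "U = C -` U0"
  define \<phi> where "\<phi> = (\<lambda>x. \<phi>0 (C x))"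
  have oU: "open U"
    unfolding U_def using I0.open_U bounded_linear.continuous_on[OF bC(1) continuous_on_id] by (simp add: open_vimage)
  have sC: "smooth_on U C" using smooth_on_bounded_linear[OF oU bC(1) smooth_on_ident[OF oU]] .
  have sm: "smooth_on U \<phi>"
    unfolding \<phi>_def by (rule smooth_on_compose[OF oU I0.open_U _ I0.smooth_phi sC]) (auto simp: U_def)
  have D: "D \<phi> x = (\<lambda>v. D \<phi>0 (C x) (C v))" if "x \<in> U" for x
  proof -
    have "(\<phi> has_derivative (\<lambda>v. D \<phi>0 (C x) (C v))) (at x)"
      unfolding \<phi>_def
      by (rule has_derivative_compose[OF bounded_linear_imp_has_derivative[OF bC(1)] has_frechet_derivative[OF I0.phi_differentiable]])
         (use that in \<open>simp add: U_def\<close>)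
    then show ?thesis using frechet_derivative_at by metis
  qed
  have im: "\<phi> ` U = \<phi>0 ` U0"
  proof -
    have "C ` U = U0" unfolding U_def using C'(3) by (metis image_vimage_eq inf_top.right_neutral surjI)
    then show ?thesis unfolding \<phi>_def by (metis image_image)
  qed
  obtain \<psi>0 where \<psi>0: "homeomorphism U0 (\<phi>0 ` U0) \<phi>0 \<psi>0"
    using P0(1) unfolding local_parametrization_def by blast
  have hC: "homeomorphism U U0 C C'"
    by (rule homeomorphismI) (use C' bounded_linear.continuous_on[OF bC(1) continuous_on_id]
      bounded_linear.continuous_on[OF bC(2) continuous_on_id] in \<open>auto simp: U_def\<close>)
  have hom: "homeomorphism U (\<phi> ` U) \<phi> (C' \<circ> \<psi>0)"
    using homeomorphism_compose[OF hC \<psi>0] unfolding im by (simp add: \<phi>_def o_def)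
  show ?thesis
  proof (rule that)
    show "local_parametrization M U \<phi>"
      unfolding local_parametrization_def
    proof (intro conjI ballI)
      show "inj (D \<phi> u)" if "u \<in> U" for u
        unfolding D[OF that] using I0.inj_frechet[of "C u"] C(2) that by (auto simp: inj_def U_def)
      show "openin (top_of_set M) (\<phi> ` U)" unfolding im using P0(1) by (simp add: local_parametrization_def)
    qed (use oU sm hom in auto)
    show uU: "C' u0 \<in> U" using u0 C' by (simp add: U_def)
    show "\<phi> (C' u0) = p" using u0 C' by (simp add: \<phi>_def)
    show "induced_metric \<phi> (C' u0) = mat 1"
      using D[OF uU] C' by (simp add: induced_metric_def vec_eq_iff partial_def C(3) inner_axis_axis mat_def)
  qed
qed

locale normal_frame = immersion U \<phi>
  for U :: "(real^'n::finite) set" and \<phi> :: "real^'n \<Rightarrow> real^('n option)" +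
  fixes u :: "real^'n"
  assumes u: "u \<in> U" and met1: "induced_metric \<phi> u = mat 1"
begin

lemma inv_met1: "inv_met u = mat 1"
  unfolding met1 by (rule matrix_inv_unique) simp

lemma frechet_inner: "D \<phi> u v \<bullet> D \<phi> u w = v \<bullet> w"
proof -
  have "D \<phi> u v \<bullet> D \<phi> u w = (\<Sum>i\<in>UNIV. \<Sum>j\<in>UNIV. v $ i * (w $ j * met u $ i $ j))"
    by (simp add: frechet_tang[OF u] inner_sum_left inner_sum_right met_entry sum_distrib_left)
      (subst sum.swap, simp add: mult_ac)
  also have "\<dots> = v \<bullet> w"
    by (simp add: met1 mat_def inner_vec_def if_distrib cong: if_cong)
  finally show ?thesis .
qed

lemma frechet_norm: "norm (D \<phi> u v) = norm v"
  by (simp add: norm_eq_sqrt_inner frechet_inner)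

lemma mean_curvature_frame: "mean_curvature u = (\<Sum>i\<in>UNIV. second_form i i u)"
proof -
  have "(\<Sum>j\<in>UNIV. inv_met u $ i $ j *\<^sub>R second_form i j u) = (\<Sum>j\<in>UNIV. if j = i then second_form i j u else 0)" for i
    by (rule sum.cong) (auto simp: inv_met1 mat_def)
  then show ?thesis by (simp add: mean_curvature_def)
qed

lemma scalar_frame: "scalar_coord met u = mean_curvature u \<bullet> mean_curvature u
   - (\<Sum>i\<in>UNIV. \<Sum>k\<in>UNIV. second_form i k u \<bullet> second_form i k u)"
proof -
  have r: "ricci_coord met i j u = (\<Sum>k\<in>UNIV. second_form i j u \<bullet> second_form k k u - second_form i k u \<bullet> second_form j k u)" for i j
  proof -
    have "(\<Sum>l\<in>UNIV. inv_met u $ k $ l * (second_form i j u \<bullet> second_form k l u - second_form i k u \<bullet> second_form j l u))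
      = (\<Sum>l\<in>UNIV. if l = k then second_form i j u \<bullet> second_form k l u - second_form i k u \<bullet> second_form j l u else 0)" for k
      by (rule sum.cong) (auto simp: inv_met1 mat_def)
    then show ?thesis by (simp add: gauss_ricci[OF u])
  qed
  have "(\<Sum>j\<in>UNIV. inv_met u $ i $ j * ricci_coord met i j u) = (\<Sum>j\<in>UNIV. if j = i then ricci_coord met i j u else 0)" for i
    by (rule sum.cong) (auto simp: inv_met1 mat_def)
  then have "scalar_coord met u = (\<Sum>i\<in>UNIV. ricci_coord met i i u)" by (simp add: scalar_coord_def)
  also have "\<dots> = (\<Sum>i\<in>UNIV. \<Sum>k\<in>UNIV. second_form i i u \<bullet> second_form k k u) - (\<Sum>i\<in>UNIV. \<Sum>k\<in>UNIV. second_form i k u \<bullet> second_form i k u)"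
    unfolding r by (simp add: sum_subtractf)
  also have "(\<Sum>i\<in>UNIV. \<Sum>k\<in>UNIV. second_form i i u \<bullet> second_form k k u) = mean_curvature u \<bullet> mean_curvature u"
    by (simp add: mean_curvature_frame inner_sum_left inner_sum_right) (rule sum.swap)
  finally show ?thesis .
qed

end

context immersion begin

lemma normal_part_normal:
  assumes u: "u \<in> U" shows "normal_part u y \<bullet> tang k u = 0"
proof -
  have "(\<Sum>i\<in>UNIV. \<Sum>j\<in>UNIV. inv_met u $ i $ j * (y \<bullet> tang i u) * met u $ j $ k) =
    (\<Sum>i\<in>UNIV. (y \<bullet> tang i u) * (\<Sum>j\<in>UNIV. inv_met u $ i $ j * met u $ j $ k))"
    by (simp add: sum_distrib_left mult_ac)
  also have "\<dots> = y \<bullet> tang k u" by (simp add: inv_met_met[OF u] if_distrib cong: if_cong)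
  finally show ?thesis
    by (simp add: normal_part_def inner_diff_left inner_sum_left met_entry)
qed

lemma normal_part_normal_frechet:
  "u \<in> U \<Longrightarrow> normal_part u y \<bullet> D \<phi> u v = 0"
  by (simp add: frechet_tang inner_sum_right normal_part_normal)

lemma mean_curvature_normal:
  "u \<in> U \<Longrightarrow> mean_curvature u \<bullet> D \<phi> u v = 0"
  by (simp add: mean_curvature_def inner_sum_left sform_axis[symmetric] sform_normal)

text \<open>
  The normal part is unchanged by tangential vectors. Near the pole, \<open>P - Q\<close> is almost tangential and
  only its second-order deviation survives.
\<close>

lemma normal_part_tangent_shift:
  assumes u: "u \<in> U"
  shows "normal_part u (y + D \<phi> u v) = normal_part u y"
proof -
  have "(\<Sum>i\<in>UNIV. \<Sum>j\<in>UNIV. (inv_met u $ i $ j * (D \<phi> u v \<bullet> tang i u)) *\<^sub>R tang j u)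
    = (\<Sum>j\<in>UNIV. (\<Sum>i\<in>UNIV. inv_met u $ j $ i * (\<Sum>k\<in>UNIV. v $ k * met u $ k $ i)) *\<^sub>R tang j u)"
    by (subst sum.swap) (simp add: frechet_tang[OF u] inner_sum_left met_entry scaleR_sum_left inv_met_commute[OF u])
  also have "\<dots> = (\<Sum>j\<in>UNIV. v $ j *\<^sub>R tang j u)"
    by (simp add: raise_index[OF u refl, of "\<lambda>k. v $ k", symmetric])
  finally show ?thesis
    by (simp add: normal_part_def inner_add_left distrib_left scaleR_add_left sum.distrib frechet_tang[OF u])
qed

lemma normal_part_inner_shift:
  assumes u: "u \<in> U"
  shows "(y + D \<phi> u v) \<bullet> normal_part u (y + D \<phi> u v) = y \<bullet> normal_part u y"
  unfolding normal_part_tangent_shift[OF u]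
  using normal_part_normal_frechet[OF u, of y v] by (simp add: inner_add_left) (simp add: inner_commute)

lemma inner_normal_part:
  assumes u: "u \<in> U" and z: "\<And>v. z \<bullet> D \<phi> u v = 0"
  shows "z \<bullet> normal_part u y = z \<bullet> y"
proof -
  have "z \<bullet> tang k u = 0" for k using z[of "axis k 1"] by (simp add: partial_def)
  then show ?thesis by (simp add: normal_part_def inner_diff_right inner_sum_right)
qed

text \<open>
  This is where codimension one enters: the normal space is a line, so all normal vectors at a point
  are multiples of any nonzero one.
\<close>

lemma dim_normal_space:
  assumes u: "u \<in> U"
  shows "dim {z. \<forall>v. z \<bullet> D \<phi> u v = 0} = 1"
proof -
  let ?T = "range (D \<phi> u)"
  have sub: "subspace ?T" by (rule linear_subspace_image[OF linear_frechet_phi[OF u] subspace_UNIV])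
  have "dim ?T = CARD('n)"
    using dim_image_eq[OF linear_frechet_phi[OF u], of UNIV] inj_frechet[OF u] by simp
  moreover have "dim {y \<in> UNIV. \<forall>x \<in> ?T. orthogonal x y} + dim ?T = dim (UNIV :: (real^('n option)) set)"
    by (rule dim_subspace_orthogonal_to_vectors[OF sub subspace_UNIV]) auto
  moreover have "{y \<in> UNIV. \<forall>x \<in> ?T. orthogonal x y} = {z. \<forall>v. z \<bullet> D \<phi> u v = 0}"
    by (auto simp: orthogonal_def inner_commute)
  ultimately show ?thesis by simp
qed

lemma unit_normal_exists:
  assumes u: "u \<in> U"
  obtains \<nu> where "norm \<nu> = 1" "\<And>v. \<nu> \<bullet> D \<phi> u v = 0"
proof -
  let ?N = "{z. \<forall>v. z \<bullet> D \<phi> u v = 0}"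
  have "\<not> ?N \<subseteq> {0}" using dim_normal_space[OF u] dim_eq_0[of ?N] by simp
  then obtain z where z: "z \<in> ?N" "z \<noteq> 0" by blast
  show ?thesis by (rule that[of "z /\<^sub>R norm z"]) (use z in auto)
qed

lemma normal_parallel:
  assumes u: "u \<in> U" and z: "z \<noteq> 0" "\<And>v. z \<bullet> D \<phi> u v = 0"
    and w: "\<And>v. w \<bullet> D \<phi> u v = 0"
  shows "w = ((z \<bullet> w) / (z \<bullet> z)) *\<^sub>R z"
proof -
  let ?N = "{z. \<forall>v. z \<bullet> D \<phi> u v = 0}"
  have "subspace ?N" by (auto simp: subspace_def inner_add_left)
  moreover have "span {z} \<subseteq> ?N" using z \<open>subspace ?N\<close> by (intro span_minimal) auto
  moreover have "dim (span {z}) = 1" using z(1) by simp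
  ultimately have "span {z} = ?N"
    using dim_normal_space[OF u] by (intro subspace_dim_equal) auto
  moreover have "w \<in> ?N" using w by simp
  ultimately have "w \<in> span {z}" by blast
  then obtain c where "w = c *\<^sub>R z" by (auto simp: span_singleton)
  then show ?thesis using z(1) by simp
qed

end

section \<open>The maximum principle\<close>

text \<open>
  For a definite form the off-diagonal entries satisfy \<open>q i j ^ 2 < q i i * q j j\<close>, and there are
  off-diagonal entries in dimension at least two.
\<close>

lemma posdef_norm_less_trace:
  fixes q :: "real^'n::finite \<Rightarrow> real^'n \<Rightarrow> real"
  assumes n: "CARD('n) \<ge> 2" and lin: "\<And>w. linear (\<lambda>v. q v w)" "\<And>v. linear (\<lambda>w. q v w)"
    and sym: "\<And>v w. q v w = q w v" and pos: "\<And>v. v \<noteq> 0 \<Longrightarrow> q v v > 0"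
  shows "(\<Sum>i\<in>UNIV. \<Sum>j\<in>UNIV. (q (axis i 1) (axis j 1))\<^sup>2) < (\<Sum>i\<in>UNIV. q (axis i 1) (axis i 1))\<^sup>2"
proof -
  let ?e = "\<lambda>i. axis i 1 :: real^'n"
  have d: "q (?e i) (?e i) > 0" for i by (rule pos) simp
  have off: "(q (?e i) (?e j))\<^sup>2 < q (?e i) (?e i) * q (?e j) (?e j)" if "i \<noteq> j" for i j
  proof -
    let ?a = "q (?e j) (?e j)" and ?b = "q (?e i) (?e j)"
    have "?a *\<^sub>R ?e i - ?b *\<^sub>R ?e j \<noteq> 0"
    proof
      assume "?a *\<^sub>R ?e i - ?b *\<^sub>R ?e j = 0"
      then have "(?a *\<^sub>R ?e i - ?b *\<^sub>R ?e j) $ i = 0" by simp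
      then show False using d[of j] that by (simp add: axis_def)
    qed
    from pos[OF this] have "?a * (?a * q (?e i) (?e i) - ?b\<^sup>2) > 0"
      by (simp add: linear_diff[OF lin(1)] linear_diff[OF lin(2)] linear_cmul[OF lin(1)] linear_cmul[OF lin(2)]
         sym[of "?e j" "?e i"] power2_eq_square algebra_simps)
    then have "?a * q (?e i) (?e i) - ?b\<^sup>2 > 0" using d[of j] by (simp add: zero_less_mult_iff)
    then show ?thesis by (simp add: mult.commute)
  qed
  have le: "(q (?e i) (?e j))\<^sup>2 \<le> q (?e i) (?e i) * q (?e j) (?e j)" for i j
    by (cases "i = j") (use off less_imp_le in \<open>auto simp: power2_eq_square\<close>)
  have "\<not> (\<forall>a b::'n. a = b)"
  proof
    assume "\<forall>a b::'n. a = b"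
    then have "UNIV = {undefined :: 'n}" by auto
    then have "CARD('n) = card {undefined :: 'n}" by metis
    then show False using n by simp
  qed
  then obtain a b :: 'n where ab: "a \<noteq> b" by blast
  have "(\<Sum>i\<in>UNIV. \<Sum>j\<in>UNIV. (q (?e i) (?e j))\<^sup>2) < (\<Sum>i\<in>UNIV. \<Sum>j\<in>UNIV. q (?e i) (?e i) * q (?e j) (?e j))"
  proof (rule sum_strict_mono_ex1)
    show "\<forall>i\<in>UNIV. (\<Sum>j\<in>UNIV. (q (?e i) (?e j))\<^sup>2) \<le> (\<Sum>j\<in>UNIV. q (?e i) (?e i) * q (?e j) (?e j))"
      by (auto intro: sum_mono le)
    have "(\<Sum>j\<in>UNIV. (q (?e a) (?e j))\<^sup>2) < (\<Sum>j\<in>UNIV. q (?e a) (?e a) * q (?e j) (?e j))"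
      by (rule sum_strict_mono_ex1) (use le off[OF ab] in auto)
    then show "\<exists>i\<in>UNIV. (\<Sum>j\<in>UNIV. (q (?e i) (?e j))\<^sup>2) < (\<Sum>j\<in>UNIV. q (?e i) (?e i) * q (?e j) (?e j))" by blast
  qed simp
  also have "\<dots> = (\<Sum>i\<in>UNIV. q (?e i) (?e i))\<^sup>2"
    by (simp add: power2_eq_square sum_product)
  finally show ?thesis .
qed

text \<open>
  The hypersurface obtained from \<open>M\<close> by inversion at \<open>Q\<close> is scalar flat.
\<close>

definition curvature_equation :: "(real^('n::finite option)) set \<Rightarrow> real^('n option) \<Rightarrow> bool" where
  "curvature_equation M Q \<longleftrightarrow> (\<forall>U \<phi> u. local_parametrization M U \<phi> \<longrightarrow> u \<in> U \<longrightarrow> \<phi> u \<noteq> Q \<longrightarrow>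
    immersion.curvature_defect \<phi> u (\<phi> u - Q) (\<phi> u - Q) = 0)"

lemma normal_frame_of_parametrization:
  assumes "local_parametrization M U \<phi>" "u \<in> U" "induced_metric \<phi> u = mat 1"
  shows "normal_frame U \<phi> u"
  using immersion_of_parametrization[OF assms(1)] assms(2,3)
  by (simp add: normal_frame_def normal_frame_axioms_def)

text \<open>
  The first and second derivative tests, in the form needed for the touching argument.
\<close>

lemma local_min_derivatives:
  fixes f :: "'a::euclidean_space \<Rightarrow> real"
  assumes U: "open U" "u \<in> U" and f: "smooth_on U f" and min: "\<And>x. x \<in> U \<Longrightarrow> f u \<le> f x"
  shows "D f u v = 0" "D2 f u v v \<ge> 0"
proof -
  have D: "D f u = (\<lambda>v. 0)"
    by (rule differential_zero_maxmin[OF U(2,1) has_frechet_derivative[OF smooth_on_imp_differentiable[OF f U(2)]]])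
       (use min in auto)
  then show "D f u v = 0" by simp
  show "D2 f u v v \<ge> 0"
  proof (rule ccontr)
    define A where "A = D2 f u v v"
    assume "\<not> ?thesis"
    then have A: "A < 0" by (simp add: A_def)
    have v: "v \<noteq> 0"
    proof
      assume "v = 0"
      then have "A = 0" using linear_0[OF linear_second_derivative(1)[OF U f]] by (simp add: A_def)
      then show False using A by simp
    qed
    define e where "e = - A / (4 * (norm v)\<^sup>2)"
    have e: "e > 0" using A v by (simp add: e_def divide_neg_pos)
    obtain d where d: "d > 0" "\<And>h. norm h < d \<Longrightarrow> u + h \<in> U \<and>
      norm (f (u + h) - f u - D f u h - (1/2) *\<^sub>R D2 f u h h) \<le> e * (norm h)\<^sup>2"
      using taylor_second_order[OF U f e] by metis
    define r where "r = d / (2 * norm v)"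
    have r: "r > 0" using d v by (simp add: r_def)
    have nr: "norm (r *\<^sub>R v) < d" using d v by (simp add: r_def)
    have "D2 f u (r *\<^sub>R v) (r *\<^sub>R v) = r\<^sup>2 * A"
      using linear_cmul[OF linear_second_derivative(1)[OF U f]] linear_cmul[OF linear_second_derivative(2)[OF U f]]
      by (simp add: A_def power2_eq_square)
    then have "f (u + r *\<^sub>R v) - f u - r\<^sup>2 * A / 2 \<le> e * (norm (r *\<^sub>R v))\<^sup>2" "f u \<le> f (u + r *\<^sub>R v)"
      using d(2)[OF nr] min D by auto
    moreover have "e * (norm (r *\<^sub>R v))\<^sup>2 = - (r\<^sup>2 * A) / 4"
      using v by (simp add: e_def power_mult_distrib)
    ultimately have "r\<^sup>2 * A \<ge> 0" by simp
    then show False using r A by (simp add: zero_le_mult_iff)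
  qed
qed

context normal_frame begin

text \<open>
  In the application \<open>M\<close> lies locally on one side of the sphere or hyperplane of all \<open>x\<close> with
  \<open>t |x - Q|^2 - (x - Q) \<bullet> \<nu> = \<epsilon>\<close> and touches it at \<open>Q + y\<close>, where \<open>z = 2 t y - \<nu>\<close> is its normal. After contraction with \<open>z\<close> the
  form \<open>B\<close> of \<open>curvature_defect\<close> becomes \<open>q\<close>, and the touching condition makes it at least \<open>2 \<epsilon> / s\<close> times the
  metric. A definite form cannot satisfy the curvature equation.
\<close>

lemma touching_contradiction:
  assumes n: "CARD('n) \<ge> 2"
    and eq: "curvature_defect u y y = 0" and y: "y \<noteq> 0" and \<epsilon>: "\<epsilon> > 0" and z: "\<And>v. z \<bullet> D \<phi> u v = 0"
    and zy: "z \<bullet> y = t * (y \<bullet> y) + \<epsilon>" and hess: "\<And>v. 2 * t * (v \<bullet> v) + z \<bullet> sform u v v \<ge> 0"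
  shows False
proof -
  define s where "s = y \<bullet> y"
  have s: "s > 0" using y by (simp add: s_def)
  note zy = zy[folded s_def]
  have z0: "z \<noteq> 0"
  proof
    assume z0: "z = 0"
    have "2 * t * ((axis undefined 1 :: real^'n) \<bullet> axis undefined 1) + z \<bullet> sform u (axis undefined 1) (axis undefined 1) \<ge> 0"
      by (rule hess)
    then have "t \<ge> 0" using z0 by simp
    then show False using zy z0 s \<epsilon> by (simp add: add_nonneg_pos less_imp_neq[symmetric] add_nonneg_eq_0_iff)
  qed
  define N where "N = real CARD('n)"
  define A where "A = (\<lambda>i j. z \<bullet> second_form i j u)"
  define T where "T = (\<Sum>i\<in>UNIV. A i i)"
  define S where "S = (\<Sum>i\<in>UNIV. \<Sum>j\<in>UNIV. (A i j)\<^sup>2)"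
  define m where "m = z \<bullet> z"
  define \<theta> where "\<theta> = z \<bullet> y"
  define \<rho> where "\<rho> = \<theta> / s"
  have m: "m > 0" using z0 by (simp add: m_def)
  have II: "second_form i j u = (A i j / m) *\<^sub>R z" for i j
    unfolding A_def m_def
    by (rule normal_parallel[OF u z0 z]) (simp add: sform_axis[symmetric] sform_normal[OF u])
  have zH: "z \<bullet> mean_curvature u = T"
    by (simp add: mean_curvature_frame T_def A_def inner_sum_right)
  have H: "mean_curvature u = (T / m) *\<^sub>R z"
    using normal_parallel[OF u z0 z mean_curvature_normal[OF u]] by (simp add: zH m_def)
  have Y: "normal_part u y = (\<theta> / m) *\<^sub>R z"
    using normal_parallel[OF u z0 z normal_part_normal_frechet[OF u]]
    by (simp add: inner_normal_part[OF u z] m_def \<theta>_def)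
  have "4 * (N - 1) * (N * (\<theta>\<^sup>2 / m) / s\<^sup>2 + T * \<theta> / m / s) + (T\<^sup>2 / m - S / m) = 0"
  proof -
    have "y \<bullet> normal_part u y = \<theta>\<^sup>2 / m" unfolding Y by (simp add: \<theta>_def inner_commute power2_eq_square)
    moreover have "y \<bullet> mean_curvature u = T * \<theta> / m" unfolding H by (simp add: \<theta>_def inner_commute)
    moreover have "scalar_coord met u = T\<^sup>2 / m - S / m"
    proof -
      have "mean_curvature u \<bullet> mean_curvature u = T\<^sup>2 / m"
        unfolding H using m by (simp add: m_def[symmetric] power2_eq_square)
      moreover have "second_form i k u \<bullet> second_form i k u = (A i k)\<^sup>2 / m" for i k
        unfolding II using m by (simp add: m_def[symmetric] power2_eq_square)
      ultimately show ?thesis unfolding scalar_frame by (simp add: S_def sum_divide_distrib)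
    qed
    ultimately show ?thesis using eq by (simp add: curvature_defect_def N_def s_def)
  qed
  then have "(4 * (N - 1) * (N * \<rho>\<^sup>2 + T * \<rho>) + T\<^sup>2 - S) / m = 0"
    by (simp add: \<rho>_def power_divide add_divide_distrib diff_divide_distrib algebra_simps)
  then have main: "4 * (N - 1) * (N * \<rho>\<^sup>2 + T * \<rho>) + T\<^sup>2 - S = 0" using m by simp
  define q where "q = (\<lambda>v w. z \<bullet> sform u v w + 2 * \<rho> * (v \<bullet> w))"
  have "(\<Sum>i\<in>UNIV. \<Sum>j\<in>UNIV. (q (axis i 1) (axis j 1))\<^sup>2) < (\<Sum>i\<in>UNIV. q (axis i 1) (axis i 1))\<^sup>2"
  proof (rule posdef_norm_less_trace[OF n])
    show "linear (\<lambda>v. q v w)" for w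
      unfolding q_def using linear_add[OF sform_bilinear(1)] linear_cmul[OF sform_bilinear(1)]
      by (intro linearI) (simp_all add: inner_add_right inner_add_left algebra_simps)
    show "linear (\<lambda>w. q v w)" for v
      unfolding q_def using linear_add[OF sform_bilinear(2)] linear_cmul[OF sform_bilinear(2)]
      by (intro linearI) (simp_all add: inner_add_right algebra_simps)
    show "q v w = q w v" for v w by (simp add: q_def sform_commute[OF u, of v] inner_commute)
    show "q v v > 0" if "v \<noteq> 0" for v
    proof -
      have "\<rho> = t + \<epsilon> / s" using s by (simp add: \<rho>_def \<theta>_def zy field_simps)
      then have "q v v = 2 * t * (v \<bullet> v) + z \<bullet> sform u v v + 2 * (\<epsilon> / s) * (v \<bullet> v)"
        by (simp add: q_def algebra_simps)
      moreover have "2 * (\<epsilon> / s) * (v \<bullet> v) > 0" using \<epsilon> s that by simp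
      ultimately show ?thesis using hess[of v] by linarith
    qed
  qed
  moreover have q: "q (axis i 1) (axis j 1) = A i j + (if i = j then 2 * \<rho> else 0)" for i j
    by (simp add: q_def sform_axis A_def inner_axis_axis)
  have "(\<Sum>i\<in>UNIV. q (axis i 1) (axis i 1)) = T + 2 * N * \<rho>"
    by (simp add: q sum.distrib T_def N_def)
  moreover have "(\<Sum>i\<in>UNIV. \<Sum>j\<in>UNIV. (q (axis i 1) (axis j 1))\<^sup>2) = S + 4 * \<rho> * T + 4 * N * \<rho>\<^sup>2"
  proof -
    have "(q (axis i 1) (axis j 1))\<^sup>2 = (A i j)\<^sup>2 + (if j = i then 4 * \<rho> * A i j + 4 * \<rho>\<^sup>2 else 0)" for i j
      by (simp add: q power2_eq_square algebra_simps)
    then show ?thesis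
      by (simp add: sum.distrib S_def T_def N_def sum_distrib_left)
  qed
  ultimately have "S + 4 * \<rho> * T + 4 * N * \<rho>\<^sup>2 < (T + 2 * N * \<rho>)\<^sup>2" by simp
  then show False using main by (simp add: power2_eq_square algebra_simps)
qed

end

text \<open>
  The quotient \<open>((P - Q) \<bullet> \<nu>) / |P - Q|^2\<close> is the height, in direction \<open>\<nu>\<close>, of the inverted point, and
  \<open>\<kappa>\<close> bounds its limit superior at the pole. If it exceeds \<open>\<kappa>\<close> somewhere, then so does its maximum after
  the perturbation by a small multiple \<open>\<epsilon> / |P - Q|^2\<close>, and this maximum is attained away from the pole. The
  perturbation makes \<open>B\<close> strictly definite there; at a maximum of the quotient itself it could vanish.
\<close>

lemma quotient_bound:
  fixes M :: "(real^('n::finite option)) set"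
  assumes n: "CARD('n) \<ge> 2" and M: "closed_embedded_hypersurface M" and CE: "curvature_equation M Q"
    and lim: "\<And>e. e > 0 \<Longrightarrow> \<exists>d>0. \<forall>P\<in>M. norm (P - Q) < d \<longrightarrow> (P - Q) \<bullet> \<nu> \<le> (\<kappa> + e) * ((P - Q) \<bullet> (P - Q))"
    and P1: "P1 \<in> M"
  shows "(P1 - Q) \<bullet> \<nu> \<le> \<kappa> * ((P1 - Q) \<bullet> (P1 - Q))"
proof (rule ccontr)
  assume neg: "\<not> ?thesis"
  define s where "s = (\<lambda>P. (P - Q) \<bullet> (P - Q))"
  define hgt where "hgt = (\<lambda>P. ((P - Q) \<bullet> \<nu>) / s P)"
  have s0: "s P > 0" if "P \<noteq> Q" for P using that by (simp add: s_def)
  have P1Q: "P1 \<noteq> Q" using neg by auto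
  have h1: "hgt P1 > \<kappa>" using neg s0[OF P1Q] by (simp add: hgt_def s_def field_simps)
  define mid where "mid = (\<kappa> + hgt P1) / 2"
  have mid: "\<kappa> < mid" "mid < hgt P1" using h1 by (auto simp: mid_def)
  obtain d where d: "d > 0" "\<And>P. P \<in> M \<Longrightarrow> norm (P - Q) < d \<Longrightarrow> (P - Q) \<bullet> \<nu> \<le> mid * s P"
    using lim[of "mid - \<kappa>"] mid by (auto simp: s_def)
  \<comment> \<open>Heights above \<open>mid\<close> occur only at distance at least \<open>d\<close>; the compact set \<open>K\<close> uses \<open>d / 2\<close> so that the
    maximum is interior to it.\<close>
  have hd: "norm (P - Q) \<ge> d" if "P \<in> M" "P \<noteq> Q" "hgt P > mid" for P
    using d(2)[OF that(1)] that s0[OF that(2)] by (force simp: hgt_def field_simps)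
  define K where "K = M \<inter> {P. d / 2 \<le> norm (P - Q)}"
  have K: "compact K"
    unfolding K_def using M by (intro compact_Int_closed closed_Collect_le continuous_intros)
      (auto simp: closed_embedded_hypersurface_def)
  have KQ: "P \<noteq> Q" if "P \<in> K" for P using that d(1) by (auto simp: K_def)
  have P1K: "P1 \<in> K" using hd[OF P1 P1Q] mid d(1) P1 by (simp add: K_def)
  \<comment> \<open>Small enough that the perturbed maximum still has height above \<open>mid\<close>.\<close>
  define \<epsilon> where "\<epsilon> = (hgt P1 - mid) * (d / 2)\<^sup>2 / 2"
  have \<epsilon>: "\<epsilon> > 0" using mid d(1) by (simp add: \<epsilon>_def)
  have \<epsilon>s: "\<epsilon> / s P < hgt P1 - mid" if "P \<in> K" for P
  proof -
    have "(d / 2)\<^sup>2 \<le> (norm (P - Q))\<^sup>2" using that d(1) by (intro power_mono) (auto simp: K_def)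
    then have "(hgt P1 - mid) * (d / 2)\<^sup>2 \<le> (hgt P1 - mid) * s P"
      using mid by (intro mult_left_mono) (auto simp: s_def dot_square_norm)
    moreover have "(hgt P1 - mid) * (d / 2)\<^sup>2 > 0" using mid d(1) by simp
    ultimately have "\<epsilon> < (hgt P1 - mid) * s P" by (simp add: \<epsilon>_def)
    then show ?thesis using s0[OF KQ[OF that]] by (simp add: pos_divide_less_eq)
  qed
  define F where "F = (\<lambda>P. ((P - Q) \<bullet> \<nu> + \<epsilon>) / s P)"
  have F: "F P = hgt P + \<epsilon> / s P" for P by (simp add: F_def hgt_def add_divide_distrib)
  have "continuous_on K F"
    unfolding F_def using KQ s0 by (intro continuous_intros) (auto simp: s_def intro!: continuous_intros)
  then obtain P0 where P0: "P0 \<in> K" "\<And>P. P \<in> K \<Longrightarrow> F P \<le> F P0"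
    using continuous_attains_sup[OF K] P1K by blast
  define t where "t = F P0"
  have P0M: "P0 \<in> M" and P0Q: "P0 \<noteq> Q" using P0(1) KQ by (auto simp: K_def)
  have "hgt P0 > mid"
  proof -
    have "F P1 > hgt P1" using \<epsilon> s0[OF P1Q] by (simp add: F)
    then have "F P0 > hgt P1" using P0(2)[OF P1K] by simp
    then show ?thesis using \<epsilon>s[OF P0(1)] by (simp add: F)
  qed
  then have P0d: "norm (P0 - Q) \<ge> d" using hd P0M P0Q by blast
  obtain U \<phi> u where c: "local_parametrization M U \<phi>" "u \<in> U" "\<phi> u = P0" "induced_metric \<phi> u = mat 1"
    using normalized_chart[OF M P0M] by metis
  define V where "V = {x \<in> U. d / 2 < norm (\<phi> x - Q)}"
  interpret IU: immersion U \<phi> by (rule immersion_of_parametrization[OF c(1)])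
  have "open (U \<inter> \<phi> -` {P. d / 2 < norm (P - Q)})"
    by (intro continuous_open_preimage IU.open_U smooth_on_imp_continuous_on[OF IU.smooth_phi] open_Collect_less continuous_intros)
  moreover have "U \<inter> \<phi> -` {P. d / 2 < norm (P - Q)} = V" by (auto simp: V_def)
  ultimately have oV: "open V" by simp
  have PV: "local_parametrization M V \<phi>"
    by (rule local_parametrization_subset[OF c(1) oV]) (auto simp: V_def)
  have uV: "u \<in> V" using c P0d d(1) by (simp add: V_def)
  interpret normal_frame V \<phi> u by (rule normal_frame_of_parametrization[OF PV uV c(4)])
  define f where "f = (\<lambda>x. t * ((\<phi> x - Q) \<bullet> (\<phi> x - Q)) - (\<phi> x - Q) \<bullet> \<nu>)"
  have sy: "smooth_on V (\<lambda>x. \<phi> x - Q)" by (intro smooth_on_diff oV smooth_phi smooth_on_const)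
  have sf: "smooth_on V f"
    unfolding f_def by (intro smooth_on_diff smooth_on_mult smooth_on_inner oV sy smooth_on_const)
  have fu: "f u = \<epsilon>"
  proof -
    have "t * s P0 = (P0 - Q) \<bullet> \<nu> + \<epsilon>" using s0[OF P0Q] by (simp add: t_def F_def)
    then show ?thesis by (simp add: f_def c(3) s_def)
  qed
  have fmin: "f u \<le> f x" if "x \<in> V" for x
  proof -
    have xK: "\<phi> x \<in> K" using parametrization_in[OF PV that] that by (auto simp: V_def K_def)
    then have "F (\<phi> x) \<le> t" using P0(2) by (simp add: t_def)
    then have "(\<phi> x - Q) \<bullet> \<nu> + \<epsilon> \<le> t * s (\<phi> x)" using s0[OF KQ[OF xK]] by (simp add: F_def field_simps)
    then show ?thesis unfolding fu by (simp add: f_def s_def)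
  qed
  define z where "z = (\<lambda>x. (2 * t) *\<^sub>R (\<phi> x - Q) - \<nu>)"
  have Df: "D f x v = z x \<bullet> D \<phi> x v" if "x \<in> V" for x v
  proof -
    have "(f has_derivative (\<lambda>v. z x \<bullet> D \<phi> x v)) (at x)"
      unfolding f_def z_def using has_frechet_derivative[OF phi_differentiable[OF that]]
      by (auto intro!: derivative_eq_intros simp: fun_eq_iff inner_diff_left inner_diff_right inner_commute algebra_simps)
    then show ?thesis using frechet_derivative_at by metis
  qed
  have D2f: "D2 f u v v = 2 * t * (v \<bullet> v) + z u \<bullet> D2 \<phi> u v v" for v
  proof -
    let ?D = "\<lambda>x. D \<phi> x v"
    have dD: "(?D has_derivative (\<lambda>w. D2 \<phi> u w v)) (at u)"
      unfolding D2_def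
      by (rule has_frechet_derivative[OF smooth_on_imp_differentiable[OF smooth_on_frechet[OF smooth_phi] u]])
    have "((\<lambda>x. z x \<bullet> ?D x) has_derivative (\<lambda>w. z u \<bullet> D2 \<phi> u w v + ((2 * t) *\<^sub>R D \<phi> u w) \<bullet> ?D u)) (at u)"
      unfolding z_def
      by (rule has_derivative_inner[OF _ dD])
         (auto intro!: derivative_eq_intros has_frechet_derivative[OF phi_differentiable[OF u]])
    then have "((\<lambda>x. D f x v) has_derivative (\<lambda>w. z u \<bullet> D2 \<phi> u w v + ((2 * t) *\<^sub>R D \<phi> u w) \<bullet> ?D u)) (at u)"
      by (rule has_derivative_transform_within_open[OF _ oV u]) (simp add: Df)
    from fun_cong[OF frechet_derivative_at[OF this], of v]
    show ?thesis by (simp add: D2_def[of f] frechet_inner)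
  qed
  have zn: "z u \<bullet> D \<phi> u v = 0" for v
    using local_min_derivatives(1)[OF oV u sf fmin] Df[OF u] by metis
  show False
  proof (rule touching_contradiction[OF n, of "P0 - Q" \<epsilon> "z u" t])
    show "curvature_defect u (P0 - Q) (P0 - Q) = 0"
      using CE PV uV P0Q c(3) unfolding curvature_equation_def by metis
    show "z u \<bullet> D \<phi> u v = 0" for v by (rule zn)
    show "z u \<bullet> (P0 - Q) = t * ((P0 - Q) \<bullet> (P0 - Q)) + \<epsilon>"
      using fu by (simp add: z_def f_def s_def c(3) inner_diff_left[of "_ *\<^sub>R _"] inner_commute[of \<nu>])
    show "2 * t * (v \<bullet> v) + z u \<bullet> sform u v v \<ge> 0" for v
      using local_min_derivatives(2)[OF oV u sf fmin, of v] unfolding D2f normal_second_derivative[OF u zn] .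
  qed (use P0Q \<epsilon> in auto)
qed

section \<open>Umbilicity at the pole\<close>

context immersion begin

lemma normal_part_scaleR: "normal_part u (c *\<^sub>R y) = c *\<^sub>R normal_part u y"
  by (simp add: normal_part_def scaleR_diff_right scaleR_sum_right mult_ac)

lemma tendsto_normal_part:
  assumes x: "(x \<longlongrightarrow> u) F" and u: "u \<in> U" and y: "(y \<longlongrightarrow> b) F"
  shows "((\<lambda>t. normal_part (x t) (y t)) \<longlongrightarrow> normal_part u b) F"
proof -
  have "isCont (tang i) u" "isCont (\<lambda>x. inv_met x $ i $ j) u" for i j
    using u smooth_differentiable(1,4) differentiable_imp_continuous_within by blast+
  then have "((\<lambda>t. tang i (x t)) \<longlongrightarrow> tang i u) F" "((\<lambda>t. inv_met (x t) $ i $ j) \<longlongrightarrow> inv_met u $ i $ j) F" for i j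
    using isCont_tendsto_compose[OF _ x] by blast+
  then show ?thesis unfolding normal_part_def
    by (intro tendsto_diff tendsto_sum tendsto_scaleR tendsto_mult tendsto_inner y)
qed

lemma tendsto_mean_curvature:
  assumes x: "(x \<longlongrightarrow> u) F" and u: "u \<in> U"
  shows "((\<lambda>t. mean_curvature (x t)) \<longlongrightarrow> mean_curvature u) F"
proof -
  have "isCont (second_form i j) u" "isCont (\<lambda>x. inv_met x $ i $ j) u" for i j
    using u smooth_differentiable(4) smooth_on_imp_differentiable[OF smooth_second_form] differentiable_imp_continuous_within by blast+
  then have "((\<lambda>t. second_form i j (x t)) \<longlongrightarrow> second_form i j u) F" "((\<lambda>t. inv_met (x t) $ i $ j) \<longlongrightarrow> inv_met u $ i $ j) F" for i j
    using isCont_tendsto_compose[OF _ x] by blast+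
  then show ?thesis unfolding mean_curvature_def by (intro tendsto_sum tendsto_scaleR)
qed

lemma tendsto_scalar_coord:
  assumes x: "(x \<longlongrightarrow> u) F" and u: "u \<in> U"
  shows "((\<lambda>t. scalar_coord met (x t)) \<longlongrightarrow> scalar_coord met u) F"
  by (rule isCont_tendsto_compose[OF differentiable_imp_continuous_within[OF
     smooth_on_imp_differentiable[OF smooth_scalar_coord u]] x])

lemma tendsto_curvature_defect:
  assumes "(x \<longlongrightarrow> u) F" "u \<in> U" "(a \<longlongrightarrow> a0) F" "(b \<longlongrightarrow> b0) F" "b0 \<noteq> 0"
  shows "((\<lambda>t. curvature_defect (x t) (a t) (b t)) \<longlongrightarrow> curvature_defect u a0 b0) F"
  unfolding curvature_defect_def
  by (intro tendsto_intros assms tendsto_normal_part[OF assms(1,2)] tendsto_mean_curvature[OF assms(1,2)]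
    tendsto_scalar_coord[OF assms(1,2)]) (use assms(5) in auto)

end

text \<open>
  The limit of the curvature equation as \<open>P\<close> tends to \<open>Q\<close> along the coordinate line in direction \<open>\<xi>\<close>. Here
  \<open>P - Q\<close> differs from a tangent vector at \<open>P\<close> by \<open>y'\<close>, which is \<open>- (t^2 / 2) h\<close> to leading order, while
  \<open>P - Q\<close> itself is of order \<open>t\<close>; the equation is invariant under the rescaling by \<open>t^2\<close> and \<open>t\<close>.
\<close>

lemma curvature_equation_at_pole:
  fixes M :: "(real^('n::finite option)) set"
  assumes CE: "curvature_equation M Q" and P: "local_parametrization M U \<phi>" and uU: "u \<in> U"
    and uQ: "\<phi> u = Q" and met: "induced_metric \<phi> u = mat 1" and \<xi>: "\<xi> \<noteq> 0"
  defines "h \<equiv> D2 \<phi> u \<xi> \<xi>"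
  shows "immersion.curvature_defect \<phi> u (- (1/2) *\<^sub>R h) (D \<phi> u \<xi>) = 0"
proof -
  interpret normal_frame U \<phi> u by (rule normal_frame_of_parametrization[OF P uU met])
  define x where "x = (\<lambda>t::real. u + t *\<^sub>R \<xi>)"
  define y where "y = (\<lambda>t. \<phi> (x t) - Q)"
  define y' where "y' = (\<lambda>t. y t - D \<phi> (x t) (t *\<^sub>R \<xi>))"
  have x: "(x \<longlongrightarrow> u) (at_right 0)" unfolding x_def by (auto intro!: tendsto_eq_intros)
  have t\<xi>: "((\<lambda>t. t *\<^sub>R \<xi>) \<longlongrightarrow> 0) (at_right 0)" by (auto intro!: tendsto_eq_intros)
  have t\<xi>b: "eventually (\<lambda>t. norm (t *\<^sub>R \<xi>) \<le> norm \<xi> * t) (at_right 0)"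
    using eventually_at_right_less[of "0::real"] by eventually_elim simp
  have pos: "eventually (\<lambda>t::real. t > 0) (at_right 0)" by (rule eventually_at_right_less)
  have xU: "eventually (\<lambda>t. x t \<in> U) (at_right 0)" by (rule topological_tendstoD[OF x open_U uU])
  let ?E = "D \<phi> u"
  note lin = linear_frechet_phi[OF uU]
  have y1: "((\<lambda>t. (1 / t) *\<^sub>R y t) \<longlongrightarrow> ?E \<xi>) (at_right 0)"
  proof -
    have "((\<lambda>t. (1 / t) *\<^sub>R (\<phi> (u + t *\<^sub>R \<xi>) - \<phi> u - ?E (t *\<^sub>R \<xi>)) + ?E \<xi>) \<longlongrightarrow> 0 + ?E \<xi>) (at_right 0)"
      by (intro tendsto_add tendsto_const taylor_first_order_limit[OF phi_differentiable[OF uU] t\<xi> t\<xi>b])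
    then show ?thesis
      unfolding add_0
      by (rule Lim_transform_eventually)
         (use pos in \<open>eventually_elim, simp add: y_def x_def uQ linear_cmul[OF lin] scaleR_right_diff_distrib\<close>)
  qed
  have y2: "((\<lambda>t. (1 / t\<^sup>2) *\<^sub>R y' t) \<longlongrightarrow> - (1/2) *\<^sub>R h) (at_right 0)"
  proof -
    let ?D = "\<lambda>x. D \<phi> x \<xi>"
    have hh: "D2 \<phi> u (t *\<^sub>R \<xi>) (t *\<^sub>R \<xi>) = t\<^sup>2 *\<^sub>R h" for t
      using linear_cmul[OF linear_second_derivative(1)[OF open_U uU smooth_phi]]
        linear_cmul[OF linear_second_derivative(2)[OF open_U uU smooth_phi]] by (simp add: h_def power2_eq_square)
    have hD: "D ?D u (t *\<^sub>R \<xi>) = t *\<^sub>R h" for t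
      using linear_cmul[OF linear_second_derivative(1)[OF open_U uU smooth_phi]] by (simp add: h_def D2_def)
    \<comment> \<open>The coefficient \<open>- 1/2\<close> is \<open>1/2\<close> from the expansion of \<open>\<phi>\<close> minus \<open>1\<close> from that of its derivative.\<close>
    have a: "((\<lambda>t. (1 / t\<^sup>2) *\<^sub>R (\<phi> (u + t *\<^sub>R \<xi>) - \<phi> u - ?E (t *\<^sub>R \<xi>) - (1/2) *\<^sub>R D2 \<phi> u (t *\<^sub>R \<xi>) (t *\<^sub>R \<xi>))) \<longlongrightarrow> 0) (at_right 0)"
      by (rule taylor_second_order_limit[OF open_U uU smooth_phi t\<xi> t\<xi>b])
    have b: "((\<lambda>t. (1 / t) *\<^sub>R (?D (u + t *\<^sub>R \<xi>) - ?D u - D ?D u (t *\<^sub>R \<xi>))) \<longlongrightarrow> 0) (at_right 0)"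
      by (rule taylor_first_order_limit[OF smooth_on_imp_differentiable[OF smooth_on_frechet[OF smooth_phi] uU] t\<xi> t\<xi>b])
    have "((\<lambda>t. (1 / t\<^sup>2) *\<^sub>R (\<phi> (u + t *\<^sub>R \<xi>) - \<phi> u - ?E (t *\<^sub>R \<xi>) - (1/2) *\<^sub>R D2 \<phi> u (t *\<^sub>R \<xi>) (t *\<^sub>R \<xi>))
       - (1 / t) *\<^sub>R (?D (u + t *\<^sub>R \<xi>) - ?D u - D ?D u (t *\<^sub>R \<xi>)) + - (1/2) *\<^sub>R h) \<longlongrightarrow> 0 - 0 + - (1/2) *\<^sub>R h) (at_right 0)"
      by (intro tendsto_add tendsto_diff tendsto_const a b)
    then have l: "((\<lambda>t. (1 / t\<^sup>2) *\<^sub>R (\<phi> (u + t *\<^sub>R \<xi>) - \<phi> u - ?E (t *\<^sub>R \<xi>) - (1/2) *\<^sub>R D2 \<phi> u (t *\<^sub>R \<xi>) (t *\<^sub>R \<xi>))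
       - (1 / t) *\<^sub>R (?D (u + t *\<^sub>R \<xi>) - ?D u - D ?D u (t *\<^sub>R \<xi>)) + - (1/2) *\<^sub>R h) \<longlongrightarrow> - (1/2) *\<^sub>R h) (at_right 0)"
      by simp
    show ?thesis
    proof (rule Lim_transform_eventually[OF l])
      show "eventually (\<lambda>t. (1 / t\<^sup>2) *\<^sub>R (\<phi> (u + t *\<^sub>R \<xi>) - \<phi> u - ?E (t *\<^sub>R \<xi>) - (1/2) *\<^sub>R D2 \<phi> u (t *\<^sub>R \<xi>) (t *\<^sub>R \<xi>))
       - (1 / t) *\<^sub>R (?D (u + t *\<^sub>R \<xi>) - ?D u - D ?D u (t *\<^sub>R \<xi>)) + - (1/2) *\<^sub>R h = (1 / t\<^sup>2) *\<^sub>R y' t) (at_right 0)"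
        using pos xU
      proof eventually_elim
        case (elim t)
        have "y' t = \<phi> (u + t *\<^sub>R \<xi>) - \<phi> u - t *\<^sub>R ?D (u + t *\<^sub>R \<xi>)"
          using linear_cmul[OF linear_frechet_phi[OF elim(2)]] by (simp add: y'_def y_def uQ x_def)
        then have "(1 / t\<^sup>2) *\<^sub>R y' t = (1 / t\<^sup>2) *\<^sub>R (\<phi> (u + t *\<^sub>R \<xi>) - \<phi> u) - (1 / t) *\<^sub>R ?D (u + t *\<^sub>R \<xi>)"
          using elim(1) by (simp add: scaleR_right_diff_distrib power2_eq_square)
        moreover have "(1/2::real) *\<^sub>R h = h - (1/2) *\<^sub>R h" by (simp add: scaleR_left_diff_distrib[symmetric, of 1, simplified])
        ultimately show ?case
          using elim(1) unfolding hh hD linear_cmul[OF lin]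
          by (simp add: scaleR_right_diff_distrib power2_eq_square algebra_simps)
      qed
    qed
  qed
  have inv: "eventually (\<lambda>t. curvature_defect (x t) ((1 / t\<^sup>2) *\<^sub>R y' t) ((1 / t) *\<^sub>R y t) = 0) (at_right 0)"
    using pos xU
  proof eventually_elim
    case (elim t)
    obtain \<psi> where \<psi>: "homeomorphism U (\<phi> ` U) \<phi> \<psi>"
      using P unfolding local_parametrization_def by blast
    have "\<phi> (x t) \<noteq> Q"
    proof
      assume "\<phi> (x t) = Q"
      then have "x t = u" using homeomorphism_apply1[OF \<psi>] elim(2) uU uQ by metis
      then show False using elim(1) \<xi> by (simp add: x_def)
    qed
    then have eq: "curvature_defect (x t) (y t) (y t) = 0"
      using CE P elim(2) unfolding curvature_equation_def y_def by metis
    have yy: "y t = y' t + D \<phi> (x t) (t *\<^sub>R \<xi>)" by (simp add: y'_def)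
    have "y t \<bullet> normal_part (x t) (y t) = y' t \<bullet> normal_part (x t) (y' t)"
      unfolding yy by (rule normal_part_inner_shift[OF elim(2)])
    moreover have "D \<phi> (x t) (t *\<^sub>R \<xi>) \<bullet> mean_curvature (x t) = 0"
      using mean_curvature_normal[OF elim(2)] by (simp add: inner_commute)
    then have "y t \<bullet> mean_curvature (x t) = y' t \<bullet> mean_curvature (x t)"
      by (subst yy) (simp add: inner_add_left)
    moreover have "((1 / t\<^sup>2) *\<^sub>R y' t) \<bullet> normal_part (x t) ((1 / t\<^sup>2) *\<^sub>R y' t) / (((1 / t) *\<^sub>R y t) \<bullet> ((1 / t) *\<^sub>R y t))\<^sup>2
       = (y' t \<bullet> normal_part (x t) (y' t)) / (y t \<bullet> y t)\<^sup>2"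
      using elim(1) by (simp add: normal_part_scaleR field_simps power2_eq_square)
    moreover have "((1 / t\<^sup>2) *\<^sub>R y' t) \<bullet> mean_curvature (x t) / (((1 / t) *\<^sub>R y t) \<bullet> ((1 / t) *\<^sub>R y t))
       = (y' t \<bullet> mean_curvature (x t)) / (y t \<bullet> y t)"
      using elim(1) by (simp add: field_simps power2_eq_square)
    ultimately show ?case
      using eq unfolding curvature_defect_def by (metis times_divide_eq_right)
  qed
  have "?E \<xi> \<noteq> 0" using \<xi> frechet_norm[of \<xi>] by auto
  from tendsto_unique[OF _ tendsto_curvature_defect[OF x uU y2 y1 this] tendsto_eventually[OF inv]]
  show ?thesis by simp
qed

text \<open>
  The normal curvature \<open>b \<xi>\<close> in direction \<open>\<xi>\<close> solves the quadratic equation obtained in the limit, whose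
  coefficients do not depend on \<open>\<xi>\<close>. A continuous function with at most two values on the connected set
  of nonzero vectors is constant.
\<close>

lemma umbilic_at_pole:
  fixes M :: "(real^('n::finite option)) set"
  assumes n: "CARD('n) \<ge> 3" and CE: "curvature_equation M Q" and P: "local_parametrization M U \<phi>" and uU: "u \<in> U"
    and uQ: "\<phi> u = Q" and met: "induced_metric \<phi> u = mat 1"
    and \<nu>: "norm \<nu> = 1" "\<And>v. \<nu> \<bullet> D \<phi> u v = 0"
  obtains \<kappa> where "\<And>\<xi>. \<nu> \<bullet> D2 \<phi> u \<xi> \<xi> = 2 * \<kappa> * (\<xi> \<bullet> \<xi>)"
proof -
  interpret normal_frame U \<phi> u by (rule normal_frame_of_parametrization[OF P uU met])
  define N where "N = real CARD('n)"
  have N: "N \<ge> 3" using n by (simp add: N_def)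
  have \<nu>0: "\<nu> \<noteq> 0" and \<nu>1: "\<nu> \<bullet> \<nu> = 1" using \<nu>(1) by (auto simp: dot_square_norm)
  define \<eta> where "\<eta> = \<nu> \<bullet> mean_curvature u"
  define R where "R = scalar_coord met u"
  define b where "b = (\<lambda>\<xi>. (\<nu> \<bullet> D2 \<phi> u \<xi> \<xi>) / (\<xi> \<bullet> \<xi>))"
  have H: "mean_curvature u = \<eta> *\<^sub>R \<nu>"
    using normal_parallel[OF uU \<nu>0 \<nu>(2) mean_curvature_normal[OF uU]] by (simp add: \<eta>_def \<nu>1)
  have quad: "poly [:R, - 2 * (N - 1) * \<eta>, N * (N - 1):] (b \<xi>) = 0" if \<xi>: "\<xi> \<noteq> 0" for \<xi>
  proof -
    let ?h = "D2 \<phi> u \<xi> \<xi>"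
    have "normal_part u ?h = (\<nu> \<bullet> ?h) *\<^sub>R \<nu>"
      using normal_parallel[OF uU \<nu>0 \<nu>(2) normal_part_normal_frechet[OF uU], of ?h]
      by (simp add: \<nu>1 inner_normal_part[OF uU \<nu>(2)])
    then have "?h \<bullet> normal_part u ?h = (\<nu> \<bullet> ?h)\<^sup>2" by (simp add: inner_commute power2_eq_square)
    moreover have "?h \<bullet> mean_curvature u = \<eta> * (\<nu> \<bullet> ?h)" unfolding H by (simp add: inner_commute)
    ultimately have "4 * (N - 1) * (N * ((1/4) * (\<nu> \<bullet> ?h)\<^sup>2) / (\<xi> \<bullet> \<xi>)\<^sup>2 - (1/2) * (\<eta> * (\<nu> \<bullet> ?h)) / (\<xi> \<bullet> \<xi>)) + R = 0"
      using curvature_equation_at_pole[OF CE P uU uQ met \<xi>]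
      unfolding curvature_defect_def normal_part_scaleR frechet_inner by (simp add: N_def R_def)
    moreover have "\<nu> \<bullet> ?h = b \<xi> * (\<xi> \<bullet> \<xi>)" using \<xi> by (simp add: b_def)
    moreover have "4 * (N - 1) * (N * ((1/4) * (\<beta> * q)\<^sup>2) / q\<^sup>2 - (1/2) * (\<eta> * (\<beta> * q)) / q) + R
      = poly [:R, - 2 * (N - 1) * \<eta>, N * (N - 1):] \<beta>" if "q \<noteq> 0" for \<beta> q
      using that by (simp add: power_mult_distrib power2_eq_square algebra_simps)
    ultimately show ?thesis using \<xi> by (metis inner_eq_zero_iff)
  qed
  have "[:R, - 2 * (N - 1) * \<eta>, N * (N - 1):] \<noteq> 0" using N by simp
  then have "finite {x. poly [:R, - 2 * (N - 1) * \<eta>, N * (N - 1):] x = 0}" by (rule poly_roots_finite)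
  moreover have "b ` (- {0}) \<subseteq> {x. poly [:R, - 2 * (N - 1) * \<eta>, N * (N - 1):] x = 0}" using quad by auto
  ultimately have fin: "finite (b ` (- {0}))" by (rule rev_finite_subset)
  have cont: "continuous_on (- {0}) b"
    unfolding b_def second_derivative_partial[OF open_U uU smooth_phi]
    by (auto intro!: continuous_intros)
  have "connected (- {0 :: real^'n})" by (rule connected_punctured_universe) (use n in simp)
  then have "b constant_on (- {0})" using continuous_finite_range_constant cont fin by blast
  then obtain c where c: "\<And>\<xi>. \<xi> \<noteq> 0 \<Longrightarrow> b \<xi> = c" unfolding constant_on_def by auto
  have "\<nu> \<bullet> D2 \<phi> u \<xi> \<xi> = 2 * (c / 2) * (\<xi> \<bullet> \<xi>)" for \<xi>
  proof (cases "\<xi> = 0")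
    case True
    then show ?thesis using linear_0[OF linear_second_derivative(1)[OF open_U uU smooth_phi]] by simp
  next
    case False
    then show ?thesis using c[OF False] by (simp add: b_def field_simps)
  qed
  then show ?thesis by (rule that)
qed

text \<open>
  By Taylor expansion at the pole, \<open>(P - Q) \<bullet> \<nu>\<close> is \<open>\<kappa> |h|^2\<close> and \<open>|P - Q|^2\<close> is \<open>|h|^2\<close> to leading order in the
  coordinate displacement \<open>h\<close> of \<open>P\<close>.
\<close>

lemma quotient_tends_to_curvature:
  fixes M :: "(real^('n::finite option)) set"
  assumes P: "local_parametrization M U \<phi>" and uU: "u \<in> U" and uQ: "\<phi> u = Q" and met: "induced_metric \<phi> u = mat 1"
    and \<nu>: "norm \<nu> = 1" "\<And>v. \<nu> \<bullet> D \<phi> u v = 0"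
    and umb: "\<And>\<xi>. \<nu> \<bullet> D2 \<phi> u \<xi> \<xi> = 2 * \<kappa> * (\<xi> \<bullet> \<xi>)" and e: "e > 0"
  obtains d where "d > 0" "\<And>P. P \<in> M \<Longrightarrow> norm (P - Q) < d \<Longrightarrow>
    \<bar>(P - Q) \<bullet> \<nu> - \<kappa> * ((P - Q) \<bullet> (P - Q))\<bar> \<le> e * ((P - Q) \<bullet> (P - Q))"
proof -
  interpret normal_frame U \<phi> u by (rule normal_frame_of_parametrization[OF P uU met])
  let ?E = "D \<phi> u"
  \<comment> \<open>An error \<open>e1\<close> in both expansions leads to a total error of at most \<open>4 (1 + 3 |\<kappa>|) e1 |P - Q|^2\<close>.\<close>
  define e1 where "e1 = min (1/2) (e / (4 * (1 + 3 * \<bar>\<kappa>\<bar>)))"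
  have e1: "e1 > 0" "e1 \<le> 1/2" "e1 * (1 + 3 * \<bar>\<kappa>\<bar>) * 4 \<le> e"
  proof -
    show "e1 > 0" using e by (auto simp: e1_def add_pos_nonneg)
    show "e1 \<le> 1/2" unfolding e1_def by (rule min.cobounded1)
    have "e1 \<le> e / (4 * (1 + 3 * \<bar>\<kappa>\<bar>))" by (simp add: e1_def)
    moreover have "4 * (1 + 3 * \<bar>\<kappa>\<bar>) > 0" by (simp add: add_pos_nonneg)
    ultimately have "e1 * (4 * (1 + 3 * \<bar>\<kappa>\<bar>)) \<le> e" by (simp only: pos_le_divide_eq)
    then show "e1 * (1 + 3 * \<bar>\<kappa>\<bar>) * 4 \<le> e" by (simp add: algebra_simps)
  qed
  obtain d1 where d1: "d1 > 0" "\<And>h. norm h < d1 \<Longrightarrow> u + h \<in> U \<and>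
    norm (\<phi> (u + h) - \<phi> u - ?E h - (1/2) *\<^sub>R D2 \<phi> u h h) \<le> e1 * (norm h)\<^sup>2"
    using taylor_second_order[OF open_U uU smooth_phi e1(1)] by metis
  obtain d2 where d2: "d2 > 0" "\<And>x. norm (x - u) < d2 \<Longrightarrow> norm (\<phi> x - \<phi> u - ?E (x - u)) \<le> e1 * norm (x - u)"
    using has_frechet_derivative[OF phi_differentiable[OF uU]] e1(1) unfolding has_derivative_at_alt by blast
  obtain \<psi> where \<psi>: "homeomorphism U (\<phi> ` U) \<phi> \<psi>"
    using P unfolding local_parametrization_def by blast
  obtain O1 where O1: "open O1" "\<phi> ` U = M \<inter> O1"
    using P unfolding local_parametrization_def openin_open by blast
  have QU: "Q \<in> \<phi> ` U" using uU uQ by blast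
  then obtain r where r: "r > 0" "ball Q r \<subseteq> O1" using O1 open_contains_ball by blast
  have \<psi>Q: "\<psi> Q = u" using homeomorphism_apply1[OF \<psi> uU] uQ by simp
  have "min d1 d2 > 0" using d1 d2 by simp
  then obtain r' where r': "r' > 0" "\<And>P. P \<in> \<phi> ` U \<Longrightarrow> dist P Q < r' \<Longrightarrow> dist (\<psi> P) (\<psi> Q) < min d1 d2"
    using homeomorphism_cont2[OF \<psi>] QU unfolding continuous_on_iff by metis
  show ?thesis
  proof (rule that[of "min r r'"])
    show "min r r' > 0" using r r' by simp
    fix P assume PM: "P \<in> M" and PQ: "norm (P - Q) < min r r'"
    have "P \<in> O1" using r(2) PQ by (auto simp: dist_norm norm_minus_commute)
    then have PU: "P \<in> \<phi> ` U" using O1 PM by blast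
    define h where "h = \<psi> P - u"
    have hd: "norm h < d1" "norm h < d2"
      using r'(2)[OF PU] PQ \<psi>Q by (auto simp: h_def dist_norm)
    have \<phi>h: "\<phi> (u + h) = P" using homeomorphism_apply2[OF \<psi> PU] by (simp add: h_def)
    define y where "y = P - Q"
    have t2: "norm (y - ?E h - (1/2) *\<^sub>R D2 \<phi> u h h) \<le> e1 * (norm h)\<^sup>2"
      using d1(2)[OF hd(1)] by (simp add: \<phi>h uQ y_def)
    have t1: "norm (y - ?E h) \<le> e1 * norm h"
      using d2(2)[of "u + h"] hd(2) by (simp add: \<phi>h uQ y_def)
    define A where "A = norm y"
    define B where "B = norm h"
    have "\<bar>\<nu> \<bullet> (y - ?E h - (1/2) *\<^sub>R D2 \<phi> u h h)\<bar> \<le> e1 * B\<^sup>2"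
      using Cauchy_Schwarz_ineq2[of \<nu> "y - ?E h - (1/2) *\<^sub>R D2 \<phi> u h h"] t2 \<nu>(1) by (simp add: B_def)
    then have 1: "\<bar>y \<bullet> \<nu> - \<kappa> * B\<^sup>2\<bar> \<le> e1 * B\<^sup>2"
      by (simp add: inner_diff_right \<nu>(2) umb inner_commute[of \<nu> y] B_def dot_square_norm)
    have AB: "\<bar>A - B\<bar> \<le> e1 * B"
      using norm_triangle_ineq3[of y "?E h"] t1 by (simp add: A_def B_def frechet_norm)
    have B0: "B \<ge> 0" "A \<ge> 0" by (auto simp: A_def B_def)
    have "e1 * B \<le> (1/2) * B" using e1 B0 by (intro mult_right_mono) auto
    then have BA: "B \<le> 2 * A" "A \<le> 2 * B" using AB B0 by auto
    have "\<bar>A\<^sup>2 - B\<^sup>2\<bar> = \<bar>A - B\<bar> * (A + B)"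
      using B0 by (simp add: power2_eq_square square_diff_square_factored abs_mult)
    also have "\<dots> \<le> (e1 * B) * (3 * B)"
      using AB BA B0 e1 by (intro mult_mono) auto
    finally have 2: "\<bar>A\<^sup>2 - B\<^sup>2\<bar> \<le> 3 * e1 * B\<^sup>2" by (simp add: power2_eq_square)
    have "\<bar>y \<bullet> \<nu> - \<kappa> * A\<^sup>2\<bar> \<le> \<bar>y \<bullet> \<nu> - \<kappa> * B\<^sup>2\<bar> + \<bar>\<kappa>\<bar> * \<bar>A\<^sup>2 - B\<^sup>2\<bar>"
    proof -
      have "y \<bullet> \<nu> - \<kappa> * A\<^sup>2 = (y \<bullet> \<nu> - \<kappa> * B\<^sup>2) - \<kappa> * (A\<^sup>2 - B\<^sup>2)" by (simp add: algebra_simps)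
      then show ?thesis by (metis abs_mult abs_triangle_ineq4)
    qed
    also have "\<dots> \<le> e1 * B\<^sup>2 + \<bar>\<kappa>\<bar> * (3 * e1 * B\<^sup>2)"
      using 1 2 by (intro add_mono mult_left_mono) auto
    also have "\<dots> = e1 * (1 + 3 * \<bar>\<kappa>\<bar>) * B\<^sup>2" by (simp add: algebra_simps)
    also have "\<dots> \<le> e1 * (1 + 3 * \<bar>\<kappa>\<bar>) * (2 * A)\<^sup>2"
      using BA B0 e1 by (intro mult_left_mono power_mono) auto
    also have "\<dots> = e1 * (1 + 3 * \<bar>\<kappa>\<bar>) * 4 * A\<^sup>2" by (simp add: power_mult_distrib)
    also have "\<dots> \<le> e * A\<^sup>2" using e1(3) by (intro mult_right_mono) auto
    finally show "\<bar>(P - Q) \<bullet> \<nu> - \<kappa> * ((P - Q) \<bullet> (P - Q))\<bar> \<le> e * ((P - Q) \<bullet> (P - Q))"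
      by (simp add: A_def y_def dot_square_norm)
  qed
qed

section \<open>Closed hypersurfaces inside spheres and hyperplanes\<close>

text \<open>
  The image of \<open>M\<close> would be compact, and open by invariance of domain.
\<close>

lemma hypersurface_not_embeddable:
  fixes M :: "(real^('n::finite option)) set"
  assumes M: "closed_embedded_hypersurface M" "M \<noteq> {}" and MS: "M \<subseteq> S"
    and S: "S homeomorphic (UNIV :: (real^'n) set)"
  shows False
proof -
  obtain f g where fg: "homeomorphism S (UNIV :: (real^'n) set) f g"
    using S unfolding homeomorphic_def by blast
  have cf: "continuous_on M f" using homeomorphism_cont1[OF fg] MS continuous_on_subset by blast
  have comp: "compact (f ` M)"
    using M cf by (intro compact_continuous_image) (auto simp: closed_embedded_hypersurface_def)
  have "open (f ` M)"
  proof (rule open_subopen[THEN iffD2], rule ballI)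
    fix x assume "x \<in> f ` M"
    then obtain p where p: "p \<in> M" "x = f p" by blast
    obtain U \<phi> where P: "local_parametrization M U \<phi>" "p \<in> \<phi> ` U"
      using M(1) p(1) unfolding closed_embedded_hypersurface_def by blast
    obtain \<psi> where \<psi>: "homeomorphism U (\<phi> ` U) \<phi> \<psi>"
      using P unfolding local_parametrization_def by blast
    have sub: "\<phi> ` U \<subseteq> M" using parametrization_in[OF P(1)] by blast
    have "open ((\<lambda>u. f (\<phi> u)) ` U)"
    proof (rule invariance_of_domain)
      show "continuous_on U (\<lambda>u. f (\<phi> u))"
        by (rule continuous_on_compose2[OF cf homeomorphism_cont1[OF \<psi>] sub])
      show "open U" using P unfolding local_parametrization_def by blast
      show "inj_on (\<lambda>u. f (\<phi> u)) U"
      proof (rule inj_onI)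
        fix v w assume vw: "v \<in> U" "w \<in> U" "f (\<phi> v) = f (\<phi> w)"
        have "\<phi> v \<in> S" "\<phi> w \<in> S" using vw sub MS by blast+
        then have "\<phi> v = \<phi> w" using vw(3) homeomorphism_apply1[OF fg] by metis
        then show "v = w" using vw homeomorphism_apply1[OF \<psi>] by metis
      qed
    qed
    moreover have "x \<in> (\<lambda>u. f (\<phi> u)) ` U" "(\<lambda>u. f (\<phi> u)) ` U \<subseteq> f ` M" using P(2) p(2) sub by blast+
    ultimately show "\<exists>T. open T \<and> x \<in> T \<and> T \<subseteq> f ` M" by blast
  qed
  moreover have "closed (f ` M)" using comp by (rule compact_imp_closed)
  ultimately have "f ` M = {} \<or> f ` M = UNIV" using clopen[of "f ` M"] by simp
  then have "f ` M = UNIV" using M(2) by simp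
  then show False using comp not_compact_UNIV by metis
qed

text \<open>
  The equation describes a hyperplane for \<open>\<kappa> = 0\<close> and otherwise a sphere through \<open>Q\<close>. Hyperplanes and
  spheres without a point are homeomorphic to Euclidean space, so \<open>M\<close> is contained in neither.
\<close>

lemma hypersurface_in_quadric:
  fixes M :: "(real^('n::finite option)) set"
  assumes M: "closed_embedded_hypersurface M" "Q \<in> M" and \<nu>: "norm \<nu> = 1"
    and eq: "\<And>P. P \<in> M \<Longrightarrow> (P - Q) \<bullet> \<nu> = \<kappa> * ((P - Q) \<bullet> (P - Q))"
  shows "\<exists>c r. r > 0 \<and> M = sphere c r"
proof (cases "\<kappa> = 0")
  case True
  have \<nu>0: "\<nu> \<noteq> 0" using \<nu> by auto
  have "M \<subseteq> {x. \<nu> \<bullet> x = \<nu> \<bullet> Q}"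
  proof
    fix P assume "P \<in> M"
    then have "(P - Q) \<bullet> \<nu> = 0" using eq True by simp
    then show "P \<in> {x. \<nu> \<bullet> x = \<nu> \<bullet> Q}" by (simp add: inner_diff_left inner_commute[of \<nu>])
  qed
  moreover have "{x. \<nu> \<bullet> x = \<nu> \<bullet> Q} homeomorphic (UNIV :: (real^'n) set)"
    using \<nu>0 by (intro homeomorphic_affine_sets affine_hyperplane affine_UNIV) simp
  ultimately have False using hypersurface_not_embeddable[OF M(1)] M(2) by blast
  then show ?thesis ..
next
  case False
  define c where "c = Q + (1 / (2 * \<kappa>)) *\<^sub>R \<nu>"
  define r where "r = 1 / (2 * \<bar>\<kappa>\<bar>)"
  have r: "r > 0" using False by (simp add: r_def)
  have sub: "M \<subseteq> sphere c r"
  proof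
    fix P assume P: "P \<in> M"
    have "(norm (P - c))\<^sup>2 = (P - Q - (1 / (2 * \<kappa>)) *\<^sub>R \<nu>) \<bullet> (P - Q - (1 / (2 * \<kappa>)) *\<^sub>R \<nu>)"
      by (simp add: c_def dot_square_norm diff_diff_eq)
    also have "\<dots> = (P - Q) \<bullet> (P - Q) - (1 / \<kappa>) * ((P - Q) \<bullet> \<nu>) + (1 / (2 * \<kappa>))\<^sup>2"
    proof -
      have "(a - k *\<^sub>R \<nu>) \<bullet> (a - k *\<^sub>R \<nu>) = a \<bullet> a - 2 * k * (a \<bullet> \<nu>) + k\<^sup>2" for a k
      proof -
        have "\<nu> \<bullet> \<nu> = 1" using \<nu> by (simp add: dot_square_norm)
        then show ?thesis
          by (simp add: inner_diff_left inner_diff_right inner_commute[of \<nu> a] power2_eq_square right_diff_distrib)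
      qed
      from this[of "P - Q" "1 / (2 * \<kappa>)"] show ?thesis by simp
    qed
    also have "\<dots> = r\<^sup>2" using False by (simp add: eq[OF P] r_def power_divide power_mult_distrib)
    finally have "norm (P - c) = r" using r by (simp add: power2_eq_iff_nonneg)
    then show "P \<in> sphere c r" by (simp add: dist_norm norm_minus_commute)
  qed
  have "M = sphere c r"
  proof (rule ccontr)
    assume "M \<noteq> sphere c r"
    then obtain b where b: "b \<in> sphere c r" "b \<notin> M" using sub by blast
    have "(sphere c r - {b}) homeomorphic (UNIV :: (real^'n) set)"
    proof (rule homeomorphic_trans)
      have \<nu>0: "\<nu> \<noteq> 0" using \<nu> by auto
      show "sphere c r - {b} homeomorphic {x. \<nu> \<bullet> x = 0}"
        by (rule homeomorphic_punctured_sphere_hyperplane[OF r b(1) \<nu>0])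
      show "{x. \<nu> \<bullet> x = 0} homeomorphic (UNIV :: (real^'n) set)"
        using \<nu>0 by (intro homeomorphic_affine_sets affine_hyperplane affine_UNIV) simp
    qed
    moreover have "M \<subseteq> sphere c r - {b}" using sub b by blast
    ultimately show False using hypersurface_not_embeddable[OF M(1)] M(2) by blast
  qed
  then show ?thesis using r by blast
qed

theorem theorem1:
  fixes M :: "(real^('n::finite option)) set"
    and vol :: "(real^('n option)) measure"
    and G :: "real^('n option) \<Rightarrow> real^('n option) \<Rightarrow> real"
  assumes "CARD('n) \<ge> 3"
    and "closed_embedded_hypersurface M"
    and "riemannian_volume M vol"
    and "green_function M vol G"
    and "\<exists>Q\<in>M. \<forall>P\<in>M - {Q}.
           G P Q = Gamma (real CARD('n) / 2 - 1) / (4 * pi powr (real CARD('n) / 2))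
                   * norm (P - Q) powr (2 - real CARD('n))"
  shows "\<exists>c r. r > 0 \<and> M = sphere c r"
proof -
  define k where "k = Gamma (real CARD('n) / 2 - 1) / (4 * pi powr (real CARD('n) / 2))"
  obtain Q where Q: "Q \<in> M" "\<And>P. P \<in> M \<Longrightarrow> P \<noteq> Q \<Longrightarrow> G P Q = k * norm (P - Q) powr (2 - real CARD('n))"
    using assms(5) unfolding k_def by blast
  have "Gamma (real CARD('n) / 2 - 1) > 0" by (rule Gamma_real_pos) (use assms(1) in simp)
  then have k: "k \<noteq> 0" by (simp add: k_def)
  have CE: "curvature_equation M Q"
    unfolding curvature_equation_def
    using green_function_curvature_equation[OF assms(1-4) Q(1) k Q(2)] by blast
  obtain U \<phi> u where c: "local_parametrization M U \<phi>" "u \<in> U" "\<phi> u = Q" "induced_metric \<phi> u = mat 1"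
    using normalized_chart[OF assms(2) Q(1)] by metis
  interpret normal_frame U \<phi> u by (rule normal_frame_of_parametrization[OF c(1,2,4)])
  obtain \<nu> where \<nu>: "norm \<nu> = 1" "\<And>v. \<nu> \<bullet> D \<phi> u v = 0"
    using unit_normal_exists[OF c(2)] by metis
  obtain \<kappa> where umb: "\<And>\<xi>. \<nu> \<bullet> D2 \<phi> u \<xi> \<xi> = 2 * \<kappa> * (\<xi> \<bullet> \<xi>)"
    using umbilic_at_pole[OF assms(1) CE c \<nu>] by metis
  have n2: "CARD('n) \<ge> 2" using assms(1) by simp
  \<comment> \<open>The maximum principle is applied to both orientations \<open>\<sigma> = 1\<close> and \<open>\<sigma> = - 1\<close> of the normal.\<close>
  have bound: "(P - Q) \<bullet> (\<sigma> *\<^sub>R \<nu>) \<le> (\<sigma> * \<kappa>) * ((P - Q) \<bullet> (P - Q))" if "P \<in> M" "\<bar>\<sigma>\<bar> = 1" for P \<sigma>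
  proof (rule quotient_bound[OF n2 assms(2) CE _ that(1)])
    fix e :: real assume "e > 0"
    then obtain d where d: "d > 0" "\<And>P. P \<in> M \<Longrightarrow> norm (P - Q) < d \<Longrightarrow>
      \<bar>(P - Q) \<bullet> \<nu> - \<kappa> * ((P - Q) \<bullet> (P - Q))\<bar> \<le> e * ((P - Q) \<bullet> (P - Q))"
      using quotient_tends_to_curvature[OF c \<nu> umb] by metis
    have "(P - Q) \<bullet> (\<sigma> *\<^sub>R \<nu>) \<le> (\<sigma> * \<kappa> + e) * ((P - Q) \<bullet> (P - Q))" if P: "P \<in> M" "norm (P - Q) < d" for P
    proof -
      have "\<sigma> * a \<le> \<bar>a\<bar>" for a using abs_ge_self[of "\<sigma> * a"] \<open>\<bar>\<sigma>\<bar> = 1\<close> by (simp add: abs_mult)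
      from order_trans[OF this d(2)[OF P]] show ?thesis
        by (simp add: right_diff_distrib distrib_right mult.assoc)
    qed
    then show "\<exists>d>0. \<forall>P\<in>M. norm (P - Q) < d \<longrightarrow> (P - Q) \<bullet> (\<sigma> *\<^sub>R \<nu>) \<le> (\<sigma> * \<kappa> + e) * ((P - Q) \<bullet> (P - Q))"
      using d(1) by blast
  qed
  have "(P - Q) \<bullet> \<nu> = \<kappa> * ((P - Q) \<bullet> (P - Q))" if "P \<in> M" for P
    using bound[OF that, of 1] bound[OF that, of "- 1"] by simp
  then show ?thesis by (rule hypersurface_in_quadric[OF assms(2) Q(1) \<nu>(1)])
qed

end
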